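(* Let $C_{n,w}$ be the number of $w$-NAFs of length $n\in\mathbb N_0$. Then \[ C_{n,w}=\frac{1}{(|N(\tau)|-1)w+1}|N(\tau)|^{n+w}+O\bigl((\rho|N(\tau)|)^n\bigr),\qquad \rho=\Bigl(1+\frac{1}{|N(\tau)|w^3}\Bigr)^{-1}<1. \] Let $0\ne\eta\in\mathcal D$ and let $X_{n,w,\eta}$ be the number of occurrences of $\eta$ in a $w$-NAF of length $n$ chosen uniformly at random. Then, writing $M=|N(\tau)|$, \[ \mathbb E(X_{n,w,\eta})=e_wn+\frac{(M-1)(w-1)w}{M^{w-1}((M-1)w+1)^2}+O(n\rho^n), \] \[ \mathbb V(X_{n,w,\eta})=v_wn+\frac{(w-1)w\bigl(-(w-1)^2-M^2w^2+(M-1)M^{w-1}((M-1)w+1)^2+2M(w^2-w+1)\bigr)}{M^{2w-2}((M-1)w+1)^4}+O(n^2\rho^n), \] where \[ e_w=\frac{1}{M^{w-1}((M-1)w+1)},\qquad v_w=\frac{M^{w-1}((M-1)w+1)^2-\bigl((M-1)w^2+2w-1\bigr)}{M^{2w-2}((M-1)w+1)^3}. \] Moreover \[ \mathbb P\Bigl(\frac{X_{n,w,\eta}-e_wn}{\sqrt{v_wn}}\le x\Bigr)=\Phi(x)+O\Bigl(\frac1{\sqrt n}\Bigr) \] uniformly in $x\in\mathbb R$, where $\Phi(x)=(2\pi)^{-1/2}\int_{t\le x}e^{-t^2/2}\,dt$.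
   Context: Let $\tau\in\mathbb C$ be an algebraic integer with $|\tau|>1$, let $N(\tau)$ denote its norm, and let $w\ge2$ be an integer. $\mathcal D\subseteq\mathbb Z[\tau]$ is a reduced residue digit set modulo $\tau^w$: it consists of $0$ and exactly one representative of each residue class of $\mathbb Z[\tau]$ modulo $\tau^w$ that is not divisible by $\tau$. A $w$-NAF of length $n$ is a word $\eta_{n-1}\dots\eta_1\eta_0$ with digits in $\mathcal D$ (leading zeros allowed, i.e. all $w$-NAFs with $\eta_j=0$ for $j<0$ and $j\ge n$) such that every block of $w$ consecutive digits contains at most one nonzero digit. *)

theory Defs
  imports
    "HOL-Probability.Probability"
    "HOL-Library.Landau_Symbols"
    "HOL-Computational_Algebra.Computational_Algebra"
begin

definition min_poly :: "complex \<Rightarrow> rat poly" where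
  "min_poly x = (THE p. lead_coeff p = 1 \<and> irreducible p \<and> poly (map_poly of_rat p) x = 0)"

text \<open>The norm of \<open>x\<close> with respect to the extension \<open>\<rat>(x)/\<rat>\<close>, i.e. the product of the conjugates
  of \<open>x\<close>. The minimal polynomial is separable, so each conjugate is a simple root.\<close>

definition alg_norm :: "complex \<Rightarrow> complex" where
  "alg_norm x = \<Prod> {z. poly (map_poly of_rat (min_poly x)) z = 0}"

text \<open>The ring \<open>\<int>[\<tau>]\<close>.\<close>

definition int_adjoin :: "complex \<Rightarrow> complex set" where
  "int_adjoin \<tau> = range (\<lambda>p :: int poly. poly (map_poly of_int p) \<tau>)"

text \<open>Divisibility of \<open>b\<close> by \<open>a\<close> in \<open>\<int>[\<tau>]\<close>; the overloaded \<^term>\<open>(dvd)\<close> on type \<^typ>\<open>complex\<close> would be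
  divisibility in the field of complex numbers.\<close>

definition adjoin_dvd :: "complex \<Rightarrow> complex \<Rightarrow> complex \<Rightarrow> bool" where
  "adjoin_dvd \<tau> a b \<longleftrightarrow> (\<exists>c\<in>int_adjoin \<tau>. b = a * c)"

definition reduced_residue_digit_set :: "complex \<Rightarrow> nat \<Rightarrow> complex set \<Rightarrow> bool" where
  "reduced_residue_digit_set \<tau> w D \<longleftrightarrow>
     D \<subseteq> int_adjoin \<tau> \<and> 0 \<in> D \<and>
     (\<forall>d\<in>D - {0}. \<not> adjoin_dvd \<tau> \<tau> d) \<and>
     (\<forall>z\<in>int_adjoin \<tau>. \<not> adjoin_dvd \<tau> \<tau> z \<longrightarrow>
        (\<exists>!d. d \<in> D - {0} \<and> adjoin_dvd \<tau> (\<tau> ^ w) (z - d)))"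

text \<open>Words are two-sided sequences of digits; a word of length \<open>n\<close> vanishes outside the positions
  \<open>0, \<dots>, n - 1\<close>. In particular, for \<open>n < w\<close> a \<open>w\<close>-NAF of length \<open>n\<close> has at most one nonzero digit.\<close>

definition is_wNAF :: "complex set \<Rightarrow> nat \<Rightarrow> (int \<Rightarrow> complex) \<Rightarrow> bool" where
  "is_wNAF D w \<eta> \<longleftrightarrow>
     (\<forall>j. \<eta> j \<in> D) \<and> (\<forall>i. card {j \<in> {i..<i + int w}. \<eta> j \<noteq> 0} \<le> 1)"

definition wNAFs :: "complex set \<Rightarrow> nat \<Rightarrow> nat \<Rightarrow> (int \<Rightarrow> complex) set" where
  "wNAFs D w n = {\<eta>. is_wNAF D w \<eta> \<and> (\<forall>j. j < 0 \<or> j \<ge> int n \<longrightarrow> \<eta> j = 0)}"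

definition wNAF_count :: "complex set \<Rightarrow> nat \<Rightarrow> nat \<Rightarrow> nat" where
  "wNAF_count D w n = card (wNAFs D w n)"

definition random_wNAF :: "complex set \<Rightarrow> nat \<Rightarrow> nat \<Rightarrow> (int \<Rightarrow> complex) pmf" where
  "random_wNAF D w n = pmf_of_set (wNAFs D w n)"

definition occurrences :: "nat \<Rightarrow> complex \<Rightarrow> (int \<Rightarrow> complex) \<Rightarrow> real" where
  "occurrences n d \<eta> = real (card {j \<in> {0..<int n}. \<eta> j = d})"

definition rho :: "real \<Rightarrow> nat \<Rightarrow> real" where
  "rho M w = inverse (1 + 1 / (M * real w ^ 3))"

definition e_coeff :: "real \<Rightarrow> nat \<Rightarrow> real" where
  "e_coeff M w = 1 / (M ^ (w - 1) * ((M - 1) * real w + 1))"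

definition v_coeff :: "real \<Rightarrow> nat \<Rightarrow> real" where
  "v_coeff M w =
     (M ^ (w - 1) * ((M - 1) * real w + 1)\<^sup>2 - ((M - 1) * (real w)\<^sup>2 + 2 * real w - 1))
     / (M ^ (2 * w - 2) * ((M - 1) * real w + 1) ^ 3)"

definition std_normal_Phi :: "real \<Rightarrow> real" where
  "std_normal_Phi x = 1 / sqrt (2 * pi) * (LBINT t:{..x}. exp (- (t\<^sup>2) / 2))"

end

theory Submission
  imports Defs "HOL-Complex_Analysis.Complex_Analysis" "HOL-Real_Asymp.Real_Asymp"
begin

text \<open>
  Writing \<open>M = |N(\<tau>)|\<close>, the quotient \<open>\<int>[\<tau>] / \<tau>\<close> is \<open>\<int> / M\<close>. The nonzero digits together with \<open>\<tau>\<close>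
  times the residues modulo \<open>\<tau>\<^bsup>w-1\<^esup>\<close> represent every residue class modulo \<open>\<tau>\<^bsup>w\<^esup>\<close> once, so there are
  \<open>N = (M - 1) M\<^bsup>w-1\<^esup>\<close> nonzero digits. Splitting off the leading digit, the generating polynomial of the
  occurrences of \<open>\<eta>\<close> satisfies \<open>P\<^bsub>n+1\<^esub>(y) = P\<^bsub>n\<^esub>(y) + (N - 1 + y) P\<^bsub>n+1-w\<^esub>(y)\<close>.

  The counts and the first two factorial moments are therefore coefficients of \<open>t\<close>, \<open>t\<^sup>2\<close> and \<open>t\<^sup>3\<close>,
  where after rescaling \<open>t(u) = 1 / ((1 - u) q(u))\<close> with
  \<open>q(u) = 1/M + (M - 1)/M (1 + u + \<dots> + u\<^bsup>w-1\<^esup>)\<close>. All zeros of \<open>q\<close> have modulus greater than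
  \<open>1 + 1 / (M w\<^sup>3)\<close>, so the main terms are the polar parts at \<open>u = 1\<close>.

  For the central limit theorem, \<open>P\<^sub>n\<close> has only real, negative zeros: if \<open>y\<close> is not real, the ratios
  of nearby terms of the recursion stay in the cone spanned by \<open>1\<close> and \<open>N - 1 + y\<close>, which excludes \<open>0\<close>.
  Hence the number of occurrences is distributed as a sum of independent Bernoulli variables, and
  Fourier inversion on \<open>[-\<pi>, \<pi>]\<close>, which is exact for integer-valued variables, compares its
  distribution function with the normal one.
\<close>

section \<open>Minimal polynomials of algebraic integers\<close>

lemma map_poly_hom_add:
  assumes "h 0 = 0" "\<And>a b. h (a + b) = h a + h b"
  shows "map_poly h (p + q) = map_poly h p + map_poly h q"
  by (rule poly_eqI) (simp add: coeff_map_poly assms)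

lemma map_poly_hom_mult:
  fixes h :: "'a::comm_semiring_0 \<Rightarrow> 'b::comm_semiring_0"
  assumes "h 0 = 0" "\<And>a b. h (a + b) = h a + h b" "\<And>a b. h (a * b) = h a * h b"
  shows "map_poly h (p * q) = map_poly h p * map_poly h q"
proof (rule poly_eqI)
  fix n
  have "h (\<Sum>i\<le>n. coeff p i * coeff q (n - i)) = (\<Sum>i\<le>n. h (coeff p i * coeff q (n - i)))"
    by (rule sum_comp_morphism[symmetric, unfolded o_def, OF assms(1,2)])
  thus "coeff (map_poly h (p * q)) n = coeff (map_poly h p * map_poly h q) n"
    by (simp add: coeff_mult coeff_map_poly assms)
qed

abbreviation of_int_poly :: "int poly \<Rightarrow> 'a::ring_1 poly" where
  "of_int_poly \<equiv> map_poly of_int"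

abbreviation of_rat_poly :: "rat poly \<Rightarrow> 'a::field_char_0 poly" where
  "of_rat_poly \<equiv> map_poly of_rat"

lemma of_int_poly_hom [simp]:
  fixes p q :: "int poly"
  shows "(of_int_poly (p + q) :: 'a::comm_ring_1 poly) = of_int_poly p + of_int_poly q"
    and "(of_int_poly (p - q) :: 'a poly) = of_int_poly p - of_int_poly q"
    and "(of_int_poly (p * q) :: 'a poly) = of_int_poly p * of_int_poly q"
    and "(of_int_poly (smult c p) :: 'a poly) = smult (of_int c) (of_int_poly p)"
    and "(of_int_poly (pCons c p) :: 'a poly) = pCons (of_int c) (of_int_poly p)"
  by (rule poly_eqI; simp add: map_poly_hom_mult coeff_map_poly coeff_pCons split: nat.splits)+

lemma of_int_poly_pderiv [simp]: "of_int_poly (pderiv p) = (pderiv (of_int_poly p) :: 'a::idom poly)"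
  by (rule poly_eqI) (simp add: coeff_map_poly coeff_pderiv)

lemma degree_of_int_poly [simp]: "degree (of_int_poly p :: 'a::ring_char_0 poly) = degree p"
  by (rule degree_map_poly) auto

lemma of_rat_poly_hom [simp]:
  "of_rat_poly (p + q) = of_rat_poly p + of_rat_poly q"
  "of_rat_poly (p * q) = of_rat_poly p * of_rat_poly q"
  "of_rat_poly (smult c p) = smult (of_rat c) (of_rat_poly p)"
  by (rule poly_eqI; simp add: map_poly_hom_mult coeff_map_poly of_rat_add of_rat_mult)+

lemma of_rat_poly_of_int_poly [simp]: "of_rat_poly (of_int_poly p) = of_int_poly p"
  by (subst map_poly_map_poly) (simp_all add: o_def)

lemma rat_poly_clear_denominators:
  fixes p :: "rat poly"
  obtains c :: int and q :: "int poly"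
  where "c \<noteq> 0" "smult (of_int c) p = of_int_poly q"
proof -
  have "\<exists>c q. c \<noteq> 0 \<and> smult (of_int c) p = of_int_poly q"
  proof (induction p)
    case 0
    show ?case by (intro exI[of _ 1] exI[of _ 0]) simp
  next
    case (pCons a p)
    then obtain c q where cq: "c \<noteq> 0" "smult (of_int c) p = of_int_poly q"
      by blast
    obtain n d where nd: "quotient_of a = (n, d)" by fastforce
    have d: "d > 0" "a = of_int n / of_int d"
      using quotient_of_denom_pos[OF nd] quotient_of_div[OF nd] by auto
    have "smult (of_int (c * d)) p = smult (of_int d) (smult (of_int c) p)"
      by (simp add: mult.commute)
    also have "\<dots> = of_int_poly (smult d q)" using cq(2) by simp
    finally have "smult (of_int (c * d)) (pCons a p) = of_int_poly (pCons (c * n) (smult d q))"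
      using d by simp
    with cq d show ?case by (metis less_irrefl mult_eq_0_iff)
  qed
  with that show ?thesis by blast
qed

lemma primitive_dvd_smultD:
  fixes g p :: "int poly"
  assumes "content g = 1" "a \<noteq> 0" "g dvd smult a p"
  shows "g dvd p"
proof -
  obtain q where q: "smult a p = g * q" using assms(3) by blast
  have "content q = normalize a * content p"
    using arg_cong[OF q, of content] assms(1) by (simp add: content_mult)
  hence "[:a:] dvd q" by (simp add: const_poly_dvd_iff_dvd_content)
  then obtain r where "q = smult a r" by (auto elim!: dvdE)
  hence "smult a p = smult a (g * r)" using q by simp
  hence "p = g * r" using assms(2) by (metis smult_cancel)
  thus ?thesis by simp
qed

definition is_min_int_poly :: "complex \<Rightarrow> int poly \<Rightarrow> bool" where
  "is_min_int_poly x f \<longleftrightarrow> lead_coeff f = 1 \<and> (\<forall>p. poly (of_int_poly p) x = 0 \<longleftrightarrow> f dvd p)"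

lemma ex_primitive_int_poly_dvd_iff_root:
  fixes x :: complex
  assumes "poly (of_int_poly p) x = 0" "p \<noteq> 0"
  obtains g :: "int poly" where "content g = 1" "\<And>q. poly (of_int_poly q) x = 0 \<longleftrightarrow> g dvd q"
proof -
  let ?root = "\<lambda>q :: int poly. poly (of_int_poly q) x = 0"
  obtain h where h: "h \<noteq> 0" "?root h" and h_min: "\<And>q. q \<noteq> 0 \<Longrightarrow> ?root q \<Longrightarrow> degree h \<le> degree q"
    using ex_has_least_nat[of "\<lambda>q. q \<noteq> 0 \<and> ?root q" p degree] assms by metis
  define g where "g = primitive_part h"
  have hg: "h = smult (content h) g" by (simp add: g_def)
  have g: "g \<noteq> 0" "content g = 1" "degree g = degree h" using h by (auto simp: g_def)
  have "?root (smult (content h) g)" using h(2) hg by metis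
  hence g_root: "?root g" using h(1) by simp
  have "g dvd q" if "?root q" for q
  proof -
    obtain a r where ar: "a \<noteq> 0" "smult a q = g * r + pseudo_mod q g"
      using pseudo_mod(1)[OF g(1)] by blast
    have "?root (pseudo_mod q g)"
      using arg_cong[OF ar(2), of "\<lambda>p. poly (of_int_poly p) x"] that g_root by simp
    hence "pseudo_mod q g = 0"
      using pseudo_mod(2)[OF g(1), of q] h_min[of "pseudo_mod q g"] g(3) by fastforce
    hence "g dvd smult a q" using ar(2) by simp
    thus ?thesis by (rule primitive_dvd_smultD[OF g(2) ar(1)])
  qed
  moreover have "?root q" if "g dvd q" for q using that g_root by auto
  ultimately show ?thesis using that[OF g(2)] by blast
qed

lemma algebraic_int_imp_min_int_poly:
  assumes "algebraic_int (x :: complex)"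
  obtains f where "is_min_int_poly x f"
proof -
  obtain F :: "int poly" where F: "poly (of_int_poly F) x = 0" "lead_coeff F = 1"
    using assms unfolding algebraic_int_altdef_ipoly by blast
  from F(2) have "F \<noteq> 0" by auto
  then obtain g where g: "\<And>q. poly (of_int_poly q) x = 0 \<longleftrightarrow> g dvd q"
    using ex_primitive_int_poly_dvd_iff_root[OF F(1)] by metis
  then obtain q where "F = g * q" using F(1) by blast
  hence "lead_coeff g * lead_coeff q = 1" using F(2) by (simp add: lead_coeff_mult)
  hence "\<bar>lead_coeff g\<bar> = 1" by (metis dvd_triv_left zdvd1_eq)
  hence "lead_coeff g = 1 \<or> lead_coeff (- g) = 1" by (simp add: abs_if split: if_splits)
  thus ?thesis
    using that[of g] that[of "- g"] unfolding is_min_int_poly_def g by fastforce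
qed

lemma rat_poly_root_iff_dvd:
  assumes f: "is_min_int_poly x f"
  shows "poly (of_rat_poly p) x = 0 \<longleftrightarrow> of_int_poly f dvd p"
proof
  assume root: "poly (of_rat_poly p) x = 0"
  obtain c q where cq: "c \<noteq> 0" "smult (of_int c) p = of_int_poly q"
    by (rule rat_poly_clear_denominators)
  have "poly (of_int_poly q) x = 0"
    using arg_cong[OF cq(2), of "\<lambda>p. poly (of_rat_poly p) x"] root by simp
  hence "f dvd q" using f by (simp add: is_min_int_poly_def)
  hence "of_int_poly f dvd smult (of_int c) p" unfolding cq(2) by auto
  thus "of_int_poly f dvd p" using cq(1) by (simp add: dvd_smult_iff)
next
  assume "of_int_poly f dvd p"
  then obtain q where "p = of_int_poly f * q" by blast
  thus "poly (of_rat_poly p) x = 0" using f by (simp add: is_min_int_poly_def)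
qed

lemma irreducible_min_int_poly:
  assumes f: "is_min_int_poly x f"
  shows "irreducible (of_int_poly f :: rat poly)"
proof (rule prime_elem_imp_irreducible, rule prime_elemI)
  show "(of_int_poly f :: rat poly) \<noteq> 0" using f by (auto simp: is_min_int_poly_def map_poly_eq_0_iff)
  show "\<not> (of_int_poly f :: rat poly) dvd 1" using rat_poly_root_iff_dvd[OF f, of 1] by simp
  show "of_int_poly f dvd a \<or> of_int_poly f dvd b" if "of_int_poly f dvd a * b" for a b :: "rat poly"
    using that unfolding rat_poly_root_iff_dvd[OF f, symmetric] by simp
qed

lemma lead_coeff_of_int_poly: "lead_coeff (of_int_poly f :: 'a::ring_char_0 poly) = of_int (lead_coeff f)"
  by (simp add: coeff_map_poly)

lemma min_poly_eq_of_int_poly: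
  assumes f: "is_min_int_poly x f"
  shows "min_poly x = of_int_poly f"
  unfolding min_poly_def
proof (rule the_equality)
  have monic: "lead_coeff (of_int_poly f :: rat poly) = 1"
    using f unfolding lead_coeff_of_int_poly by (simp add: is_min_int_poly_def)
  thus "lead_coeff (of_int_poly f :: rat poly) = 1 \<and> irreducible (of_int_poly f :: rat poly) \<and>
      poly (of_rat_poly (of_int_poly f)) x = 0"
    using irreducible_min_int_poly[OF f] rat_poly_root_iff_dvd[OF f, of "of_int_poly f"] by auto
  fix p assume p: "lead_coeff p = 1 \<and> irreducible p \<and> poly (of_rat_poly p) x = 0"
  then obtain q where q: "p = of_int_poly f * q" using rat_poly_root_iff_dvd[OF f] by blast
  hence "is_unit q"
    using p irreducible_min_int_poly[OF f] by (auto simp: irreducible_def)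
  then obtain c where c: "q = [:c:]" by (auto simp: is_unit_poly_iff)
  have "lead_coeff p = c" unfolding q lead_coeff_mult monic by (simp add: c)
  hence "c = 1" using p by metis
  thus "p = of_int_poly f" by (simp add: q c)
qed

lemma degree_min_int_poly_pos:
  assumes "is_min_int_poly x f"
  shows "degree f > 0"
proof (rule ccontr)
  assume "\<not> degree f > 0"
  hence "f = [:lead_coeff f:]" by (metis degree_0_id gr0I)
  hence "f = 1" using assms by (simp add: is_min_int_poly_def one_pCons)
  moreover have "poly (of_int_poly f) x = 0" using assms by (simp add: is_min_int_poly_def)
  ultimately show False by simp
qed

text \<open>The minimal polynomial of a multiple root would be a proper factor, as it also divides the
  derivative.\<close>

lemma rsquarefree_min_int_poly:
  assumes f: "is_min_int_poly x f"
  shows "rsquarefree (of_int_poly f :: complex poly)"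
proof -
  have "\<not> (poly (of_int_poly f) z = 0 \<and> poly (of_int_poly (pderiv f)) z = 0)" for z :: complex
  proof
    assume z: "poly (of_int_poly f) z = 0 \<and> poly (of_int_poly (pderiv f)) z = 0"
    hence "algebraic_int z"
      unfolding algebraic_int_altdef_ipoly using f by (auto simp: is_min_int_poly_def)
    then obtain g where g: "is_min_int_poly z g" by (rule algebraic_int_imp_min_int_poly)
    hence dvd: "g dvd f" "g dvd pderiv f"
      using z by (simp_all add: is_min_int_poly_def del: of_int_poly_pderiv)
    then obtain q where q: "f = g * q" by blast
    hence "of_int_poly f = (of_int_poly g * of_int_poly q :: rat poly)" by simp
    hence "(of_int_poly g :: rat poly) dvd 1 \<or> (of_int_poly q :: rat poly) dvd 1"
      by (rule irreducibleD[OF irreducible_min_int_poly[OF f]])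
    hence "degree (of_int_poly g :: rat poly) = 0 \<or> degree (of_int_poly q :: rat poly) = 0"
      by (auto simp: is_unit_poly_iff simp del: degree_of_int_poly)
    hence "degree q = 0" using degree_min_int_poly_pos[OF g] by simp
    hence "degree f = degree g" using degree_mult_le[of g q] dvd_imp_degree_le[OF dvd(1)]
      degree_min_int_poly_pos[OF f] q by fastforce
    moreover have "degree g \<le> degree (pderiv f)"
      using degree_min_int_poly_pos[OF f] by (intro dvd_imp_degree_le dvd) (simp add: pderiv_eq_0_iff)
    ultimately show False using degree_min_int_poly_pos[OF f] by (simp add: degree_pderiv)
  qed
  thus ?thesis by (simp add: rsquarefree_roots)
qed

lemma cmod_alg_norm_eq:
  assumes f: "is_min_int_poly x f"
  shows "cmod (alg_norm x) = \<bar>of_int (coeff f 0)\<bar>"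
proof -
  let ?F = "of_int_poly f :: complex poly"
  have "rsquarefree ?F"
    by (rule rsquarefree_min_int_poly[OF f])
  hence "?F = smult (lead_coeff ?F) (\<Prod>z|poly ?F z = 0. [:- z, 1:])"
    using complex_poly_decompose_rsquarefree by metis
  moreover have "lead_coeff ?F = 1"
    using f unfolding lead_coeff_of_int_poly by (simp add: is_min_int_poly_def)
  ultimately have "?F = (\<Prod>z|poly ?F z = 0. [:- z, 1:])" by simp
  from arg_cong[OF this, of "\<lambda>p. poly p 0"] have "poly ?F 0 = (\<Prod>z|poly ?F z = 0. - z)"
    by (simp add: poly_prod)
  hence "of_int (coeff f 0) = (\<Prod>z|poly ?F z = 0. - z)"
    by (simp add: poly_0_coeff_0 coeff_map_poly)
  from arg_cong[OF this, of cmod] show ?thesis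
    by (simp add: alg_norm_def min_poly_eq_of_int_poly[OF f] flip: prod_norm)
qed

lemma coeff_0_min_int_poly_nonzero:
  assumes f: "is_min_int_poly x f" and "x \<noteq> 0"
  shows "coeff f 0 \<noteq> 0"
proof
  assume "coeff f 0 = 0"
  then obtain h where fh: "f = pCons 0 h" by (metis coeff_pCons_0 pCons_cases)
  have "poly (of_int_poly f) x = 0" using f by (simp add: is_min_int_poly_def)
  hence "f dvd h" using fh f \<open>x \<noteq> 0\<close> by (simp add: is_min_int_poly_def)
  moreover have "h \<noteq> 0" using f fh by (auto simp: is_min_int_poly_def)
  ultimately show False using fh dvd_imp_degree_le[of f h] by simp
qed

section \<open>Residue systems of \<open>\<int>[\<tau>]\<close>\<close>

lemma int_adjoin_closed:
  "x \<in> int_adjoin \<tau> \<Longrightarrow> y \<in> int_adjoin \<tau> \<Longrightarrow> x + y \<in> int_adjoin \<tau>"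
  "x \<in> int_adjoin \<tau> \<Longrightarrow> y \<in> int_adjoin \<tau> \<Longrightarrow> x - y \<in> int_adjoin \<tau>"
  "x \<in> int_adjoin \<tau> \<Longrightarrow> y \<in> int_adjoin \<tau> \<Longrightarrow> x * y \<in> int_adjoin \<tau>"
  by (auto simp: int_adjoin_def simp flip: poly_add poly_diff poly_mult of_int_poly_hom)

lemma of_int_in_int_adjoin [simp]: "of_int k \<in> int_adjoin \<tau>"
  unfolding int_adjoin_def by (rule range_eqI[of _ _ "[:k:]"]) simp

lemma of_nat_in_int_adjoin [simp]: "of_nat n \<in> int_adjoin \<tau>"
  using of_int_in_int_adjoin[of "int n"] by simp

lemma zero_in_int_adjoin [simp]: "0 \<in> int_adjoin \<tau>"
  using of_int_in_int_adjoin[of 0] by simp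

lemma power_in_int_adjoin [simp]: "\<tau> ^ k \<in> int_adjoin \<tau>"
  unfolding int_adjoin_def
  by (rule range_eqI[of _ _ "monom 1 k"]) (simp add: map_poly_monom poly_monom)

lemma generator_in_int_adjoin [simp]: "\<tau> \<in> int_adjoin \<tau>"
  using power_in_int_adjoin[of \<tau> 1] by simp

lemma adjoin_dvd_0 [simp]: "adjoin_dvd \<tau> a 0"
  unfolding adjoin_dvd_def by (rule bexI[of _ 0]) auto

lemma adjoin_dvd_mult [simp]: "b \<in> int_adjoin \<tau> \<Longrightarrow> adjoin_dvd \<tau> a (a * b)"
  by (auto simp: adjoin_dvd_def)

lemma adjoin_dvd_add:
  "adjoin_dvd \<tau> a x \<Longrightarrow> adjoin_dvd \<tau> a y \<Longrightarrow> adjoin_dvd \<tau> a (x + y)"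
  unfolding adjoin_dvd_def using int_adjoin_closed(1) by (metis distrib_left)

lemma adjoin_dvd_diff:
  "adjoin_dvd \<tau> a x \<Longrightarrow> adjoin_dvd \<tau> a y \<Longrightarrow> adjoin_dvd \<tau> a (x - y)"
  unfolding adjoin_dvd_def using int_adjoin_closed(2) by (metis right_diff_distrib)

lemma adjoin_dvd_cong:
  assumes "adjoin_dvd \<tau> a (x - y)"
  shows "adjoin_dvd \<tau> a x \<longleftrightarrow> adjoin_dvd \<tau> a y"
  using adjoin_dvd_diff[of \<tau> a x "x - y"] adjoin_dvd_add[of \<tau> a y "x - y"] assms by auto

lemma adjoin_dvd_mult_leftD:
  "adjoin_dvd \<tau> (a * b) x \<Longrightarrow> b \<in> int_adjoin \<tau> \<Longrightarrow> adjoin_dvd \<tau> a x"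
  unfolding adjoin_dvd_def using int_adjoin_closed(3) by (metis mult.assoc)

lemma adjoin_dvd_mult_cancel_left:
  "a \<noteq> 0 \<Longrightarrow> adjoin_dvd \<tau> (a * b) (a * x) \<longleftrightarrow> adjoin_dvd \<tau> b x"
  by (auto simp: adjoin_dvd_def)

definition residue_system :: "complex \<Rightarrow> complex \<Rightarrow> complex set \<Rightarrow> bool" where
  "residue_system \<tau> a S \<longleftrightarrow>
     S \<subseteq> int_adjoin \<tau> \<and> (\<forall>z\<in>int_adjoin \<tau>. \<exists>!s. s \<in> S \<and> adjoin_dvd \<tau> a (z - s))"

lemma residue_systemI:
  assumes "S \<subseteq> int_adjoin \<tau>"
    and "\<And>z. z \<in> int_adjoin \<tau> \<Longrightarrow> \<exists>s\<in>S. adjoin_dvd \<tau> a (z - s)"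
    and "\<And>s s'. s \<in> S \<Longrightarrow> s' \<in> S \<Longrightarrow> adjoin_dvd \<tau> a (s - s') \<Longrightarrow> s = s'"
  shows "residue_system \<tau> a S"
  unfolding residue_system_def
proof (intro conjI ballI)
  fix z assume "z \<in> int_adjoin \<tau>"
  then obtain s where s: "s \<in> S" "adjoin_dvd \<tau> a (z - s)" using assms(2) by blast
  show "\<exists>!s. s \<in> S \<and> adjoin_dvd \<tau> a (z - s)"
  proof (rule ex1I[of _ s])
    fix s' assume s': "s' \<in> S \<and> adjoin_dvd \<tau> a (z - s')"
    hence "adjoin_dvd \<tau> a ((z - s) - (z - s'))" using s by (blast intro: adjoin_dvd_diff)
    thus "s' = s" using assms(3)[of s' s] s s' by simp
  qed (use s in blast)
qed (fact assms(1))

lemma residue_system_representative: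
  assumes "residue_system \<tau> a S" "z \<in> int_adjoin \<tau>"
  obtains s where "s \<in> S" "adjoin_dvd \<tau> a (z - s)"
  using assms unfolding residue_system_def by blast

lemma residue_system_unique:
  assumes "residue_system \<tau> a S" "s \<in> S" "s' \<in> S" "adjoin_dvd \<tau> a (s - s')"
  shows "s = s'"
proof -
  have "s \<in> int_adjoin \<tau>" "adjoin_dvd \<tau> a (s - s)" using assms by (auto simp: residue_system_def)
  thus ?thesis using assms unfolding residue_system_def by blast
qed

lemma residue_system_card_le:
  assumes S: "residue_system \<tau> a S" and T: "residue_system \<tau> a T" and "finite T"
  shows "finite S \<and> card S \<le> card T"
proof -
  have "\<exists>t\<in>T. adjoin_dvd \<tau> a (s - t)" if "s \<in> S" for s
    using S that by (blast intro: residue_system_representative[OF T] dest: residue_system_def[THEN iffD1])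
  then obtain g where g: "\<And>s. s \<in> S \<Longrightarrow> g s \<in> T \<and> adjoin_dvd \<tau> a (s - g s)" by metis
  have "inj_on g S"
  proof (rule inj_onI)
    fix s s' assume s: "s \<in> S" "s' \<in> S" "g s = g s'"
    hence "adjoin_dvd \<tau> a ((s - g s) - (s' - g s'))" using g by (blast intro: adjoin_dvd_diff)
    thus "s = s'" using residue_system_unique[OF S] s by simp
  qed
  moreover have "g ` S \<subseteq> T" using g by blast
  ultimately show ?thesis using \<open>finite T\<close> by (meson card_inj_on_le inj_on_finite)
qed

lemma residue_system_mult:
  assumes S: "residue_system \<tau> a S" and T: "residue_system \<tau> b T"
    and a: "a \<in> int_adjoin \<tau>" "a \<noteq> 0" and b: "b \<in> int_adjoin \<tau>"
  shows "residue_system \<tau> (a * b) ((\<lambda>(s, t). s + a * t) ` (S \<times> T))"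
    and "inj_on (\<lambda>(s, t). s + a * t) (S \<times> T)"
proof -
  have sub: "S \<subseteq> int_adjoin \<tau>" "T \<subseteq> int_adjoin \<tau>" using S T by (auto simp: residue_system_def)
  have uniq: "s = s' \<and> t = t'"
    if "s \<in> S" "s' \<in> S" "t \<in> T" "t' \<in> T" and dvd: "adjoin_dvd \<tau> (a * b) (s + a * t - (s' + a * t'))"
    for s s' t t'
  proof -
    have "adjoin_dvd \<tau> a (s + a * t - (s' + a * t') - a * (t - t'))"
      using that(3,4) sub
      by (intro adjoin_dvd_diff[OF adjoin_dvd_mult_leftD[OF dvd b]] adjoin_dvd_mult int_adjoin_closed) auto
    hence "adjoin_dvd \<tau> a (s - s')" by (simp add: algebra_simps)
    hence "s = s'" using residue_system_unique[OF S] that(1,2) by blast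
    moreover from this have "adjoin_dvd \<tau> (a * b) (a * (t - t'))" using dvd by (simp add: algebra_simps)
    hence "t = t'" using residue_system_unique[OF T] that(3,4) a by (simp add: adjoin_dvd_mult_cancel_left)
    ultimately show ?thesis by simp
  qed
  show "residue_system \<tau> (a * b) ((\<lambda>(s, t). s + a * t) ` (S \<times> T))"
  proof (rule residue_systemI)
    show "(\<lambda>(s, t). s + a * t) ` (S \<times> T) \<subseteq> int_adjoin \<tau>"
      using sub a by (auto intro!: int_adjoin_closed)
    fix z assume "z \<in> int_adjoin \<tau>"
    then obtain s where s: "s \<in> S" "adjoin_dvd \<tau> a (z - s)" by (rule residue_system_representative[OF S])
    then obtain c where c: "c \<in> int_adjoin \<tau>" "z - s = a * c" by (auto simp: adjoin_dvd_def)
    obtain t where t: "t \<in> T" "adjoin_dvd \<tau> b (c - t)" by (rule residue_system_representative[OF T c(1)])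
    have "z - (s + a * t) = a * (c - t)" using c(2) by (simp add: algebra_simps)
    hence "adjoin_dvd \<tau> (a * b) (z - (s + a * t))" using t a by (simp add: adjoin_dvd_mult_cancel_left)
    with s t show "\<exists>r\<in>(\<lambda>(s, t). s + a * t) ` (S \<times> T). adjoin_dvd \<tau> (a * b) (z - r)" by force
  qed (use uniq in fast)
  show "inj_on (\<lambda>(s, t). s + a * t) (S \<times> T)"
    by (rule inj_onI) (use uniq in auto)
qed

lemma adjoin_dvd_generator_iff:
  assumes f: "is_min_int_poly \<tau> f"
  shows "adjoin_dvd \<tau> \<tau> (poly (of_int_poly p) \<tau>) \<longleftrightarrow> coeff f 0 dvd coeff p 0"
proof
  assume "adjoin_dvd \<tau> \<tau> (poly (of_int_poly p) \<tau>)"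
  then obtain g where "poly (of_int_poly p) \<tau> = \<tau> * poly (of_int_poly g) \<tau>"
    by (auto simp: adjoin_dvd_def int_adjoin_def)
  hence "poly (of_int_poly (p - pCons 0 g)) \<tau> = 0" by simp
  hence "f dvd p - pCons 0 g" using f by (simp only: is_min_int_poly_def)
  then obtain h where "p - pCons 0 g = f * h" by blast
  hence "coeff (p - pCons 0 g) 0 = coeff f 0 * coeff h 0" by (simp add: coeff_mult)
  thus "coeff f 0 dvd coeff p 0" by simp
next
  assume "coeff f 0 dvd coeff p 0"
  then obtain k where k: "coeff p 0 = coeff f 0 * k" by blast
  obtain a f' where f': "f = pCons a f'" by (cases f)
  obtain b p' where p': "p = pCons b p'" by (cases p)
  have "poly (of_int_poly f) \<tau> = 0" using f by (simp add: is_min_int_poly_def)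
  hence "of_int a = - \<tau> * poly (of_int_poly f') \<tau>" by (simp add: f' add_eq_0_iff2)
  hence "poly (of_int_poly p) \<tau> = \<tau> * poly (of_int_poly (p' - smult k f')) \<tau>"
    using k f' p' by (simp add: algebra_simps)
  thus "adjoin_dvd \<tau> \<tau> (poly (of_int_poly p) \<tau>)"
    unfolding adjoin_dvd_def int_adjoin_def by blast
qed

lemma residue_system_generator:
  assumes f: "is_min_int_poly \<tau> f" and "\<tau> \<noteq> 0"
  shows "residue_system \<tau> \<tau> (of_nat ` {..<nat \<bar>coeff f 0\<bar>})"
proof (rule residue_systemI)
  let ?c = "coeff f 0"
  have dvd_iff: "adjoin_dvd \<tau> \<tau> (poly (of_int_poly p) \<tau> - of_int k) \<longleftrightarrow> ?c dvd coeff p 0 - k" for p k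
    using adjoin_dvd_generator_iff[OF f, of "p - [:k:]"] by simp
  show "of_nat ` {..<nat \<bar>?c\<bar>} \<subseteq> int_adjoin \<tau>" by auto
  fix z assume "z \<in> int_adjoin \<tau>"
  then obtain p where p: "z = poly (of_int_poly p) \<tau>" by (auto simp: int_adjoin_def)
  define r where "r = coeff p 0 mod \<bar>?c\<bar>"
  have dvd: "?c dvd coeff p 0 - r"
    using dvd_minus_mod[of "\<bar>?c\<bar>" "coeff p 0"] unfolding r_def abs_dvd_iff .
  have r: "0 \<le> r" "r < \<bar>?c\<bar>"
    using coeff_0_min_int_poly_nonzero[OF assms] by (auto simp: r_def)
  hence "adjoin_dvd \<tau> \<tau> (z - of_nat (nat r))" using dvd dvd_iff[of p r] by (simp add: p)
  with r show "\<exists>s\<in>of_nat ` {..<nat \<bar>?c\<bar>}. adjoin_dvd \<tau> \<tau> (z - s)" by fastforce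
next
  fix s s' :: complex
  assume "s \<in> of_nat ` {..<nat \<bar>coeff f 0\<bar>}" "s' \<in> of_nat ` {..<nat \<bar>coeff f 0\<bar>}"
    and dvd: "adjoin_dvd \<tau> \<tau> (s - s')"
  then obtain d d' where d: "s = of_nat d" "s' = of_nat d'" "int d < \<bar>coeff f 0\<bar>" "int d' < \<bar>coeff f 0\<bar>"
    by (auto simp: zless_nat_eq_int_zless)
  have "coeff f 0 dvd int d - int d'"
    using adjoin_dvd_generator_iff[OF f, of "[:int d - int d':]"] dvd by (simp add: d)
  hence "int d mod \<bar>coeff f 0\<bar> = int d' mod \<bar>coeff f 0\<bar>" by (simp add: mod_eq_dvd_iff)
  thus "s = s'" using d by simp
qed

lemma ex_residue_system_power:
  assumes f: "is_min_int_poly \<tau> f" and "\<tau> \<noteq> 0"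
  shows "\<exists>S. residue_system \<tau> (\<tau> ^ k) S \<and> finite S \<and> card S = nat \<bar>coeff f 0\<bar> ^ k"
proof (induction k)
  case 0
  have "residue_system \<tau> 1 {0}"
    by (rule residue_systemI) (auto simp: adjoin_dvd_def)
  thus ?case by (intro exI[of _ "{0}"]) simp
next
  case (Suc k)
  then obtain S where S: "residue_system \<tau> (\<tau> ^ k) S" "finite S" "card S = nat \<bar>coeff f 0\<bar> ^ k" by blast
  let ?d = "of_nat ` {..<nat \<bar>coeff f 0\<bar>} :: complex set"
  note prod = residue_system_mult[OF residue_system_generator[OF assms] S(1)]
  have "card ?d = nat \<bar>coeff f 0\<bar>" by (subst card_image) (auto simp: inj_on_def)
  hence "card ((\<lambda>(s, t). s + \<tau> * t) ` (?d \<times> S)) = nat \<bar>coeff f 0\<bar> ^ Suc k"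
    using prod(2) S(3) assms(2) by (simp add: card_image card_cartesian_product)
  with prod(1) S(2) assms(2) show ?case
    by (intro exI[of _ "(\<lambda>(s, t). s + \<tau> * t) ` (?d \<times> S)"]) auto
qed

lemma reduced_residue_digit_set_unique:
  assumes D: "reduced_residue_digit_set \<tau> w D" and d: "d \<in> D - {0}" "d' \<in> D - {0}"
    and dvd: "adjoin_dvd \<tau> (\<tau> ^ w) (d - d')"
  shows "d = d'"
proof -
  have "d \<in> int_adjoin \<tau>" "\<not> adjoin_dvd \<tau> \<tau> d" "adjoin_dvd \<tau> (\<tau> ^ w) (d - d)"
    using D d(1) by (auto simp: reduced_residue_digit_set_def)
  thus ?thesis using D d dvd unfolding reduced_residue_digit_set_def by blast
qed

lemma residue_system_digits_Un_multiples:
  assumes D: "reduced_residue_digit_set \<tau> (Suc k) D" and T: "residue_system \<tau> (\<tau> ^ k) T"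
    and "\<tau> \<noteq> 0"
  shows "residue_system \<tau> (\<tau> ^ Suc k) ((D - {0}) \<union> (*) \<tau> ` T)" (is "residue_system _ _ ?U")
    and "(D - {0}) \<inter> (*) \<tau> ` T = {}"
proof -
  have sub: "D \<subseteq> int_adjoin \<tau>" "T \<subseteq> int_adjoin \<tau>"
    and D_not_dvd: "\<And>d. d \<in> D - {0} \<Longrightarrow> \<not> adjoin_dvd \<tau> \<tau> d"
    and D_rep: "\<And>z. z \<in> int_adjoin \<tau> \<Longrightarrow> \<not> adjoin_dvd \<tau> \<tau> z \<Longrightarrow>
      \<exists>d\<in>D - {0}. adjoin_dvd \<tau> (\<tau> ^ Suc k) (z - d)"
    using D T unfolding reduced_residue_digit_set_def residue_system_def by blast+
  have T_dvd: "adjoin_dvd \<tau> \<tau> (\<tau> * t)" if "t \<in> T" for t using that sub by auto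
  have multiple_cong: "adjoin_dvd \<tau> (\<tau> ^ Suc k) (\<tau> * x - \<tau> * y) \<longleftrightarrow> adjoin_dvd \<tau> (\<tau> ^ k) (x - y)" for x y
    using adjoin_dvd_mult_cancel_left[OF \<open>\<tau> \<noteq> 0\<close>, of \<tau> "\<tau> ^ k" "x - y"] by (simp add: right_diff_distrib)
  show "(D - {0}) \<inter> (*) \<tau> ` T = {}" using D_not_dvd T_dvd by blast
  have D_iff: "s \<in> D - {0} \<longleftrightarrow> \<not> adjoin_dvd \<tau> \<tau> s" if "s \<in> ?U" for s
    using that D_not_dvd T_dvd by (cases "s \<in> D - {0}") auto
  show "residue_system \<tau> (\<tau> ^ Suc k) ?U"
  proof (rule residue_systemI)
    show "?U \<subseteq> int_adjoin \<tau>" using sub by (auto intro: int_adjoin_closed)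
    show "\<exists>s\<in>?U. adjoin_dvd \<tau> (\<tau> ^ Suc k) (z - s)" if z: "z \<in> int_adjoin \<tau>" for z
    proof (cases "adjoin_dvd \<tau> \<tau> z")
      case True
      then obtain c where c: "c \<in> int_adjoin \<tau>" "z = \<tau> * c" by (auto simp: adjoin_dvd_def)
      obtain t where "t \<in> T" "adjoin_dvd \<tau> (\<tau> ^ k) (c - t)"
        by (rule residue_system_representative[OF T c(1)])
      thus ?thesis unfolding c(2) using multiple_cong by blast
    qed (use D_rep[OF z] in blast)
    fix s s' assume s: "s \<in> ?U" "s' \<in> ?U" and dvd: "adjoin_dvd \<tau> (\<tau> ^ Suc k) (s - s')"
    have "adjoin_dvd \<tau> \<tau> (s - s')" using adjoin_dvd_mult_leftD[of \<tau> \<tau> "\<tau> ^ k"] dvd by simp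
    hence "adjoin_dvd \<tau> \<tau> s \<longleftrightarrow> adjoin_dvd \<tau> \<tau> s'" by (rule adjoin_dvd_cong)
    then consider "s \<in> D - {0}" "s' \<in> D - {0}" | t t' where "t \<in> T" "s = \<tau> * t" "t' \<in> T" "s' = \<tau> * t'"
      using s D_iff[OF s(1)] D_iff[OF s(2)] by blast
    thus "s = s'"
    proof cases
      case 1
      thus ?thesis using reduced_residue_digit_set_unique[OF D] dvd by blast
    next
      case 2
      thus ?thesis using dvd multiple_cong residue_system_unique[OF T] by blast
    qed
  qed
qed

lemma card_reduced_residue_digit_set:
  assumes f: "is_min_int_poly \<tau> f" "\<tau> \<noteq> 0" and D: "reduced_residue_digit_set \<tau> w D" and w: "w \<ge> 1"
  defines "m \<equiv> nat \<bar>coeff f 0\<bar>"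
  shows "finite D" "card (D - {0}) = (m - 1) * m ^ (w - 1)"
proof -
  obtain k where k: "w = Suc k" using w by (cases w) auto
  obtain S where S: "residue_system \<tau> (\<tau> ^ Suc k) S" "finite S" "card S = m ^ Suc k"
    using ex_residue_system_power[OF f] unfolding m_def by blast
  obtain T where T: "residue_system \<tau> (\<tau> ^ k) T" "finite T" "card T = m ^ k"
    using ex_residue_system_power[OF f] unfolding m_def by blast
  let ?U = "(D - {0}) \<union> (*) \<tau> ` T"
  note U = residue_system_digits_Un_multiples[OF D[unfolded k] T(1) f(2)]
  have fin: "finite ?U" using residue_system_card_le[OF U(1) S(1,2)] by blast
  thus "finite D" by simp
  have "card (D - {0}) + card T = card ?U"
    using fin U(2) f(2) by (subst card_Un_disjoint) (auto simp: card_image inj_on_def)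
  also have "card ?U = card S"
    using residue_system_card_le[OF U(1) S(1,2)] residue_system_card_le[OF S(1) U(1) fin] by simp
  finally show "card (D - {0}) = (m - 1) * m ^ (w - 1)"
    using S(3) T(3) k by (simp add: diff_mult_distrib)
qed

section \<open>Roots of the characteristic trinomial\<close>

lemma sin_ge_linear:
  fixes x :: real
  assumes "0 \<le> x" "x \<le> pi / 2"
  shows "2 / pi * x \<le> sin x"
proof -
  have "concave_on {0..pi/2} sin"
    by (rule f''_le0_imp_concave[where f' = cos and f'' = "\<lambda>x. - sin x"])
       (auto intro!: derivative_eq_intros sin_ge_zero)
  moreover have "2 / pi * x \<le> 1" using assms by (simp add: field_simps)
  ultimately have "(1 - 2 / pi * x) * sin 0 + (2 / pi * x) * sin (pi / 2) \<le>
      sin ((1 - 2 / pi * x) *\<^sub>R 0 + (2 / pi * x) *\<^sub>R (pi / 2))"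
    using assms by (intro concave_onD) auto
  thus ?thesis by simp
qed

lemma one_minus_cos_ge:
  fixes t :: real
  assumes "\<bar>t\<bar> \<le> pi"
  shows "1 - cos t \<ge> 2 * t\<^sup>2 / pi\<^sup>2"
proof -
  have "2 / pi * (\<bar>t\<bar> / 2) \<le> sin (\<bar>t\<bar> / 2)"
    using assms by (intro sin_ge_linear) auto
  hence "(2 / pi * (\<bar>t\<bar> / 2))\<^sup>2 \<le> (sin (\<bar>t\<bar> / 2))\<^sup>2"
    by (intro power_mono) auto
  hence "2 * (t\<^sup>2 / pi\<^sup>2) \<le> 2 * (sin (\<bar>t\<bar> / 2))\<^sup>2"
    by (simp add: power_mult_distrib power_divide)
  also have "\<dots> = 1 - cos t"
    using cos_double_sin[of "\<bar>t\<bar> / 2"] by (simp add: cos_abs_real)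
  finally show ?thesis by simp
qed

lemma norm_trinomial_root_ge_1:
  fixes u :: complex and M :: real
  assumes M: "M \<ge> 1" and root: "of_real M = u + of_real (M - 1) * u ^ w"
  shows "norm u \<ge> 1"
proof (rule ccontr)
  assume "\<not> norm u \<ge> 1"
  hence u: "norm u < 1" by simp
  have "M = norm (of_real M :: complex)" using M by simp
  also have "\<dots> \<le> norm u + norm (of_real (M - 1) * u ^ w)"
    unfolding root by (rule norm_triangle_ineq)
  also have "norm (of_real (M - 1) * u ^ w) = (M - 1) * norm u ^ w"
    using M by (simp add: norm_mult norm_power del: of_real_diff)
  also have "\<dots> \<le> (M - 1) * 1"
    using u M by (intro mult_left_mono power_le_one) auto
  finally show False using u by simp
qed

lemma abs_Arg_trinomial_root_ge:
  fixes u :: complex and M :: real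
  assumes M: "M \<ge> 1" and w: "w \<ge> 1" and "u \<noteq> 1"
    and root: "of_real M = u + of_real (M - 1) * u ^ w"
  shows "\<bar>Arg u\<bar> \<ge> pi / w"
proof (rule ccontr)
  define r t where "r = norm u" and "t = Arg u"
  have u: "u = of_real r * cis t" by (metis r_def t_def rcis_cmod_Arg rcis_def)
  have r: "r \<ge> 1" unfolding r_def by (rule norm_trinomial_root_ge_1[OF M root])
  have "u ^ w = of_real (r ^ w) * cis (real w * t)"
    unfolding u power_mult_distrib Complex.DeMoivre by simp
  hence Im_root: "r * sin t + (M - 1) * r ^ w * sin (real w * t) = 0"
    using arg_cong[OF root, of Im] u by simp
  assume "\<not> \<bar>Arg u\<bar> \<ge> pi / w"
  hence small: "\<bar>t\<bar> * w < pi" using w by (simp add: t_def field_simps)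
  have "t = 0"
  proof (rule ccontr)
    have "\<bar>t\<bar> * 1 \<le> \<bar>t\<bar> * w" using w by (intro mult_left_mono) auto
    moreover assume "t \<noteq> 0"
    ultimately have "0 < \<bar>t\<bar>" "\<bar>t\<bar> < pi" using small by linarith+
    hence "r * sin \<bar>t\<bar> + (M - 1) * r ^ w * sin (real w * \<bar>t\<bar>) > 0"
      using small r M
      by (intro add_pos_nonneg mult_pos_pos mult_nonneg_nonneg sin_gt_zero sin_ge_zero)
         (auto simp: mult.commute)
    thus False using Im_root by (cases "t \<ge> 0") auto
  qed
  hence u_real: "u = of_real r" using u by simp
  hence "complex_of_real M = of_real (r + (M - 1) * r ^ w)" using root by simp
  hence "M = r + (M - 1) * r ^ w" by (simp only: of_real_eq_iff)
  moreover have "(M - 1) * r ^ w \<ge> (M - 1) * 1" using r M by (intro mult_left_mono) auto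
  ultimately show False using r u_real \<open>u \<noteq> 1\<close> by simp
qed

lemma norm_of_real_diff_squared:
  "(norm (of_real a - u))\<^sup>2 = (a - norm u)\<^sup>2 + 2 * a * norm u * (1 - cos (Arg u))"
proof -
  have "Re u = norm u * cos (Arg u)" "Im u = norm u * sin (Arg u)"
    by (metis Re_rcis rcis_cmod_Arg, metis Im_rcis rcis_cmod_Arg)
  hence "(norm (of_real a - u))\<^sup>2 = (a - norm u * cos (Arg u))\<^sup>2 + (norm u * sin (Arg u))\<^sup>2"
    by (simp add: cmod_power2)
  also have "\<dots> = a\<^sup>2 - 2 * a * norm u * cos (Arg u) + (norm u)\<^sup>2 * ((sin (Arg u))\<^sup>2 + (cos (Arg u))\<^sup>2)"
    by algebra
  finally show ?thesis by (simp add: power2_eq_square algebra_simps)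
qed

lemma power_le_one_plus:
  fixes r e :: real
  assumes "0 \<le> r" "r \<le> 1 + e" "0 \<le> e" "real n * e \<le> 9 / 16"
  shows "r ^ n \<le> 1 + 25 / 16 * (real n * e)"
proof -
  have "r ^ n \<le> (1 + e) ^ n" using assms by (intro power_mono) auto
  also have "\<dots> \<le> exp e ^ n" using assms by (intro power_mono exp_ge_add_one_self) auto
  also have "\<dots> = exp (real n * e)" by (simp add: exp_of_nat_mult)
  also have "\<dots> \<le> 1 + real n * e + (real n * e)\<^sup>2" using assms by (intro exp_bound) auto
  also have "(real n * e)\<^sup>2 \<le> 9 / 16 * (real n * e)"
    using assms unfolding power2_eq_square by (intro mult_right_mono) auto
  finally show ?thesis by (simp add: mult_ac)
qed

text \<open>If \<open>r < 1 + e\<close>, then by convexity the left-hand side of the equation exceeds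
  \<open>(M - 1)\<^sup>2\<close> by at most about \<open>(M - 1)\<^sup>2 \<cdot> 2 w e\<close>, but the right-hand side by at least about \<open>4 M / w\<^sup>2\<close>.\<close>

lemma trinomial_root_modulus_ge:
  fixes r M c :: real
  assumes M: "M \<ge> 1" and w: "w \<ge> 2" and r: "r \<ge> 1" and c: "c \<ge> 2 / (real w)\<^sup>2"
    and eq: "(M - 1)\<^sup>2 * r ^ (2 * w) = (M - r)\<^sup>2 + 2 * M * r * c"
  shows "r \<ge> 1 + 9 / (8 * M * real w ^ 3)"
proof (rule ccontr)
  define e where "e = 9 / (8 * M * real w ^ 3)"
  assume "\<not> r \<ge> 1 + 9 / (8 * M * real w ^ 3)"
  hence r_less: "r < 1 + e" by (simp add: e_def)
  have e: "e > 0" using M w by (simp add: e_def)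
  have Mw: "M * (real w)\<^sup>2 \<ge> 1 * 2\<^sup>2" using M w by (intro mult_mono power_mono) auto
  have we: "real (2 * w) * e = 9 / (4 * M * (real w)\<^sup>2)"
    using w M by (simp add: e_def field_simps power3_eq_cube power2_eq_square)
  have "real (2 * w) * e \<le> 9 / 16" unfolding we using M w Mw by (simp add: field_simps)
  hence "r ^ (2 * w) \<le> 1 + 25 / 16 * (real (2 * w) * e)"
    using r r_less e by (intro power_le_one_plus) auto
  hence "(M - 1)\<^sup>2 * r ^ (2 * w) \<le> (M - 1)\<^sup>2 + (M - 1)\<^sup>2 / M * (225 / 64 / (real w)\<^sup>2)"
    unfolding we using mult_left_mono[of "r ^ (2 * w)" _ "(M - 1)\<^sup>2"] by (fastforce simp: field_simps)
  also have "(M - 1)\<^sup>2 / M * (225 / 64 / (real w)\<^sup>2) \<le> (M - 1) * (225 / 64 / (real w)\<^sup>2)"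
    using M by (intro mult_right_mono) (auto simp: power2_eq_square field_simps)
  finally have upper: "(M - 1)\<^sup>2 * r ^ (2 * w) \<le> (M - 1)\<^sup>2 + (M - 1) * (225 / 64 / (real w)\<^sup>2)"
    by simp
  have "(M - 1) * (r - 1) \<le> M * e" using M r r_less by (intro mult_mono) auto
  moreover have "(M - r)\<^sup>2 = (M - 1)\<^sup>2 - 2 * ((M - 1) * (r - 1)) + (r - 1)\<^sup>2"
    by (simp add: power2_eq_square algebra_simps)
  ultimately have "(M - r)\<^sup>2 \<ge> (M - 1)\<^sup>2 - 2 * (M * e)" using zero_le_power2[of "r - 1"] by linarith
  moreover have "2 * (M * e) \<le> 9 / 8 / (real w)\<^sup>2"
    using M w by (simp add: e_def field_simps power3_eq_cube power2_eq_square)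
  moreover have "2 * M * 1 * (2 / (real w)\<^sup>2) \<le> 2 * M * r * c" using M r c by (intro mult_mono) auto
  ultimately have "4 * M / (real w)\<^sup>2 \<le> (M - 1) * (225 / 64 / (real w)\<^sup>2) + 9 / 8 / (real w)\<^sup>2"
    using upper eq by simp
  hence "4 * M \<le> 225 / 64 * M - 225 / 64 + 9 / 8" using w by (simp add: field_simps)
  thus False using M by linarith
qed

theorem norm_trinomial_root_ge:
  fixes u :: complex and M :: real and w :: nat
  assumes M: "M \<ge> 1" and w: "w \<ge> 2" and "u \<noteq> 1"
    and root: "of_real M = u + of_real (M - 1) * u ^ w"
  shows "norm u \<ge> 1 + 9 / (8 * M * real w ^ 3)"
proof (rule trinomial_root_modulus_ge[OF M w])
  show "norm u \<ge> 1" by (rule norm_trinomial_root_ge_1[OF M root])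
  have "pi / w \<le> \<bar>Arg u\<bar>" using w by (intro abs_Arg_trinomial_root_ge[OF M _ \<open>u \<noteq> 1\<close> root]) simp
  hence "(pi / w)\<^sup>2 \<le> \<bar>Arg u\<bar>\<^sup>2" by (intro power_mono) auto
  hence "2 * (pi / w)\<^sup>2 / pi\<^sup>2 \<le> 2 * (Arg u)\<^sup>2 / pi\<^sup>2" by (intro divide_right_mono) auto
  also have "\<dots> \<le> 1 - cos (Arg u)" using Arg_bounded[of u] by (intro one_minus_cos_ge) auto
  finally show "1 - cos (Arg u) \<ge> 2 / (real w)\<^sup>2" by (simp add: power_divide)
  have "norm (of_real M - u) = norm (of_real (M - 1) * u ^ w)" by (subst root) simp
  hence "(norm (of_real M - u))\<^sup>2 = (M - 1)\<^sup>2 * norm u ^ (2 * w)"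
    using M by (simp add: norm_mult norm_power power_mult_distrib power_mult mult.commute[of 2]
        del: of_real_diff)
  thus "(M - 1)\<^sup>2 * norm u ^ (2 * w) = (M - norm u)\<^sup>2 + 2 * M * norm u * (1 - cos (Arg u))"
    by (simp add: norm_of_real_diff_squared)
qed

section \<open>The generating function of sparse words\<close>

text \<open>Recursion on the leading digit: either it is zero, or it is one of the nonzero digits, of total
  weight \<open>x\<close>, and the next \<open>w - 1\<close> digits vanish. Truncated subtraction covers words of length at
  most \<open>w\<close>.\<close>

fun naf_gf :: "nat \<Rightarrow> 'a::comm_ring_1 \<Rightarrow> nat \<Rightarrow> 'a" where
  "naf_gf w x 0 = 1"
| "naf_gf w x (Suc n) = naf_gf w x n + x * naf_gf w x (n - (w - 1))"

lemma poly_naf_gf: "poly (naf_gf w p n) y = naf_gf w (poly p y) n"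
  by (induction w p n rule: naf_gf.induct) simp_all

text \<open>Delaying the sequence by \<open>w - 1\<close> steps removes the truncated subtraction.\<close>

definition naf_fps :: "nat \<Rightarrow> 'a::comm_ring_1 \<Rightarrow> 'a fps" where
  "naf_fps w x = Abs_fps (\<lambda>n. naf_gf w x (n - (w - 1)))"

lemma naf_fps_mult_denominator:
  assumes "w \<ge> 1"
  shows "naf_fps w x * (1 - fps_X - fps_const x * fps_X ^ w) = 1"
proof (rule fps_ext)
  fix n
  let ?F = "naf_fps w x"
  have "fps_nth (?F * (1 - fps_X - fps_const x * fps_X ^ w)) n =
      fps_nth (?F - fps_X * ?F - fps_const x * (fps_X ^ w * ?F)) n"
    by (simp add: algebra_simps)
  also have "\<dots> = fps_nth ?F n - (if n = 0 then 0 else fps_nth ?F (n - 1)) -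
      x * (if n < w then 0 else fps_nth ?F (n - w))"
    by (simp add: fps_X_power_mult_nth)
  also have "\<dots> = fps_nth 1 n"
  proof (cases "n < w")
    case False
    then obtain j where j: "n = j + w" by (metis add.commute le_Suc_ex not_less)
    have "n - (w - 1) = Suc j" "n - 1 - (w - 1) = j" using assms by (auto simp: j)
    thus ?thesis using assms by (simp add: naf_fps_def j)
  qed (auto simp: naf_fps_def)
  finally show "fps_nth (?F * (1 - fps_X - fps_const x * fps_X ^ w)) n = fps_nth 1 n" .
qed

definition fps_pderiv :: "'a::idom poly fps \<Rightarrow> 'a poly fps" where
  "fps_pderiv F = Abs_fps (\<lambda>n. pderiv (fps_nth F n))"

definition fps_poly :: "'a::comm_ring_1 poly fps \<Rightarrow> 'a \<Rightarrow> 'a fps" where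
  "fps_poly F y = Abs_fps (\<lambda>n. poly (fps_nth F n) y)"

lemma pderiv_sum: "pderiv (sum f A) = (\<Sum>i\<in>A. pderiv (f i))"
  using higher_pderiv_sum[of 1] by simp

lemma fps_pderiv_mult: "fps_pderiv (F * G) = fps_pderiv F * G + F * fps_pderiv G"
  by (rule fps_ext)
     (simp add: fps_pderiv_def fps_mult_nth pderiv_sum pderiv_mult sum.distrib add.commute
        mult.commute[of "pderiv (fps_nth F _)"])

lemma fps_poly_mult: "fps_poly (F * G) y = fps_poly F y * fps_poly G y"
  by (rule fps_ext) (simp add: fps_poly_def fps_mult_nth poly_sum)

lemma fps_poly_power: "fps_poly (F ^ n) y = fps_poly F y ^ n"
  by (induction n) (simp_all add: fps_poly_mult, simp add: fps_poly_def fps_eq_iff)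

lemma fps_pderiv_X_power_mult: "fps_pderiv (fps_X ^ n * F) = fps_X ^ n * fps_pderiv F"
  by (rule fps_ext) (simp add: fps_pderiv_def fps_X_power_mult_nth)

lemma fps_poly_X: "fps_poly fps_X y = fps_X"
  by (rule fps_ext) (simp add: fps_poly_def)

lemma fps_pderiv_naf_fps:
  fixes c :: "'a::idom"
  assumes "w \<ge> 1"
  defines "F \<equiv> naf_fps w [:c, 1:]"
  shows "fps_pderiv F = fps_X ^ w * F ^ 2"
proof -
  let ?K = "1 - fps_X - fps_const [:c, 1:] * fps_X ^ w"
  have FK: "F * ?K = 1" unfolding F_def by (rule naf_fps_mult_denominator[OF assms(1)])
  have "fps_pderiv ?K = - (fps_X ^ w)"
    by (rule fps_ext) (auto simp: fps_pderiv_def fps_X_power_nth pderiv_diff pderiv_pCons)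
  moreover have "fps_pderiv F * ?K + F * fps_pderiv ?K = 0"
    unfolding fps_pderiv_mult[symmetric] FK by (rule fps_ext) (simp add: fps_pderiv_def)
  ultimately have "fps_pderiv F * ?K = fps_X ^ w * F" by (simp add: mult.commute[of F])
  moreover have "fps_pderiv F = F * (fps_pderiv F * ?K)"
    using FK by (simp add: mult.left_commute)
  ultimately show ?thesis by (simp add: power2_eq_square mult.left_commute)
qed

lemma fps_pderiv_fps_pderiv_naf_fps:
  fixes c :: "'a::idom"
  assumes "w \<ge> 1"
  defines "F \<equiv> naf_fps w [:c, 1:]"
  shows "fps_pderiv (fps_pderiv F) = 2 * fps_X ^ (2 * w) * F ^ 3"
proof -
  have F': "fps_pderiv F = fps_X ^ w * F ^ 2"
    unfolding F_def by (rule fps_pderiv_naf_fps[OF assms(1)])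
  have "fps_pderiv (fps_pderiv F) = fps_X ^ w * (2 * F * fps_pderiv F)"
    unfolding F' fps_pderiv_X_power_mult
    by (simp add: power2_eq_square fps_pderiv_mult[of F F] F' algebra_simps)
  also have "\<dots> = 2 * fps_X ^ (2 * w) * F ^ 3"
    unfolding F' mult_2 power_add by (simp add: power2_eq_square power3_eq_cube mult_ac)
  finally show ?thesis .
qed

lemma naf_gf_factorial_moments:
  fixes c y :: "'a::idom"
  assumes w: "w \<ge> 1"
  defines "T \<equiv> naf_fps w (c + y)"
  shows "poly (naf_gf w [:c, 1:] n) y = fps_nth T (n + w - 1)"
    and "poly (pderiv (naf_gf w [:c, 1:] n)) y = (if n = 0 then 0 else fps_nth (T ^ 2) (n - 1))"
    and "poly (pderiv (pderiv (naf_gf w [:c, 1:] n))) y =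
           (if n \<le> w then 0 else 2 * fps_nth (T ^ 3) (n - 1 - w))"
proof -
  let ?F = "naf_fps w [:c, 1:]"
  have F_nth: "fps_nth ?F (n + w - 1) = naf_gf w [:c, 1:] n" using w by (simp add: naf_fps_def)
  have T: "fps_poly ?F y = T"
    by (rule fps_ext) (simp add: fps_poly_def T_def naf_fps_def poly_naf_gf)
  show "poly (naf_gf w [:c, 1:] n) y = fps_nth T (n + w - 1)"
    unfolding T[symmetric] using F_nth by (simp add: fps_poly_def)
  have "poly (pderiv (naf_gf w [:c, 1:] n)) y = fps_nth (fps_poly (fps_pderiv ?F) y) (n + w - 1)"
    using F_nth by (simp add: fps_poly_def fps_pderiv_def)
  also have "fps_poly (fps_pderiv ?F) y = fps_X ^ w * T ^ 2"
    by (simp add: fps_pderiv_naf_fps[OF w] fps_poly_mult fps_poly_power fps_poly_X T)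
  also have "fps_nth (fps_X ^ w * T ^ 2) (n + w - 1) = (if n = 0 then 0 else fps_nth (T ^ 2) (n - 1))"
    using w by (auto simp: fps_X_power_mult_nth)
  finally show "poly (pderiv (naf_gf w [:c, 1:] n)) y = (if n = 0 then 0 else fps_nth (T ^ 2) (n - 1))" .
  have "poly (pderiv (pderiv (naf_gf w [:c, 1:] n))) y =
      fps_nth (fps_poly (fps_pderiv (fps_pderiv ?F)) y) (n + w - 1)"
    using F_nth by (simp add: fps_poly_def fps_pderiv_def)
  also have "fps_poly (2 :: 'a poly fps) y = 2"
    by (rule fps_ext) (simp add: fps_poly_def numeral_fps_const)
  hence "fps_poly (fps_pderiv (fps_pderiv ?F)) y = fps_X ^ (2 * w) * (2 * T ^ 3)"
    by (simp add: fps_pderiv_fps_pderiv_naf_fps[OF w] fps_poly_mult fps_poly_power fps_poly_X T)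
  also have "fps_nth (fps_X ^ (2 * w) * (2 * T ^ 3)) (n + w - 1) =
      (if n \<le> w then 0 else 2 * fps_nth (T ^ 3) (n - 1 - w))"
  proof -
    have "n + w - 1 - 2 * w = n - 1 - w" "n + w - 1 < 2 * w \<longleftrightarrow> n \<le> w" using w by auto
    thus ?thesis by (auto simp: fps_X_power_mult_nth numeral_fps_const)
  qed
  finally show "poly (pderiv (pderiv (naf_gf w [:c, 1:] n))) y =
      (if n \<le> w then 0 else 2 * fps_nth (T ^ 3) (n - 1 - w))" .
qed

section \<open>Singular expansions at a simple pole\<close>

lemma poly_of_real_poly: "poly (map_poly of_real p) (of_real x) = of_real (poly p x)"
  by (induction p) (simp_all add: map_poly_pCons)

lemma fps_conv_radius_inverse_real_poly:
  fixes p :: "real poly"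
  assumes "coeff p 0 \<noteq> 0"
    and nonzero: "\<And>z :: complex. norm z < r \<Longrightarrow> poly (map_poly of_real p) z \<noteq> 0"
  shows "fps_conv_radius (inverse (fps_of_poly p)) \<ge> ereal r"
proof -
  let ?p = "fps_of_poly (map_poly complex_of_real p)"
  define h where "h = inverse (fps_of_poly p)"
  define H where "H = Abs_fps (\<lambda>n. complex_of_real (fps_nth h n))"
  have "?p * H = 1"
  proof (rule fps_ext)
    fix n
    have "fps_nth (?p * H) n = complex_of_real (fps_nth (fps_of_poly p * h) n)"
      by (simp add: fps_mult_nth H_def coeff_map_poly)
    also have "fps_of_poly p * h = 1" unfolding h_def using assms(1) by (simp add: inverse_mult_eq_1')
    finally show "fps_nth (?p * H) n = fps_nth 1 n" by simp
  qed
  hence "H = inverse ?p" by (simp add: fps_inverse_unique)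
  moreover have "min (ereal r) (fps_conv_radius ?p) \<le> fps_conv_radius (inverse ?p)"
    by (rule fps_conv_radius_inverse) (use nonzero in auto)
  ultimately have "ereal r \<le> fps_conv_radius H" by simp
  also have "fps_conv_radius H = fps_conv_radius h"
    unfolding fps_conv_radius_def by (subst (1 2) conv_radius_norm[symmetric]) (simp add: H_def)
  finally show ?thesis unfolding h_def .
qed

lemma fps_nth_bigo_if_conv_radius:
  fixes h :: "real fps"
  assumes "ereal r < fps_conv_radius h" "r > 0"
  shows "fps_nth h \<in> O(\<lambda>n. inverse r ^ n)"
proof -
  have "summable (\<lambda>n. fps_nth h n * r ^ n)"
    using assms by (intro summable_fps) auto
  hence "Bseq (\<lambda>n. fps_nth h n * r ^ n)"
    by (intro convergent_imp_Bseq convergentI[OF summable_LIMSEQ_zero])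
  then obtain K where K: "\<And>n. norm (fps_nth h n * r ^ n) \<le> K" unfolding Bseq_def by blast
  have "norm (fps_nth h n) \<le> K * norm (inverse r ^ n)" for n
    using K[of n] assms(2) by (simp add: abs_mult power_inverse field_simps)
  thus ?thesis by (intro bigoI[of _ K] always_eventually) blast
qed

definition geometric_fps :: "real fps" where "geometric_fps = Abs_fps (\<lambda>_. 1)"

lemma one_minus_X_mult_geometric_fps: "(1 - fps_X) * geometric_fps = 1"
  using inverse_mult_eq_1[of geometric_fps] fps_inverse_gp'[where ?'a = real]
  by (simp add: geometric_fps_def)

lemma fps_nth_geometric_fps_powers:
  "fps_nth geometric_fps n = 1"
  "fps_nth (geometric_fps ^ 2) n = real n + 1"
  "fps_nth (geometric_fps ^ 3) n = (real n + 1) * (real n + 2) / 2"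
proof -
  show L: "fps_nth geometric_fps n = 1" for n by (simp add: geometric_fps_def)
  have partial_sums: "fps_nth (geometric_fps * f) n = (\<Sum>i=0..n. fps_nth f i)" for f n
    by (subst mult.commute) (simp add: fps_mult_nth L)
  show L2: "fps_nth (geometric_fps ^ 2) n = real n + 1" for n
    unfolding power2_eq_square by (simp add: partial_sums L)
  have "(\<Sum>i=0..n. real i + 1) = (real n + 1) * (real n + 2) / 2"
    by (induction n) (simp_all add: field_simps)
  thus "fps_nth (geometric_fps ^ 3) n = (real n + 1) * (real n + 2) / 2"
    using partial_sums[of "geometric_fps ^ 2" n] unfolding L2
    by (simp only: power3_eq_cube power2_eq_square mult.assoc)
qed

lemma geometric_sum_taylor:
  "\<exists>p :: 'a::idom poly. (\<Sum>i<n. monom 1 i) =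
     of_nat n - of_nat (n choose 2) * [:1, -1:] + of_nat (n choose 3) * [:1, -1:] ^ 2 - [:1, -1:] ^ 3 * p"
proof (induction n)
  case 0
  show ?case by (intro exI[of _ 0]) (simp add: binomial_eq_0)
next
  case (Suc n)
  let ?v = "[:1, -1:] :: 'a poly"
  obtain p where p: "(\<Sum>i<n. monom 1 i) =
      of_nat n - of_nat (n choose 2) * ?v + of_nat (n choose 3) * ?v ^ 2 - ?v ^ 3 * p"
    using Suc by blast
  have "monom 1 (Suc i) = (1 - ?v) * monom 1 i" for i
    by (simp add: monom_Suc one_pCons)
  hence "(\<Sum>i<Suc n. monom 1 i) = 1 + (\<Sum>i<n. (1 - ?v) * monom 1 i)"
    by (simp only: sum.lessThan_Suc_shift monom_eq_1)
  also have "\<dots> = 1 + (1 - ?v) * (\<Sum>i<n. monom 1 i)" by (simp only: sum_distrib_left)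
  also have "\<dots> = of_nat (n + 1) - of_nat ((n choose 2) + n) * ?v +
      of_nat ((n choose 3) + (n choose 2)) * ?v ^ 2 - ?v ^ 3 * (of_nat (n choose 3) + p - ?v * p)"
    unfolding p of_nat_add of_nat_1 by algebra
  finally have "(\<Sum>i<Suc n. monom 1 i) = of_nat (Suc n) - of_nat (Suc n choose 2) * ?v +
      of_nat (Suc n choose 3) * ?v ^ 2 - ?v ^ 3 * (of_nat (n choose 3) + p - ?v * p)"
    by (simp add: numeral_2_eq_2 numeral_3_eq_3 add.commute)
  thus ?case by blast
qed

lemma inverse_taylor:
  fixes v :: "'a::idom"
  assumes q: "q = c - s * v + s' * v ^ 2 - v ^ 3 * p" and "q * Q = 1" and "c * a = 1"
  defines "b1 \<equiv> s * a ^ 2" and "b2 \<equiv> s ^ 2 * a ^ 3 - s' * a ^ 2"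
  shows "Q = a + b1 * v + b2 * v ^ 2 -
    v ^ 3 * (Q * (s' * b1 - s * b2 + s' * b2 * v - p * (a + b1 * v + b2 * v ^ 2)))"
  unfolding b1_def b2_def using assms(1-3) by algebra

text \<open>Here \<open>L\<close> is the simple pole \<open>1 / v\<close>; the last summand in each expansion is regular.\<close>

lemma simple_pole_powers:
  fixes L v :: "'a::idom"
  assumes "v * L = 1" and "t = L * (a + b1 * v + b2 * v ^ 2 - v ^ 3 * h)"
  defines "g1 \<equiv> b1 + b2 * v - v ^ 2 * h" and "g2 \<equiv> b2 - v * h"
  shows "t = a * L + g1"
    and "t ^ 2 = a ^ 2 * L ^ 2 + 2 * a * b1 * L + (2 * a * g2 + g1 ^ 2)"
    and "t ^ 3 = a ^ 3 * L ^ 3 + 3 * a ^ 2 * b1 * L ^ 2 + (3 * a ^ 2 * b2 + 3 * a * b1 ^ 2) * L +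
           (3 * a * (b1 * g2 + g1 * g2) - 3 * a ^ 2 * h + g1 ^ 3)"
proof -
  have Lg1: "L * g1 = b1 * L + g2" and Lg2: "L * g2 = b2 * L - h"
    unfolding g1_def g2_def using assms(1) by algebra+
  show t: "t = a * L + g1" unfolding g1_def using assms(1,2) by algebra
  show "t ^ 2 = a ^ 2 * L ^ 2 + 2 * a * b1 * L + (2 * a * g2 + g1 ^ 2)"
    using t Lg1 by algebra
  show "t ^ 3 = a ^ 3 * L ^ 3 + 3 * a ^ 2 * b1 * L ^ 2 + (3 * a ^ 2 * b2 + 3 * a * b1 ^ 2) * L +
      (3 * a * (b1 * g2 + g1 * g2) - 3 * a ^ 2 * h + g1 ^ 3)"
    using t Lg1 Lg2 by algebra
qed

lemma fps_conv_radius_power_ge: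
  fixes F :: "'a::{banach, real_normed_div_algebra, comm_ring_1} fps"
  shows "fps_conv_radius F \<ge> r \<Longrightarrow> fps_conv_radius (F ^ n) \<ge> r"
  using fps_conv_radius_power order.trans by blast

section \<open>Asymptotics of counts and moments\<close>

lemma quotient_bigo_geometric:
  fixes f g p :: "nat \<Rightarrow> real"
  assumes f: "(\<lambda>n. f n - p n * a) \<in> O(\<lambda>n. real n ^ k * r ^ n)"
    and g: "(\<lambda>n. g n - a) \<in> O(\<lambda>n. r ^ n)" and p: "p \<in> O(\<lambda>n. real n ^ k)"
    and r: "0 < r" "r < 1" and a: "a \<noteq> 0"
  shows "(\<lambda>n. f n / g n - p n) \<in> O(\<lambda>n. real n ^ k * r ^ n)"
proof -
  have "(\<lambda>n. r ^ n) \<longlonglongrightarrow> 0" using r by (intro LIMSEQ_power_zero) auto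
  hence "(\<lambda>n. r ^ n) \<in> o(\<lambda>_. 1)" by (intro smalloI_tendsto) auto
  from smalloD_tendsto[OF landau_o.big_small_trans[OF g this]]
  have "(\<lambda>n. g n - a) \<longlonglongrightarrow> 0" by simp
  hence lim: "g \<longlonglongrightarrow> a" by (simp add: LIM_zero_iff)
  have "(\<lambda>n. inverse (g n)) \<longlonglongrightarrow> inverse a" using lim a by (rule tendsto_inverse)
  hence inv: "(\<lambda>n. inverse (g n)) \<in> O(\<lambda>_. 1)"
    by (intro bigoI_tendsto[of _ _ "inverse a"]) auto
  have "(\<lambda>n. p n * (g n - a)) \<in> O(\<lambda>n. real n ^ k * r ^ n)"
    by (rule landau_o.big.mult[OF p g])
  with f have "(\<lambda>n. (f n - p n * a) - p n * (g n - a)) \<in> O(\<lambda>n. real n ^ k * r ^ n)"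
    by (rule sum_in_bigo)
  from landau_o.big.mult[OF this inv]
  have "(\<lambda>n. ((f n - p n * a) - p n * (g n - a)) * inverse (g n)) \<in> O(\<lambda>n. real n ^ k * r ^ n)" by simp
  thus ?thesis
  proof (rule landau_o.big.in_cong[THEN iffD1, rotated])
    show "\<forall>\<^sub>F n in sequentially. (f n - p n * a - p n * (g n - a)) * inverse (g n) = f n / g n - p n"
      using tendsto_imp_eventually_ne[OF lim a] by eventually_elim (simp add: field_simps)
  qed
qed

lemma variance_bigo_geometric:
  fixes E G e g :: "nat \<Rightarrow> real"
  assumes E: "(\<lambda>n. E n - e n) \<in> O(\<lambda>n. real n * r ^ n)" and e: "e \<in> O(\<lambda>n. real n)"
    and G: "(\<lambda>n. G n - g n) \<in> O(\<lambda>n. (real n)\<^sup>2 * r ^ n)" and r: "0 < r" "r < 1"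
  shows "(\<lambda>n. (G n + E n - (E n)\<^sup>2) - (g n + e n - (e n)\<^sup>2)) \<in> O(\<lambda>n. (real n)\<^sup>2 * r ^ n)"
proof -
  have "(\<lambda>n. r ^ n) \<in> O(\<lambda>_. 1)"
    using r by (intro bigoI[of _ 1] always_eventually) (auto simp: power_le_one)
  hence "(\<lambda>n. E n - e n) \<in> O(\<lambda>n. real n)"
    using landau_o.big_trans[OF E] landau_o.big.mult[OF landau_o.big_refl] by fastforce
  hence "(\<lambda>n. (E n - e n) + e n + e n) \<in> O(\<lambda>n. real n)"
    using e by (intro sum_in_bigo(1)) auto
  hence "(\<lambda>n. (E n - e n) * (E n + e n)) \<in> O(\<lambda>n. real n * r ^ n * real n)"
    by (intro landau_o.big.mult E) simp
  hence square: "(\<lambda>n. (E n - e n) * (E n + e n)) \<in> O(\<lambda>n. (real n)\<^sup>2 * r ^ n)"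
    by (simp add: power2_eq_square mult_ac)
  have "(\<lambda>n. real n * r ^ n) \<in> O(\<lambda>n. (real n)\<^sup>2 * r ^ n)"
    by (intro landau_o.big.mult_right) real_asymp
  hence "(\<lambda>n. E n - e n) \<in> O(\<lambda>n. (real n)\<^sup>2 * r ^ n)" by (rule landau_o.big_trans[OF E])
  hence "(\<lambda>n. (G n - g n) + (E n - e n) - (E n - e n) * (E n + e n)) \<in> O(\<lambda>n. (real n)\<^sup>2 * r ^ n)"
    by (rule sum_in_bigo(2)[OF sum_in_bigo(1)[OF G] square])
  thus ?thesis by (simp add: power2_eq_square algebra_simps)
qed

definition gf_mean :: "real poly \<Rightarrow> real" where
  "gf_mean P = poly (pderiv P) 1 / poly P 1"

definition gf_variance :: "real poly \<Rightarrow> real" where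
  "gf_variance P = poly (pderiv (pderiv P)) 1 / poly P 1 + gf_mean P - (gf_mean P)\<^sup>2"

definition q_poly :: "nat \<Rightarrow> real \<Rightarrow> real poly" where
  "q_poly w M = [:1 / M:] + smult ((M - 1) / M) (\<Sum>i<w. monom 1 i)"

lemma one_minus_X_mult_q_poly:
  assumes "M \<noteq> 0"
  shows "[:1, -1:] * q_poly w M = [:1, - (1 / M):] - monom ((M - 1) / M) w"
proof -
  have "[:0, 1:] ^ n = (monom 1 n :: real poly)" for n by (simp add: monom_altdef)
  hence "[:1, -1:] * (\<Sum>i<w. monom 1 i) = (1 - monom 1 w :: real poly)"
    using one_diff_power_eq[of "[:0, 1:] :: real poly" w] by (simp add: one_pCons)
  hence "[:1, -1:] * q_poly w M = [:1, -1:] * [:1 / M:] + smult ((M - 1) / M) (1 - monom 1 w)"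
    by (simp add: q_poly_def distrib_left)
  thus ?thesis using assms by (simp add: smult_diff_right smult_monom one_pCons field_simps)
qed

locale naf_parameters =
  fixes M :: real and w :: nat
  assumes M_ge_1: "M \<ge> 1" and w_ge_2: "w \<ge> 2"
begin

definition denom :: real where "denom = (M - 1) * real w + 1"

definition digit_count :: real where "digit_count = (M - 1) * M ^ (w - 1)"

definition occurrence_gf :: "nat \<Rightarrow> real poly" where
  "occurrence_gf = naf_gf w [:digit_count - 1, 1:]"

definition q_radius :: ereal where "q_radius = ereal (1 + 9 / (8 * M * real w ^ 3))"

lemma M_pos: "M > 0" and denom_pos: "denom > 0" and w_pos: "w > 0"
  using M_ge_1 w_ge_2 by (auto simp: denom_def intro: add_nonneg_pos)

lemma M_power_w: "M ^ w = M * M ^ (w - 1)"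
  using w_pos by (simp add: power_eq_if)

lemma rho_bounds: "0 < rho M w" "rho M w < 1"
proof -
  have "1 / (M * real w ^ 3) > 0" using M_pos w_pos by simp
  thus "0 < rho M w" "rho M w < 1"
    unfolding rho_def by (auto intro!: inverse_less_1_iff[THEN iffD2] add_pos_pos)
qed

lemma fps_nth_bigo_rho:
  assumes "fps_conv_radius h \<ge> q_radius"
  shows "fps_nth h \<in> O(\<lambda>n. rho M w ^ n)"
proof -
  have "ereal (inverse (rho M w)) < q_radius"
    using M_pos w_pos by (simp add: rho_def q_radius_def field_simps)
  with assms show ?thesis
    using fps_nth_bigo_if_conv_radius[of "inverse (rho M w)" h] rho_bounds by simp
qed

lemma q_poly_nonzero:
  fixes z :: complex
  assumes z: "norm z < 1 + 9 / (8 * M * real w ^ 3)"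
  shows "poly (map_poly of_real (q_poly w M)) z \<noteq> 0"
proof (cases "z = 1")
  case True
  have "poly (q_poly w M) 1 = denom / M"
    using M_pos by (simp add: q_poly_def poly_sum poly_monom denom_def field_simps)
  thus ?thesis using denom_pos M_pos poly_of_real_poly[of "q_poly w M" 1, where 'a = complex] True by auto
next
  case False
  let ?of_real = "map_poly complex_of_real"
  have "?of_real [:1, -1:] * ?of_real (q_poly w M) = ?of_real ([:1, - (1 / M):] - monom ((M - 1) / M) w)"
    unfolding one_minus_X_mult_q_poly[OF M_pos[THEN less_imp_neq, symmetric], symmetric]
    by (rule map_poly_hom_mult[symmetric]) auto
  also have "\<dots> = [:1, - of_real (1 / M):] - monom (of_real ((M - 1) / M)) w"
    by (rule poly_eqI) (simp add: coeff_map_poly coeff_pCons split: nat.splits)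
  finally have "poly (?of_real [:1, -1:] * ?of_real (q_poly w M)) z =
      poly ([:1, - of_real (1 / M):] - monom (of_real ((M - 1) / M)) w) z" by simp
  hence one_minus_z_mult_q: "(1 - z) * poly (?of_real (q_poly w M)) z =
      (of_real M - (z + of_real (M - 1) * z ^ w)) / of_real M"
    using M_pos
    by (simp add: map_poly_pCons poly_monom left_diff_distrib diff_divide_distrib add_divide_distrib)
  have "of_real M \<noteq> z + of_real (M - 1) * z ^ w"
    using norm_trinomial_root_ge[OF M_ge_1 w_ge_2 False] z by fastforce
  thus ?thesis using one_minus_z_mult_q M_pos by auto
qed

lemma coeff_0_q_poly: "coeff (q_poly w M) 0 = 1"
  using M_pos w_pos by (simp add: q_poly_def coeff_sum field_simps)

text \<open>Rescaling by \<open>M\<close> moves the dominant pole to \<open>1\<close>.\<close>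

definition scaled_fps :: "real fps" where
  "scaled_fps = naf_fps w digit_count oo (fps_const (1 / M) * fps_X)"

lemma scaled_fps_eq: "scaled_fps = geometric_fps * inverse (fps_of_poly (q_poly w M))"
proof -
  let ?s = "fps_const (1 / M) * fps_X :: real fps"
  let ?q = "fps_of_poly (q_poly w M)"
  have "digit_count * (1 / M) ^ w = (M - 1) / M"
    using M_pos by (simp add: digit_count_def power_one_over M_power_w)
  hence "fps_const digit_count * ?s ^ w = fps_const ((M - 1) / M) * fps_X ^ w"
    by (simp add: power_mult_distrib fps_const_power flip: mult.assoc)
  hence "(1 - fps_X - fps_const digit_count * fps_X ^ w) oo ?s = 1 - ?s - fps_const ((M - 1) / M) * fps_X ^ w"
    by (simp add: fps_compose_sub_distrib fps_compose_mult_distrib fps_X_power_compose)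
  also have "\<dots> = fps_of_poly ([:1, - (1 / M):] - monom ((M - 1) / M) w)"
    by (simp add: fps_of_poly_diff fps_of_poly_linear' fps_of_poly_monom flip: fps_const_neg)
  also have "\<dots> = fps_of_poly [:1, -1:] * ?q"
    using one_minus_X_mult_q_poly[of M w] M_pos by (simp flip: fps_of_poly_mult)
  also have "fps_of_poly [:1, -1:] = (1 - fps_X :: real fps)"
    by (simp add: fps_of_poly_linear' flip: fps_const_neg)
  finally have "scaled_fps * ((1 - fps_X) * ?q) =
      (naf_fps w digit_count * (1 - fps_X - fps_const digit_count * fps_X ^ w)) oo ?s"
    by (simp add: scaled_fps_def fps_compose_mult_distrib)
  also have "\<dots> = 1" using w_pos by (simp add: naf_fps_mult_denominator)
  finally have "scaled_fps * ((1 - fps_X) * ?q) = 1" .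
  moreover have "?q * inverse ?q = 1" using coeff_0_q_poly by (simp add: inverse_mult_eq_1')
  ultimately show ?thesis using one_minus_X_mult_geometric_fps by algebra
qed

text \<open>The expansion of \<open>q\<close> at \<open>u = 1\<close> begins with \<open>1 / \<alpha> - \<beta> (1 - u) + \<gamma> (1 - u)\<^sup>2\<close>.\<close>

definition \<alpha> :: real where "\<alpha> = M / denom"

definition \<beta> :: real where "\<beta> = (M - 1) / M * real (w choose 2)"

definition \<gamma> :: real where "\<gamma> = (M - 1) / M * real (w choose 3)"

lemma fps_q_poly_taylor:
  obtains p :: "real poly" where "fps_of_poly (q_poly w M) =
    fps_const (inverse \<alpha>) - fps_const \<beta> * (1 - fps_X) + fps_const \<gamma> * (1 - fps_X) ^ 2 -
    (1 - fps_X) ^ 3 * fps_of_poly p"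
proof -
  let ?v = "1 - fps_X :: real fps"
  have v: "fps_of_poly [:1, -1:] = ?v" by (simp add: fps_of_poly_linear' flip: fps_const_neg)
  obtain p :: "real poly" where p: "(\<Sum>i<w. monom 1 i) =
      of_nat w - of_nat (w choose 2) * [:1, -1:] + of_nat (w choose 3) * [:1, -1:] ^ 2 - [:1, -1:] ^ 3 * p"
    using geometric_sum_taylor by blast
  have "fps_of_poly (q_poly w M) = fps_const (1 / M + (M - 1) / M * real w) - fps_const \<beta> * ?v +
      fps_const \<gamma> * ?v ^ 2 - ?v ^ 3 * fps_of_poly (smult ((M - 1) / M) p)"
    unfolding q_poly_def p
    by (simp add: fps_of_poly_add fps_of_poly_diff fps_of_poly_smult fps_of_poly_mult fps_of_poly_power v
        of_nat_poly fps_of_poly_const \<beta>_def \<gamma>_def algebra_simps flip: fps_const_add fps_const_mult)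
  also have "1 / M + (M - 1) / M * real w = inverse \<alpha>"
    using M_pos denom_pos by (simp add: \<alpha>_def denom_def field_simps)
  finally show ?thesis by (rule that)
qed

lemma scaled_fps_taylor:
  obtains h where "fps_conv_radius h \<ge> q_radius"
    "scaled_fps = geometric_fps * (fps_const \<alpha> + fps_const (\<beta> * \<alpha> ^ 2) * (1 - fps_X) +
       fps_const (\<beta> ^ 2 * \<alpha> ^ 3 - \<gamma> * \<alpha> ^ 2) * (1 - fps_X) ^ 2 - (1 - fps_X) ^ 3 * h)"
proof -
  let ?v = "1 - fps_X :: real fps"
  define q Q where "q = fps_of_poly (q_poly w M)" and "Q = inverse q"
  obtain p where q: "q = fps_const (inverse \<alpha>) - fps_const \<beta> * ?v + fps_const \<gamma> * ?v ^ 2 -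
      ?v ^ 3 * fps_of_poly p"
    unfolding q_def by (rule fps_q_poly_taylor)
  have qQ: "q * Q = 1" unfolding q_def Q_def using coeff_0_q_poly by (simp add: inverse_mult_eq_1')
  have alpha_unit: "fps_const (inverse \<alpha>) * fps_const \<alpha> = 1" using M_pos denom_pos by (simp add: \<alpha>_def)
  define b1 b2 where "b1 = fps_const \<beta> * fps_const \<alpha> ^ 2"
    and "b2 = fps_const \<beta> ^ 2 * fps_const \<alpha> ^ 3 - fps_const \<gamma> * fps_const \<alpha> ^ 2"
  define h where "h = Q * (fps_const \<gamma> * b1 - fps_const \<beta> * b2 + fps_const \<gamma> * b2 * ?v -
     fps_of_poly p * (fps_const \<alpha> + b1 * ?v + b2 * ?v ^ 2))"
  have "Q = fps_const \<alpha> + b1 * ?v + b2 * ?v ^ 2 - ?v ^ 3 * h"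
    unfolding h_def b1_def b2_def by (rule inverse_taylor[OF q qQ alpha_unit])
  moreover have "b1 = fps_const (\<beta> * \<alpha> ^ 2)" "b2 = fps_const (\<beta> ^ 2 * \<alpha> ^ 3 - \<gamma> * \<alpha> ^ 2)"
    by (simp_all add: b1_def b2_def fps_const_power)
  moreover have "fps_conv_radius Q \<ge> q_radius"
    unfolding Q_def q_def q_radius_def
    by (rule fps_conv_radius_inverse_real_poly) (use coeff_0_q_poly q_poly_nonzero in auto)
  hence "fps_conv_radius h \<ge> q_radius" unfolding h_def b1_def b2_def
    by (intro fps_conv_radius_mult_ge fps_conv_radius_add_ge fps_conv_radius_diff_ge
        fps_conv_radius_power_ge) auto
  ultimately show ?thesis using that scaled_fps_eq unfolding q_def Q_def by metis
qed

lemma scaled_fps_power_expansions: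
  obtains h1 h2 h3 where
    "fps_conv_radius h1 \<ge> q_radius" "fps_conv_radius h2 \<ge> q_radius" "fps_conv_radius h3 \<ge> q_radius"
    "scaled_fps = fps_const \<alpha> * geometric_fps + h1"
    "scaled_fps ^ 2 = fps_const (\<alpha> ^ 2) * geometric_fps ^ 2 + fps_const (2 * \<alpha> ^ 3 * \<beta>) * geometric_fps + h2"
    "scaled_fps ^ 3 = fps_const (\<alpha> ^ 3) * geometric_fps ^ 3 + fps_const (3 * \<alpha> ^ 4 * \<beta>) * geometric_fps ^ 2 +
       fps_const (6 * \<alpha> ^ 5 * \<beta> ^ 2 - 3 * \<alpha> ^ 4 * \<gamma>) * geometric_fps + h3"
proof -
  let ?v = "1 - fps_X :: real fps"
  define A B1 B2 where "A = fps_const \<alpha>" and "B1 = fps_const (\<beta> * \<alpha> ^ 2)"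
    and "B2 = fps_const (\<beta> ^ 2 * \<alpha> ^ 3 - \<gamma> * \<alpha> ^ 2)"
  obtain h where h: "fps_conv_radius h \<ge> q_radius"
    "scaled_fps = geometric_fps * (A + B1 * ?v + B2 * ?v ^ 2 - ?v ^ 3 * h)"
    using scaled_fps_taylor unfolding A_def B1_def B2_def by blast
  define g1 g2 where "g1 = B1 + B2 * ?v - ?v ^ 2 * h" and "g2 = B2 - ?v * h"
  note powers = simple_pole_powers[OF one_minus_X_mult_geometric_fps h(2), folded g1_def g2_def]
  have const: "fps_const (\<alpha> ^ 2) = A ^ 2" "fps_const (\<alpha> ^ 3) = A ^ 3"
    "fps_const (2 * \<alpha> ^ 3 * \<beta>) = 2 * A * B1" "fps_const (3 * \<alpha> ^ 4 * \<beta>) = 3 * A ^ 2 * B1"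
    "fps_const (6 * \<alpha> ^ 5 * \<beta> ^ 2 - 3 * \<alpha> ^ 4 * \<gamma>) = 3 * A ^ 2 * B2 + 3 * A * B1 ^ 2"
    by (simp_all add: A_def B1_def B2_def fps_const_power numeral_fps_const eval_nat_numeral algebra_simps)
  note radius_ge = fps_conv_radius_mult_ge fps_conv_radius_add_ge fps_conv_radius_diff_ge
    fps_conv_radius_power_ge h(1)
  have radius_g: "fps_conv_radius g1 \<ge> q_radius" "fps_conv_radius g2 \<ge> q_radius"
    unfolding g1_def g2_def B1_def B2_def by (intro radius_ge; simp)+
  show ?thesis
  proof (rule that)
    show "fps_conv_radius g1 \<ge> q_radius" by (rule radius_g)
    show "fps_conv_radius (2 * A * g2 + g1 ^ 2) \<ge> q_radius"
      "fps_conv_radius (3 * A * (B1 * g2 + g1 * g2) - 3 * A ^ 2 * h + g1 ^ 3) \<ge> q_radius"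
      unfolding A_def B1_def by (intro radius_ge radius_g; simp)+
    show "scaled_fps = fps_const \<alpha> * geometric_fps + g1"
      using powers(1) unfolding A_def .
    show "scaled_fps ^ 2 = fps_const (\<alpha> ^ 2) * geometric_fps ^ 2 + fps_const (2 * \<alpha> ^ 3 * \<beta>) * geometric_fps +
        (2 * A * g2 + g1 ^ 2)"
      unfolding const by (rule powers(2))
    show "scaled_fps ^ 3 =
        fps_const (\<alpha> ^ 3) * geometric_fps ^ 3 + fps_const (3 * \<alpha> ^ 4 * \<beta>) * geometric_fps ^ 2 +
        fps_const (6 * \<alpha> ^ 5 * \<beta> ^ 2 - 3 * \<alpha> ^ 4 * \<gamma>) * geometric_fps +
        (3 * A * (B1 * g2 + g1 * g2) - 3 * A ^ 2 * h + g1 ^ 3)"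
      unfolding const by (rule powers(3))
  qed
qed

text \<open>The shift by \<open>w - 1\<close> turns \<open>scaled_fps\<close> back into the counts themselves.\<close>

definition scaled_count :: "nat \<Rightarrow> real" where
  "scaled_count n = fps_nth scaled_fps (n + w - 1)"

lemma occurrence_gf_factorial_moments:
  shows "poly (occurrence_gf n) 1 = M ^ (n + w - 1) * scaled_count n"
    and "n \<ge> 1 \<Longrightarrow> poly (pderiv (occurrence_gf n)) 1 = M ^ (n - 1) * fps_nth (scaled_fps ^ 2) (n - 1)"
    and "n \<ge> w + 1 \<Longrightarrow> poly (pderiv (pderiv (occurrence_gf n))) 1 =
           2 * M ^ (n - 1 - w) * fps_nth (scaled_fps ^ 3) (n - 1 - w)"
proof -
  have power: "scaled_fps ^ k = naf_fps w digit_count ^ k oo (fps_const (1 / M) * fps_X)" for k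
    unfolding scaled_fps_def by (rule fps_compose_power) simp
  have "fps_nth (scaled_fps ^ k) n = (1 / M) ^ n * fps_nth (naf_fps w digit_count ^ k) n" for k n
    unfolding power by (rule fps_nth_compose_linear)
  hence nth: "fps_nth (naf_fps w digit_count ^ k) n = M ^ n * fps_nth (scaled_fps ^ k) n" for k n
    using M_pos by (simp add: power_one_over)
  have "w \<ge> 1" using w_pos by simp
  note moments = naf_gf_factorial_moments[OF this, where c = "digit_count - 1" and y = 1,
      folded occurrence_gf_def]
  show "poly (occurrence_gf n) 1 = M ^ (n + w - 1) * scaled_count n"
    using moments(1) nth[of 1] by (simp add: scaled_count_def)
  show "poly (pderiv (occurrence_gf n)) 1 = M ^ (n - 1) * fps_nth (scaled_fps ^ 2) (n - 1)" if "n \<ge> 1"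
    using that moments(2) nth[of 2] by simp
  show "poly (pderiv (pderiv (occurrence_gf n))) 1 =
      2 * M ^ (n - 1 - w) * fps_nth (scaled_fps ^ 3) (n - 1 - w)" if "n \<ge> w + 1"
    using that moments(3) nth[of 3] by simp
qed

end

lemma bigo_geometric_mult_power:
  fixes f :: "nat \<Rightarrow> real"
  assumes "f \<in> O(\<lambda>n. r ^ n)"
  shows "f \<in> O(\<lambda>n. real n ^ k * r ^ n)"
proof -
  have "(\<lambda>n. 1) \<in> O(\<lambda>n. real n ^ k)"
    by (intro bigoI[of _ 1] eventually_mono[OF eventually_ge_at_top[of 1]]) simp
  from landau_o.big.mult[OF this assms] show ?thesis by simp
qed

lemma variance_main_term_identity:
  fixes M w n m K a s1 s2 p g :: real
  assumes "M \<noteq> 0" "m \<noteq> 0" "K \<noteq> 0" and K: "K = (M - 1) * w + 1" and a: "a = M / K"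
    and s1: "s1 = (M - 1) / M * (w * (w - 1) / 2)" and s2: "s2 = (M - 1) / M * (w * (w - 1) * (w - 2) / 6)"
    and p: "p = n / (m * K) + (M - 1) * (w - 1) * w / (m * K\<^sup>2)"
    and g: "g = 2 * (a\<^sup>2 * ((n - w) * (n - w + 1) / 2) + 3 * a ^ 3 * s1 * (n - w)
                 + (6 * a ^ 4 * s1\<^sup>2 - 3 * a ^ 3 * s2)) / (M * m)\<^sup>2"
  shows "g + p - p\<^sup>2 = (m * K\<^sup>2 - ((M - 1) * w\<^sup>2 + 2 * w - 1)) / (m\<^sup>2 * K ^ 3) * n +
       (w - 1) * w * (- (w - 1)\<^sup>2 - M\<^sup>2 * w\<^sup>2 + (M - 1) * m * K\<^sup>2 + 2 * M * (w\<^sup>2 - w + 1)) / (m\<^sup>2 * K ^ 4)"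
    (is "_ = ?v / (m\<^sup>2 * K ^ 3) * n + ?c / (m\<^sup>2 * K ^ 4)")
proof -
  have g': "g = ((n - w) * (n - w + 1) * K\<^sup>2 + 3 * (M - 1) * w * (w - 1) * (n - w) * K
      + 3 * (M - 1)\<^sup>2 * w\<^sup>2 * (w - 1)\<^sup>2 - (M - 1) * w * (w - 1) * (w - 2) * K) / (m\<^sup>2 * K ^ 4)"
    using assms(1-3) unfolding g a s1 s2
    by (simp add: field_simps power2_eq_square power3_eq_cube power4_eq_xxxx)
  have "(g + p - p\<^sup>2) * (m\<^sup>2 * K ^ 4) = (n - w) * (n - w + 1) * K\<^sup>2 + 3 * (M - 1) * w * (w - 1) * (n - w) * K
      + 3 * (M - 1)\<^sup>2 * w\<^sup>2 * (w - 1)\<^sup>2 - (M - 1) * w * (w - 1) * (w - 2) * K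
      + n * m * K ^ 3 + (M - 1) * w * (w - 1) * m * K\<^sup>2 - (n * K + (M - 1) * w * (w - 1))\<^sup>2"
    using assms(1-3) unfolding p g'
    by (simp add: field_simps power2_eq_square power3_eq_cube power4_eq_xxxx)
  also have "\<dots> = ?v * K * n + ?c" unfolding K by algebra
  finally have "g + p - p\<^sup>2 = (?v * K * n + ?c) / (m\<^sup>2 * K ^ 4)"
    using assms(2,3) by (simp add: eq_divide_eq)
  also have "\<dots> = ?v / (m\<^sup>2 * K ^ 3) * n + ?c / (m\<^sup>2 * K ^ 4)"
    using assms(2,3) by (simp add: add_divide_distrib power4_eq_xxxx power3_eq_cube)
  finally show ?thesis .
qed

context naf_parameters
begin

lemma \<alpha>_pos: "\<alpha> > 0"
  using M_pos denom_pos by (simp add: \<alpha>_def)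

lemma scaled_count_bigo: "(\<lambda>n. scaled_count n - \<alpha>) \<in> O(\<lambda>n. rho M w ^ n)"
proof -
  obtain h where h: "fps_conv_radius h \<ge> q_radius" "scaled_fps = fps_const \<alpha> * geometric_fps + h"
    using scaled_fps_power_expansions by blast
  have "fps_nth (fps_shift (w - 1) h) \<in> O(\<lambda>n. rho M w ^ n)"
    by (rule fps_nth_bigo_rho) (simp add: h(1))
  also have "fps_nth (fps_shift (w - 1) h) = (\<lambda>n. scaled_count n - \<alpha>)"
    using w_pos by (auto simp: scaled_count_def h(2) fps_nth_geometric_fps_powers fun_eq_iff)
  finally show ?thesis .
qed

lemma fps_nth_scaled_fps_square_bigo:
  "(\<lambda>n. fps_nth (scaled_fps ^ 2) (n - 1) - (\<alpha> ^ 2 * real n + 2 * \<alpha> ^ 3 * \<beta>)) \<in> O(\<lambda>n. rho M w ^ n)"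
proof -
  obtain h where h: "fps_conv_radius h \<ge> q_radius"
    "scaled_fps ^ 2 = fps_const (\<alpha> ^ 2) * geometric_fps ^ 2 + fps_const (2 * \<alpha> ^ 3 * \<beta>) * geometric_fps + h"
    using scaled_fps_power_expansions by blast
  have "fps_nth (fps_X * h) \<in> O(\<lambda>n. rho M w ^ n)"
    by (rule fps_nth_bigo_rho) (auto intro!: fps_conv_radius_mult_ge h(1))
  also have "?this \<longleftrightarrow> ?thesis"
    by (intro landau_o.big.in_cong eventually_mono[OF eventually_ge_at_top[of 1]])
       (auto simp: h(2) fps_nth_geometric_fps_powers of_nat_diff)
  finally show ?thesis .
qed

lemma fps_nth_scaled_fps_cube_bigo:
  "(\<lambda>n. fps_nth (scaled_fps ^ 3) (n - 1 - w) - (\<alpha> ^ 3 * ((real n - real w) * (real n - real w + 1) / 2)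
      + 3 * \<alpha> ^ 4 * \<beta> * (real n - real w) + (6 * \<alpha> ^ 5 * \<beta> ^ 2 - 3 * \<alpha> ^ 4 * \<gamma>))) \<in> O(\<lambda>n. rho M w ^ n)"
proof -
  obtain h where h: "fps_conv_radius h \<ge> q_radius"
    "scaled_fps ^ 3 = fps_const (\<alpha> ^ 3) * geometric_fps ^ 3 + fps_const (3 * \<alpha> ^ 4 * \<beta>) * geometric_fps ^ 2 +
       fps_const (6 * \<alpha> ^ 5 * \<beta> ^ 2 - 3 * \<alpha> ^ 4 * \<gamma>) * geometric_fps + h"
    using scaled_fps_power_expansions by blast
  have "fps_nth (fps_X ^ (w + 1) * h) \<in> O(\<lambda>n. rho M w ^ n)"
    by (rule fps_nth_bigo_rho) (auto intro!: fps_conv_radius_mult_ge h(1))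
  also have "?this \<longleftrightarrow> ?thesis"
  proof (intro landau_o.big.in_cong eventually_mono[OF eventually_ge_at_top[of "w + 1"]])
    fix n :: nat assume n: "n \<ge> w + 1"
    hence "real (n - 1 - w) + 1 = real n - real w" "real (n - 1 - w) + 2 = real n - real w + 1"
      by (auto simp: of_nat_diff)
    moreover have "fps_nth (fps_X ^ (w + 1) * h) n = fps_nth h (n - 1 - w)"
      using n unfolding fps_X_power_mult_nth by simp
    ultimately show "fps_nth (fps_X ^ (w + 1) * h) n = fps_nth (scaled_fps ^ 3) (n - 1 - w) -
        (\<alpha> ^ 3 * ((real n - real w) * (real n - real w + 1) / 2)
         + 3 * \<alpha> ^ 4 * \<beta> * (real n - real w) + (6 * \<alpha> ^ 5 * \<beta> ^ 2 - 3 * \<alpha> ^ 4 * \<gamma>))"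
      by (simp add: h(2) fps_nth_geometric_fps_powers)
  qed
  finally show ?thesis .
qed

lemma occurrence_gf_count_asymptotics:
  "(\<lambda>n. poly (occurrence_gf n) 1 - 1 / denom * M ^ (n + w)) \<in> O(\<lambda>n. (rho M w * M) ^ n)"
proof -
  have "poly (occurrence_gf n) 1 - 1 / denom * M ^ (n + w) =
      M ^ (w - 1) * (M ^ n * (scaled_count n - \<alpha>))" for n
  proof -
    have "M ^ (n + w - 1) = M ^ n * M ^ (w - 1)" using w_pos by (simp flip: power_add)
    thus ?thesis
      using denom_pos by (simp add: occurrence_gf_factorial_moments(1) \<alpha>_def power_add M_power_w field_simps)
  qed
  moreover have "(\<lambda>n. M ^ (w - 1) * (M ^ n * (scaled_count n - \<alpha>))) \<in> O(\<lambda>n. 1 * (M ^ n * rho M w ^ n))"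
    by (intro landau_o.big.mult scaled_count_bigo) auto
  ultimately show ?thesis by (simp add: power_mult_distrib mult_ac)
qed

definition main_mean :: "nat \<Rightarrow> real" where
  "main_mean n = e_coeff M w * real n + (M - 1) * (real w - 1) * real w / (M ^ (w - 1) * denom\<^sup>2)"

definition main_second_moment :: "nat \<Rightarrow> real" where
  "main_second_moment n = 2 * (\<alpha>\<^sup>2 * ((real n - real w) * (real n - real w + 1) / 2) +
     3 * \<alpha> ^ 3 * \<beta> * (real n - real w) + (6 * \<alpha> ^ 4 * \<beta>\<^sup>2 - 3 * \<alpha> ^ 3 * \<gamma>)) / (M * M ^ (w - 1))\<^sup>2"

definition main_variance :: "nat \<Rightarrow> real" where
  "main_variance n = v_coeff M w * real n + (real w - 1) * real w
     * (- (real w - 1)\<^sup>2 - M\<^sup>2 * (real w)\<^sup>2 + (M - 1) * M ^ (w - 1) * denom\<^sup>2 + 2 * M * ((real w)\<^sup>2 - real w + 1))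
     / (M ^ (2 * w - 2) * denom ^ 4)"

lemma \<beta>_eq: "\<beta> = (M - 1) / M * (real w * (real w - 1) / 2)"
  by (simp add: \<beta>_def binomial_gbinomial gbinomial_prod_rev numeral_2_eq_2 algebra_simps)

lemma \<gamma>_eq: "\<gamma> = (M - 1) / M * (real w * (real w - 1) * (real w - 2) / 6)"
  by (simp add: \<gamma>_def binomial_gbinomial gbinomial_prod_rev numeral_3_eq_3 fact_numeral algebra_simps)

lemma main_variance_eq: "main_variance n = main_second_moment n + main_mean n - (main_mean n)\<^sup>2"
proof -
  have "M ^ (2 * w - 2) = (M ^ (w - 1))\<^sup>2"
    by (simp flip: power_mult add: mult.commute right_diff_distrib')
  moreover have "main_mean n = real n / (M ^ (w - 1) * denom) +
      (M - 1) * (real w - 1) * real w / (M ^ (w - 1) * denom\<^sup>2)"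
    by (simp add: main_mean_def e_coeff_def denom_def)
  ultimately show ?thesis
    using variance_main_term_identity[OF _ _ _ denom_def \<alpha>_def \<beta>_eq \<gamma>_eq _ main_second_moment_def,
        of "main_mean n" n] M_pos denom_pos
    by (simp add: main_variance_def v_coeff_def denom_def)
qed

lemma gf_mean_occurrence_gf_asymptotics:
  "(\<lambda>n. gf_mean (occurrence_gf n) - main_mean n) \<in> O(\<lambda>n. real n * rho M w ^ n)"
proof -
  have main_mean_mult_alpha: "main_mean n * \<alpha> = (\<alpha> ^ 2 * real n + 2 * \<alpha> ^ 3 * \<beta>) / M ^ w" for n
    using M_pos denom_pos unfolding main_mean_def e_coeff_def denom_def[symmetric] \<alpha>_def \<beta>_eq M_power_w
    by (simp add: field_simps power2_eq_square power3_eq_cube)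
  have "(\<lambda>n. (fps_nth (scaled_fps ^ 2) (n - 1) - (\<alpha> ^ 2 * real n + 2 * \<alpha> ^ 3 * \<beta>)) / M ^ w) \<in>
      O(\<lambda>n. real n ^ 1 * rho M w ^ n)"
    using M_pos fps_nth_scaled_fps_square_bigo by (intro bigo_geometric_mult_power) simp
  hence "(\<lambda>n. fps_nth (scaled_fps ^ 2) (n - 1) / M ^ w - main_mean n * \<alpha>) \<in> O(\<lambda>n. real n ^ 1 * rho M w ^ n)"
    by (simp add: main_mean_mult_alpha diff_divide_distrib)
  moreover have "main_mean \<in> O(\<lambda>n. real n ^ 1)"
    unfolding main_mean_def by real_asymp
  ultimately have "(\<lambda>n. fps_nth (scaled_fps ^ 2) (n - 1) / M ^ w / scaled_count n - main_mean n) \<in>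
      O(\<lambda>n. real n ^ 1 * rho M w ^ n)"
    by (rule quotient_bigo_geometric[OF _ scaled_count_bigo _ rho_bounds]) (use \<alpha>_pos in simp)
  also have "?this \<longleftrightarrow> (\<lambda>n. gf_mean (occurrence_gf n) - main_mean n) \<in> O(\<lambda>n. real n ^ 1 * rho M w ^ n)"
  proof (intro landau_o.big.in_cong eventually_mono[OF eventually_ge_at_top[of 1]])
    fix n :: nat assume "n \<ge> 1"
    moreover from this have "M ^ (n + w - 1) = M ^ (n - 1) * M ^ w" by (simp flip: power_add)
    ultimately show "fps_nth (scaled_fps ^ 2) (n - 1) / M ^ w / scaled_count n - main_mean n =
        gf_mean (occurrence_gf n) - main_mean n"
      using M_pos by (simp add: gf_mean_def occurrence_gf_factorial_moments)
  qed
  finally show ?thesis by simp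
qed

lemma occurrence_gf_second_moment_asymptotics:
  "(\<lambda>n. poly (pderiv (pderiv (occurrence_gf n))) 1 / poly (occurrence_gf n) 1 - main_second_moment n)
     \<in> O(\<lambda>n. (real n)\<^sup>2 * rho M w ^ n)"
proof -
  define x y where "x = (\<lambda>n. fps_nth (scaled_fps ^ 3) (n - 1 - w))"
    and "y = (\<lambda>n. \<alpha> ^ 3 * ((real n - real w) * (real n - real w + 1) / 2)
      + 3 * \<alpha> ^ 4 * \<beta> * (real n - real w) + (6 * \<alpha> ^ 5 * \<beta> ^ 2 - 3 * \<alpha> ^ 4 * \<gamma>))"
  have main_second_moment_mult_alpha: "main_second_moment n * \<alpha> = 2 / (M ^ w)\<^sup>2 * y n" for n
    unfolding main_second_moment_def M_power_w[symmetric] y_def times_divide_eq_left[symmetric]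
    by (simp add: algebra_simps eval_nat_numeral)
  have "(\<lambda>n. x n - y n) \<in> O(\<lambda>n. rho M w ^ n)"
    unfolding x_def y_def by (rule fps_nth_scaled_fps_cube_bigo)
  hence "(\<lambda>n. 2 / (M ^ w)\<^sup>2 * (x n - y n)) \<in> O(\<lambda>n. (real n)\<^sup>2 * rho M w ^ n)"
    using M_pos by (intro bigo_geometric_mult_power) (subst landau_o.big.cmult_in_iff, auto)
  hence "(\<lambda>n. 2 / (M ^ w)\<^sup>2 * x n - main_second_moment n * \<alpha>) \<in> O(\<lambda>n. (real n)\<^sup>2 * rho M w ^ n)"
    by (simp only: main_second_moment_mult_alpha right_diff_distrib)
  moreover have "main_second_moment \<in> O(\<lambda>n. (real n)\<^sup>2)"
    unfolding main_second_moment_def using M_pos by real_asymp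
  ultimately have "(\<lambda>n. 2 / (M ^ w)\<^sup>2 * x n / scaled_count n - main_second_moment n) \<in>
      O(\<lambda>n. (real n)\<^sup>2 * rho M w ^ n)"
    by (rule quotient_bigo_geometric[OF _ scaled_count_bigo _ rho_bounds]) (use \<alpha>_pos in simp)
  also have "?this \<longleftrightarrow> ?thesis"
  proof (intro landau_o.big.in_cong eventually_mono[OF eventually_ge_at_top[of "w + 1"]])
    fix n :: nat assume n: "n \<ge> w + 1"
    hence "n + w - 1 = (n - 1 - w) + w * 2" by simp
    hence "M ^ (n + w - 1) = M ^ (n - 1 - w) * (M ^ w)\<^sup>2" by (simp only: power_add power_mult)
    thus "2 / (M ^ w)\<^sup>2 * x n / scaled_count n - main_second_moment n =
        poly (pderiv (pderiv (occurrence_gf n))) 1 / poly (occurrence_gf n) 1 - main_second_moment n"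
      using n M_pos by (simp add: x_def occurrence_gf_factorial_moments)
  qed
  finally show ?thesis .
qed

lemma gf_variance_occurrence_gf_asymptotics:
  "(\<lambda>n. gf_variance (occurrence_gf n) - main_variance n) \<in> O(\<lambda>n. (real n)\<^sup>2 * rho M w ^ n)"
proof -
  have "main_mean \<in> O(\<lambda>n. real n)" unfolding main_mean_def by real_asymp
  from variance_bigo_geometric[OF gf_mean_occurrence_gf_asymptotics this
      occurrence_gf_second_moment_asymptotics rho_bounds]
  show ?thesis by (simp add: gf_variance_def main_variance_eq)
qed

end

section \<open>Generating polynomials of random words\<close>

definition gf_cdf :: "real poly \<Rightarrow> nat \<Rightarrow> real" where
  "gf_cdf P k = (\<Sum>j<k. coeff P j) / poly P 1"

definition counting_gf :: "'a set \<Rightarrow> ('a \<Rightarrow> nat) \<Rightarrow> real poly" where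
  "counting_gf S c = (\<Sum>x\<in>S. monom 1 (c x))"

lemma poly_counting_gf_1: "poly (counting_gf S c) 1 = real (card S)"
  by (simp add: counting_gf_def poly_sum poly_monom)

lemma poly_pderiv_counting_gf:
  "poly (pderiv (counting_gf S c)) 1 = (\<Sum>x\<in>S. real (c x))"
  "poly (pderiv (pderiv (counting_gf S c))) 1 = (\<Sum>x\<in>S. real (c x) * (real (c x) - 1))"
proof -
  show "poly (pderiv (counting_gf S c)) 1 = (\<Sum>x\<in>S. real (c x))"
    by (simp add: counting_gf_def pderiv_sum pderiv_monom poly_sum poly_monom)
  have falling: "real (k - Suc 0) * real k = real k * (real k - 1)" for k by (cases k) auto
  show "poly (pderiv (pderiv (counting_gf S c))) 1 = (\<Sum>x\<in>S. real (c x) * (real (c x) - 1))"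
    by (simp add: counting_gf_def pderiv_sum pderiv_monom poly_sum poly_monom falling)
qed

context
  fixes S :: "'a set" and c :: "'a \<Rightarrow> nat"
  assumes S: "finite S" "S \<noteq> {}"
begin

lemma expectation_pmf_of_set_eq_gf_mean:
  "measure_pmf.expectation (pmf_of_set S) (\<lambda>x. real (c x)) = gf_mean (counting_gf S c)"
  by (simp add: gf_mean_def integral_pmf_of_set S poly_counting_gf_1 poly_pderiv_counting_gf)

lemma variance_pmf_of_set_eq_gf_variance:
  "measure_pmf.variance (pmf_of_set S) (\<lambda>x. real (c x)) = gf_variance (counting_gf S c)"
proof -
  let ?E = "gf_mean (counting_gf S c)"
  have "integrable (measure_pmf (pmf_of_set S)) f" for f :: "'a \<Rightarrow> real"
    by (rule integrable_measure_pmf_finite) (simp add: S)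
  hence "measure_pmf.variance (pmf_of_set S) (\<lambda>x. real (c x)) =
      measure_pmf.expectation (pmf_of_set S) (\<lambda>x. (real (c x))\<^sup>2) - ?E\<^sup>2"
    by (subst measure_pmf.variance_eq) (auto simp: expectation_pmf_of_set_eq_gf_mean)
  also have "measure_pmf.expectation (pmf_of_set S) (\<lambda>x. (real (c x))\<^sup>2) =
      (\<Sum>x\<in>S. real (c x) * (real (c x) - 1) + real (c x)) / card S"
    by (simp add: integral_pmf_of_set S power2_eq_square algebra_simps)
  finally show ?thesis
    by (simp add: gf_variance_def gf_mean_def poly_counting_gf_1 poly_pderiv_counting_gf sum.distrib
        add_divide_distrib)
qed

lemma prob_pmf_of_set_eq_gf_cdf:
  "measure_pmf.prob (pmf_of_set S) {x. c x < k} = gf_cdf (counting_gf S c) k"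
proof -
  have "(\<Sum>j<k. coeff (counting_gf S c) j) = (\<Sum>x\<in>S. \<Sum>j<k. if c x = j then 1 else 0)"
    unfolding counting_gf_def coeff_sum by (subst sum.swap) (simp add: coeff_monom)
  also have "\<dots> = real (card (S \<inter> {x. c x < k}))" using S by (simp add: sum.If_cases)
  finally show ?thesis by (simp add: gf_cdf_def measure_pmf_of_set S poly_counting_gf_1)
qed

end

lemma gf_mean_smult: "a \<noteq> 0 \<Longrightarrow> gf_mean (smult a P) = gf_mean P"
  by (simp add: gf_mean_def pderiv_smult)

lemma gf_variance_smult: "a \<noteq> 0 \<Longrightarrow> gf_variance (smult a P) = gf_variance P"
  by (simp add: gf_variance_def gf_mean_smult pderiv_smult)

lemma gf_cdf_smult: "a \<noteq> 0 \<Longrightarrow> gf_cdf (smult a P) k = gf_cdf P k"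
  by (simp add: gf_cdf_def flip: sum_distrib_left)

lemma gf_mean_mult:
  assumes "poly P 1 \<noteq> 0" "poly Q 1 \<noteq> 0"
  shows "gf_mean (P * Q) = gf_mean P + gf_mean Q"
  using assms by (simp add: gf_mean_def pderiv_mult field_simps)

lemma gf_variance_mult:
  assumes "poly P 1 \<noteq> 0" "poly Q 1 \<noteq> 0"
  shows "gf_variance (P * Q) = gf_variance P + gf_variance Q"
proof -
  have "poly (pderiv (pderiv (P * Q))) 1 / poly (P * Q) 1 =
      poly (pderiv (pderiv P)) 1 / poly P 1 + 2 * gf_mean P * gf_mean Q +
      poly (pderiv (pderiv Q)) 1 / poly Q 1"
    using assms by (simp add: gf_mean_def pderiv_mult pderiv_add add_divide_distrib)
  thus ?thesis
    by (simp add: gf_variance_def gf_mean_mult assms power2_eq_square algebra_simps)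
qed

definition bernoulli_gf :: "nat \<Rightarrow> (nat \<Rightarrow> real) \<Rightarrow> real poly" where
  "bernoulli_gf d p = (\<Prod>i<d. [:1 - p i, p i:])"

lemma bernoulli_gf_simps [simp]:
  "bernoulli_gf 0 p = 1" "bernoulli_gf (Suc d) p = bernoulli_gf d p * [:1 - p d, p d:]"
  by (simp_all add: bernoulli_gf_def)

lemma poly_bernoulli_gf: "poly (bernoulli_gf d p) x = (\<Prod>i<d. 1 - p i + p i * x)"
  by (simp add: bernoulli_gf_def poly_prod mult.commute)

lemma gf_mean_bernoulli_gf: "gf_mean (bernoulli_gf d p) = (\<Sum>i<d. p i)"
proof (induction d)
  case 0
  show ?case by (simp add: gf_mean_def)
next
  case (Suc d)
  have "gf_mean [:1 - p d, p d:] = p d" by (simp add: gf_mean_def pderiv_pCons)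
  thus ?case
    using Suc by (simp add: gf_mean_mult poly_bernoulli_gf del: mult_pCons_right)
qed

lemma gf_variance_bernoulli_gf: "gf_variance (bernoulli_gf d p) = (\<Sum>i<d. p i * (1 - p i))"
proof (induction d)
  case 0
  show ?case by (simp add: gf_variance_def gf_mean_def)
next
  case (Suc d)
  have "gf_variance [:1 - p d, p d:] = p d * (1 - p d)"
    by (simp add: gf_variance_def gf_mean_def pderiv_pCons power2_eq_square algebra_simps)
  thus ?case
    using Suc by (simp add: gf_variance_mult poly_bernoulli_gf del: mult_pCons_right)
qed

section \<open>Recursive structure of \<open>w\<close>-NAFs\<close>

lemma is_wNAF_iff_separated:
  "is_wNAF D w \<xi> \<longleftrightarrow>
     (\<forall>j. \<xi> j \<in> D) \<and> (\<forall>i j. \<xi> i \<noteq> 0 \<longrightarrow> \<xi> j \<noteq> 0 \<longrightarrow> i < j \<longrightarrow> i + int w \<le> j)"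
proof -
  have "card {j \<in> {i..<i + int w}. \<xi> j \<noteq> 0} \<le> 1 \<longleftrightarrow>
      (\<forall>j\<in>{i..<i + int w}. \<forall>k\<in>{i..<i + int w}. \<xi> j \<noteq> 0 \<longrightarrow> \<xi> k \<noteq> 0 \<longrightarrow> j = k)" for i
  proof -
    have "finite {j \<in> {i..<i + int w}. \<xi> j \<noteq> 0}" by (rule finite_subset[of _ "{i..<i + int w}"]) auto
    thus ?thesis by (auto simp: card_le_Suc0_iff_eq)
  qed
  moreover have "(\<forall>i. \<forall>j\<in>{i..<i + int w}. \<forall>k\<in>{i..<i + int w}. \<xi> j \<noteq> 0 \<longrightarrow> \<xi> k \<noteq> 0 \<longrightarrow> j = k) \<longleftrightarrow>
      (\<forall>i j. \<xi> i \<noteq> 0 \<longrightarrow> \<xi> j \<noteq> 0 \<longrightarrow> i < j \<longrightarrow> i + int w \<le> j)" (is "?window \<longleftrightarrow> ?separated")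
  proof
    assume window: ?window
    show ?separated
    proof (intro allI impI, rule ccontr)
      fix i j assume "\<xi> i \<noteq> 0" "\<xi> j \<noteq> 0" "i < j" "\<not> i + int w \<le> j"
      thus False using window[rule_format, of i i j] by auto
    qed
  next
    assume separated: ?separated
    show ?window
    proof (intro allI ballI impI)
      fix i j k assume "j \<in> {i..<i + int w}" "k \<in> {i..<i + int w}" "\<xi> j \<noteq> 0" "\<xi> k \<noteq> 0"
      thus "j = k" using separated[rule_format, of j k] separated[rule_format, of k j]
        by (cases j k rule: linorder_cases) auto
    qed
  qed
  ultimately show ?thesis unfolding is_wNAF_def by simp
qed

lemma mem_wNAFs_iff:
  "\<xi> \<in> wNAFs D w n \<longleftrightarrow> (\<forall>j. \<xi> j \<in> D) \<and>
     (\<forall>i j. \<xi> i \<noteq> 0 \<longrightarrow> \<xi> j \<noteq> 0 \<longrightarrow> i < j \<longrightarrow> i + int w \<le> j) \<and>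
     (\<forall>j. \<xi> j \<noteq> 0 \<longrightarrow> 0 \<le> j \<and> j < int n)"
  unfolding wNAFs_def mem_Collect_eq is_wNAF_iff_separated by (meson leD not_le_imp_less)

lemma wNAFs_0: "0 \<in> D \<Longrightarrow> wNAFs D w 0 = {\<lambda>_. 0}"
  by (auto simp: mem_wNAFs_iff fun_eq_iff) (metis linorder_not_less)

lemma wNAFs_mono: "\<xi> \<in> wNAFs D w m \<Longrightarrow> m \<le> n \<Longrightarrow> \<xi> \<in> wNAFs D w n"
  by (force simp: mem_wNAFs_iff)

lemma wNAFs_eq_0: "\<xi> \<in> wNAFs D w n \<Longrightarrow> j \<ge> int n \<Longrightarrow> \<xi> j = 0"
  by (auto simp: mem_wNAFs_iff)

context
  fixes D :: "complex set" and w :: nat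
  assumes w: "w \<ge> 1" and zero_digit: "0 \<in> D"
begin

lemma prepend_digit_in_wNAFs:
  assumes "\<xi> \<in> wNAFs D w (n - (w - 1))" "d \<in> D"
  shows "\<xi>(int n := d) \<in> wNAFs D w (Suc n)"
proof -
  have small: "0 \<le> j \<and> j + int w \<le> int n" if "\<xi> j \<noteq> 0" for j
    using assms(1) that w unfolding mem_wNAFs_iff by fastforce
  hence "i + int w \<le> j"
    if "(\<xi>(int n := d)) i \<noteq> 0" "(\<xi>(int n := d)) j \<noteq> 0" "i < j" for i j
    using that assms(1) small[of i] small[of j] by (auto simp: mem_wNAFs_iff split: if_splits)
  moreover have "0 \<le> j \<and> j < int (Suc n)" if "(\<xi>(int n := d)) j \<noteq> 0" for j
    using that small[of j] by (auto split: if_splits)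
  ultimately show ?thesis using assms unfolding mem_wNAFs_iff by auto
qed

lemma drop_leading_digit_in_wNAFs:
  assumes "\<xi> \<in> wNAFs D w (Suc n)" "\<xi> (int n) \<noteq> 0"
  shows "\<xi>(int n := 0) \<in> wNAFs D w (n - (w - 1))"
proof -
  have "0 \<le> j \<and> j < int (n - (w - 1))" if "(\<xi>(int n := 0)) j \<noteq> 0" for j
  proof -
    have "\<xi> j \<noteq> 0" "0 \<le> j" "j < int n" using that assms(1) by (auto simp: mem_wNAFs_iff split: if_splits)
    moreover from this have "j + int w \<le> int n" using assms unfolding mem_wNAFs_iff by blast
    ultimately show ?thesis using w by auto
  qed
  thus ?thesis using assms(1) zero_digit unfolding mem_wNAFs_iff by auto
qed

lemma wNAFs_Suc:
  "wNAFs D w (Suc n) = wNAFs D w n \<union>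
     (\<lambda>(d, \<xi>). \<xi>(int n := d)) ` ((D - {0}) \<times> wNAFs D w (n - (w - 1)))" (is "_ = ?R")
proof (intro equalityI subsetI)
  fix \<eta> assume \<eta>: "\<eta> \<in> wNAFs D w (Suc n)"
  show "\<eta> \<in> ?R"
  proof (cases "\<eta> (int n) = 0")
    case True
    hence "j < int n" if "\<eta> j \<noteq> 0" for j
      using that \<eta> by (cases "j = int n") (auto simp: mem_wNAFs_iff)
    thus ?thesis using \<eta> by (auto simp: mem_wNAFs_iff)
  next
    case False
    have "\<eta> = (\<eta>(int n := 0))(int n := \<eta> (int n))" by simp
    thus ?thesis using False \<eta> drop_leading_digit_in_wNAFs[OF \<eta> False]
      by (intro UnI2 image_eqI[of _ _ "(\<eta> (int n), \<eta>(int n := 0))"]) (auto simp: mem_wNAFs_iff)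
  qed
qed (auto intro: prepend_digit_in_wNAFs wNAFs_mono[of _ D w n])

lemma wNAFs_leading_digit_disjoint:
  "wNAFs D w n \<inter> (\<lambda>(d, \<xi>). \<xi>(int n := d)) ` ((D - {0}) \<times> wNAFs D w (n - (w - 1))) = {}"
  using wNAFs_eq_0[of _ D w n "int n"] by fastforce

lemma inj_on_prepend_digit:
  "inj_on (\<lambda>(d, \<xi>). \<xi>(int n := d)) (A \<times> wNAFs D w (n - (w - 1)))"
proof (rule inj_onI, clarify)
  fix d \<xi> d' \<xi>' assume mem: "\<xi> \<in> wNAFs D w (n - (w - 1))" "\<xi>' \<in> wNAFs D w (n - (w - 1))"
    and eq: "\<xi>(int n := d) = \<xi>'(int n := d')"
  have "\<xi> (int n) = \<xi>' (int n)" using mem by (simp add: wNAFs_eq_0)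
  hence "\<xi> = \<xi>'" using eq by (metis fun_upd_triv fun_upd_upd)
  thus "d = d' \<and> \<xi> = \<xi>'" using fun_cong[OF eq, of "int n"] by simp
qed

definition word_weight :: "(complex \<Rightarrow> 'a) \<Rightarrow> nat \<Rightarrow> (int \<Rightarrow> complex) \<Rightarrow> 'a::comm_ring_1" where
  "word_weight f n \<xi> = (\<Prod>j\<in>{0..<int n}. f (\<xi> j))"

lemma word_weight_eq_of_mem_wNAFs:
  assumes "\<xi> \<in> wNAFs D w m" "m \<le> n" "f 0 = 1"
  shows "word_weight f n \<xi> = word_weight f m \<xi>"
  unfolding word_weight_def
  using assms wNAFs_eq_0[OF assms(1)] by (intro prod.mono_neutral_right) auto

lemma word_weight_prepend_digit:
  assumes "\<xi> \<in> wNAFs D w (n - (w - 1))" "f 0 = 1"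
  shows "word_weight f (Suc n) (\<xi>(int n := d)) = f d * word_weight f (n - (w - 1)) \<xi>"
proof -
  have "{0..<int (Suc n)} = insert (int n) {0..<int n}" by auto
  hence "word_weight f (Suc n) (\<xi>(int n := d)) = f d * word_weight f n \<xi>"
    by (simp add: word_weight_def)
  thus ?thesis using word_weight_eq_of_mem_wNAFs[where f = f and n = n, OF assms(1) _ assms(2)] by simp
qed

context
  assumes finite_digits: "finite D"
begin

lemma finite_wNAFs: "finite (wNAFs D w n)"
proof (induction n rule: less_induct)
  case (less n)
  thus ?case using zero_digit finite_digits by (cases n) (auto simp: wNAFs_0 wNAFs_Suc)
qed

lemma sum_word_weight_wNAFs:
  fixes f :: "complex \<Rightarrow> 'a::comm_ring_1"
  assumes f0: "f 0 = 1"
  shows "(\<Sum>\<xi>\<in>wNAFs D w n. word_weight f n \<xi>) = naf_gf w (\<Sum>d\<in>D - {0}. f d) n"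
proof (induction n rule: less_induct)
  case (less n)
  show ?case
  proof (cases n)
    case 0
    thus ?thesis using zero_digit by (simp add: wNAFs_0 word_weight_def)
  next
    case (Suc k)
    let ?k = "k - (w - 1)" and ?W = "\<Sum>d\<in>D - {0}. f d"
    let ?prepend = "\<lambda>(d, \<xi>). \<xi>(int k := d)" and ?P = "(D - {0}) \<times> wNAFs D w (k - (w - 1))"
    have "(\<Sum>\<xi>\<in>wNAFs D w (Suc k). word_weight f (Suc k) \<xi>) =
        (\<Sum>\<xi>\<in>wNAFs D w k. word_weight f (Suc k) \<xi>) + (\<Sum>\<xi>\<in>?prepend ` ?P. word_weight f (Suc k) \<xi>)"
      unfolding wNAFs_Suc using wNAFs_leading_digit_disjoint finite_wNAFs finite_digits
      by (intro sum.union_disjoint) auto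
    also have "(\<Sum>\<xi>\<in>wNAFs D w k. word_weight f (Suc k) \<xi>) = (\<Sum>\<xi>\<in>wNAFs D w k. word_weight f k \<xi>)"
      by (intro sum.cong refl word_weight_eq_of_mem_wNAFs f0) auto
    also have "\<dots> = naf_gf w ?W k" using less[of k] Suc by simp
    also have "(\<Sum>\<xi>\<in>?prepend ` ?P. word_weight f (Suc k) \<xi>) = (\<Sum>(d, \<xi>)\<in>?P. f d * word_weight f ?k \<xi>)"
      unfolding sum.reindex[OF inj_on_prepend_digit]
      by (intro sum.cong refl) (auto simp: word_weight_prepend_digit f0 simp del: fun_upd_apply)
    also have "\<dots> = ?W * (\<Sum>\<xi>\<in>wNAFs D w ?k. word_weight f ?k \<xi>)"
      by (simp add: sum_product sum.cartesian_product)
    also have "(\<Sum>\<xi>\<in>wNAFs D w ?k. word_weight f ?k \<xi>) = naf_gf w ?W ?k" using less[of ?k] Suc by simp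
    finally show ?thesis using Suc by simp
  qed
qed

lemma wNAF_count_eq_naf_gf: "real (wNAF_count D w n) = naf_gf w (real (card (D - {0}))) n"
  using sum_word_weight_wNAFs[of "\<lambda>_. 1 :: real"] by (simp add: wNAF_count_def word_weight_def)

lemma counting_gf_occurrences:
  assumes \<eta>: "\<eta> \<in> D - {0}"
  shows "counting_gf (wNAFs D w n) (\<lambda>\<xi>. card {j \<in> {0..<int n}. \<xi> j = \<eta>}) =
    naf_gf w [:real (card (D - {0})) - 1, 1:] n"
proof -
  let ?f = "\<lambda>d. if d = \<eta> then monom 1 1 else 1 :: real poly"
  have "word_weight ?f n \<xi> = monom 1 (card {j \<in> {0..<int n}. \<xi> j = \<eta>})" for \<xi>
    unfolding word_weight_def by (subst prod.If_cases) (auto simp: Int_def monom_altdef)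
  moreover have "(\<Sum>d\<in>D - {0}. ?f d) = [:real (card (D - {0})) - 1, 1:]"
  proof -
    have "(\<Sum>d\<in>D - {0}. ?f d) = monom 1 1 + (\<Sum>d\<in>D - {0} - {\<eta>}. 1)"
      using \<eta> finite_digits by (subst sum.remove[of _ \<eta>]) (auto intro!: sum.cong)
    also have "\<dots> = [:real (card (D - {0} - {\<eta>})), 1:]"
      by (simp add: of_nat_poly monom_altdef)
    also have "real (card (D - {0} - {\<eta>})) = real (card (D - {0})) - 1"
      using card_Suc_Diff1[of "D - {0}" \<eta>] \<eta> finite_digits by simp
    finally show ?thesis .
  qed
  moreover have "?f 0 = 1" using \<eta> by auto
  ultimately show ?thesis using sum_word_weight_wNAFs[of ?f n] by (simp add: counting_gf_def)
qed

end

end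

section \<open>Real-rootedness\<close>

text \<open>For \<open>x\<close> in the upper half plane, this is the convex cone spanned by \<open>1\<close> and \<open>x\<close>.\<close>

definition wedge :: "complex \<Rightarrow> complex set" where
  "wedge x = {z. 0 \<le> Im z \<and> Im (z * cnj x) \<le> 0}"

lemma wedge_add: "y \<in> wedge x \<Longrightarrow> z \<in> wedge x \<Longrightarrow> y + z \<in> wedge x"
  by (simp add: wedge_def algebra_simps)

lemma wedge_divide:
  assumes "z \<in> wedge x"
  shows "x / z \<in> wedge x"
proof -
  have mult_cnj_eq: "x / z * cnj x = of_real ((cmod x)\<^sup>2) / z" unfolding complex_norm_square by simp
  have "Im (x / z * cnj x) \<le> 0" unfolding mult_cnj_eq Im_divide
    using assms by (intro divide_nonpos_nonneg) (auto simp: wedge_def)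
  moreover have "0 \<le> Im (x / z)" unfolding Im_divide
    using assms by (intro divide_nonneg_nonneg) (auto simp: wedge_def mult.commute)
  ultimately show ?thesis by (simp only: wedge_def mem_Collect_eq)
qed

lemma one_plus_wedge_nonzero:
  assumes "Im x > 0" "z \<in> wedge x"
  shows "1 + z \<noteq> 0"
proof
  assume "1 + z = 0"
  hence "z = -1" by (simp add: eq_neg_iff_add_eq_0 add.commute)
  thus False using assms by (simp add: wedge_def)
qed

lemma naf_gf_ratio_in_wedge:
  assumes x: "Im x > 0" and "i \<le> j" "j \<le> i + (w - 1)"
  shows "naf_gf w x j \<noteq> 0 \<and> naf_gf w x j / naf_gf w x i \<in> wedge x"
  using assms(2,3)
proof (induction j arbitrary: i rule: less_induct)
  case (less j)
  have one_in_wedge: "1 \<in> wedge x" using x by (simp add: wedge_def)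
  show ?case
  proof (cases j)
    case 0
    thus ?thesis using less.prems one_in_wedge by simp
  next
    case (Suc n)
    let ?p = "naf_gf w x" and ?k = "n - (w - 1)"
    have n: "?p n \<noteq> 0" "?p n / ?p ?k \<in> wedge x" using less.IH[of n ?k] Suc by auto
    have "?p j = ?p n * (1 + x / (?p n / ?p ?k))" using n(1) by (simp add: Suc field_simps)
    moreover have "1 + x / (?p n / ?p ?k) \<noteq> 0" by (rule one_plus_wedge_nonzero[OF x wedge_divide[OF n(2)]])
    ultimately have nz: "?p j \<noteq> 0" using n(1) by simp
    moreover have "?p j / ?p i \<in> wedge x"
    proof (cases "i = j")
      case False
      hence i: "i \<le> n" "n \<le> i + (w - 1)" using less.prems Suc by auto
      hence "?p n / ?p i \<in> wedge x" "?p i / ?p ?k \<in> wedge x"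
        using less.IH[of n i] less.IH[of i ?k] Suc by auto
      hence "?p n / ?p i + x / (?p i / ?p ?k) \<in> wedge x" by (intro wedge_add wedge_divide)
      thus ?thesis by (simp add: Suc add_divide_distrib)
    qed (use nz one_in_wedge in simp)
    ultimately show ?thesis by simp
  qed
qed

lemma cnj_naf_gf: "cnj (naf_gf w x n) = naf_gf w (cnj x) n"
  by (induction w x n rule: naf_gf.induct) simp_all

lemma naf_gf_nonzero_if_nonreal:
  assumes "Im x \<noteq> 0"
  shows "naf_gf w x n \<noteq> 0"
proof -
  have upper: "naf_gf w y n \<noteq> 0" if "Im y > 0" for y
    using naf_gf_ratio_in_wedge[OF that, of n n w] by simp
  consider "Im x > 0" | "Im (cnj x) > 0" using assms by force
  thus ?thesis
    by cases (use upper cnj_naf_gf[of w x n] in \<open>force+\<close>)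
qed

lemma naf_gf_ge_1: "x \<ge> (0 :: real) \<Longrightarrow> naf_gf w x n \<ge> 1"
proof (induction w x n rule: naf_gf.induct)
  case (2 w x n)
  have "x * naf_gf w x (n - (w - 1)) \<ge> 0"
    using "2.IH"(2)[OF "2.prems"] "2.prems" by (intro mult_nonneg_nonneg) auto
  thus ?case using "2.IH"(1)[OF "2.prems"] unfolding naf_gf.simps by linarith
qed simp

lemma poly_map_of_real_naf_gf:
  "poly (map_poly complex_of_real (naf_gf w p n)) z = naf_gf w (poly (map_poly of_real p) z) n"
  by (induction w p n rule: naf_gf.induct) (simp_all add: map_poly_hom_add map_poly_hom_mult)

lemma real_rooted_poly_decompose:
  fixes P :: "real poly"
  assumes "\<And>z :: complex. poly (map_poly of_real P) z = 0 \<Longrightarrow> Im z = 0"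
  obtains r where "P = smult (lead_coeff P) (\<Prod>i<degree P. [:- r i, 1:])"
proof -
  let ?P = "map_poly complex_of_real P"
  have lead: "degree ?P = degree P" "coeff ?P (degree P) = of_real (lead_coeff P)"
    by (simp_all add: degree_map_poly coeff_map_poly)
  obtain root where root: "smult (lead_coeff ?P) (\<Prod>i<degree ?P. [:- root i, 1:]) = ?P"
    by (rule complex_poly_decompose')
  have real: "root i = of_real (Re (root i))" if "i < degree P" for i
  proof -
    have "poly ?P (root i) = lead_coeff ?P * (\<Prod>k<degree P. root i - root k)"
      by (subst root[symmetric]) (simp add: poly_prod lead)
    also have "(\<Prod>k<degree P. root i - root k) = 0" using that by (intro prod_zero) auto
    finally show ?thesis using assms by (simp add: complex_eq_iff)
  qed
  have "poly P x = poly (smult (lead_coeff P) (\<Prod>i<degree P. [:- Re (root i), 1:])) x" for x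
  proof -
    have "complex_of_real (poly P x) = lead_coeff ?P * (\<Prod>i<degree P. of_real x - root i)"
      unfolding poly_of_real_poly[symmetric] by (subst root[symmetric]) (simp add: poly_prod lead)
    also have "(\<Prod>i<degree P. of_real x - root i) = (\<Prod>i<degree P. of_real (x - Re (root i)))"
      by (intro prod.cong refl) (use real in auto)
    finally have "complex_of_real (poly P x) = of_real (lead_coeff P * (\<Prod>i<degree P. x - Re (root i)))"
      by (simp add: lead)
    thus ?thesis unfolding of_real_eq_iff by (simp add: poly_prod)
  qed
  hence "poly P = poly (smult (lead_coeff P) (\<Prod>i<degree P. [:- Re (root i), 1:]))" by (rule ext)
  hence "P = smult (lead_coeff P) (\<Prod>i<degree P. [:- Re (root i), 1:])" by (simp only: poly_eq_poly_eq_iff)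
  thus ?thesis by (rule that)
qed

lemma real_rooted_poly_eq_bernoulli_gf:
  fixes P :: "real poly"
  assumes real: "\<And>z :: complex. poly (map_poly of_real P) z = 0 \<Longrightarrow> Im z = 0"
    and nonneg: "\<And>x. x \<ge> 0 \<Longrightarrow> poly P x \<noteq> 0"
  obtains p d where "\<And>i. i < d \<Longrightarrow> 0 < p i \<and> p i < 1" "P = smult (poly P 1) (bernoulli_gf d p)"
proof -
  obtain r where r: "P = smult (lead_coeff P) (\<Prod>i<degree P. [:- r i, 1:])"
    using real_rooted_poly_decompose[OF real] by blast
  define p where "p i = 1 / (1 - r i)" for i
  have P_eq: "poly P x = lead_coeff P * (\<Prod>i<degree P. x - r i)" for x
    by (subst r) (simp add: poly_prod)
  have neg: "r i < 0" if "i < degree P" for i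
  proof (rule ccontr)
    assume "\<not> r i < 0"
    moreover have "(\<Prod>k<degree P. r i - r k) = 0" using that by (intro prod_zero) auto
    ultimately show False using nonneg[of "r i"] P_eq[of "r i"] by simp
  qed
  have factor: "x - r i = (1 - r i) * (1 - p i + p i * x)" if "i < degree P" for i x
  proof -
    have "(1 - r i) * p i = 1" using neg[OF that] by (simp add: p_def)
    thus ?thesis by algebra
  qed
  have "poly P x = poly (smult (poly P 1) (bernoulli_gf (degree P) p)) x" for x
  proof -
    have "(\<Prod>i<degree P. x - r i) = (\<Prod>i<degree P. (1 - r i) * (1 - p i + p i * x))"
      by (intro prod.cong refl factor) simp
    thus ?thesis unfolding poly_smult P_eq[of 1] P_eq[of x] by (simp add: prod.distrib poly_bernoulli_gf)
  qed
  hence "poly P = poly (smult (poly P 1) (bernoulli_gf (degree P) p))" by (rule ext)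
  hence "P = smult (poly P 1) (bernoulli_gf (degree P) p)" by (simp only: poly_eq_poly_eq_iff)
  moreover have "0 < p i \<and> p i < 1" if "i < degree P" for i
    using neg[OF that] by (simp add: p_def)
  ultimately show ?thesis using that by blast
qed

lemma naf_gf_eq_bernoulli_gf:
  assumes c: "c \<ge> (0 :: real)"
  obtains p d where "\<And>i. i < d \<Longrightarrow> 0 < p i \<and> p i < 1"
    "naf_gf w [:c, 1:] n = smult (naf_gf w (c + 1) n) (bernoulli_gf d p)"
proof -
  have "Im z = 0" if "poly (map_poly of_real (naf_gf w [:c, 1:] n)) z = 0" for z :: complex
  proof -
    have "naf_gf w (of_real c + z) n = 0"
      using that unfolding poly_map_of_real_naf_gf by (simp add: map_poly_pCons)
    thus ?thesis using naf_gf_nonzero_if_nonreal[of "of_real c + z"] by auto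
  qed
  moreover have "poly (naf_gf w [:c, 1:] n) x \<noteq> 0" if "x \<ge> 0" for x
    using naf_gf_ge_1[of "c + x" w n] c that by (simp add: poly_naf_gf)
  ultimately obtain p d where pd: "\<And>i. i < d \<Longrightarrow> 0 < p i \<and> p i < 1"
    "naf_gf w [:c, 1:] n = smult (poly (naf_gf w [:c, 1:] n) 1) (bernoulli_gf d p)"
    using real_rooted_poly_eq_bernoulli_gf by metis
  show ?thesis by (rule that[OF pd(1)]) (use pd(2) in \<open>simp_all add: poly_naf_gf\<close>)
qed

section \<open>The normal distribution function\<close>

lemma std_normal_Phi_eq_LBINT: "std_normal_Phi x = (LBINT t:{..x}. std_normal_density t)"
  unfolding std_normal_Phi_def std_normal_density_def set_integral_mult_right ..

lemma std_normal_Phi_eq_cdf: "std_normal_Phi x = cdf std_normal_distribution x"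
proof -
  have "cdf std_normal_distribution x = (\<integral>t. indicator {..x} t \<partial>std_normal_distribution)"
    by (simp add: cdf_def)
  also have "\<dots> = (LBINT t:{..x}. std_normal_density t)"
    unfolding set_lebesgue_integral_def by (subst integral_density) (auto simp: mult.commute)
  finally show ?thesis by (simp add: std_normal_Phi_eq_LBINT)
qed

lemma
  shows std_normal_Phi_nonneg: "std_normal_Phi x \<ge> 0"
    and std_normal_Phi_le_1: "std_normal_Phi x \<le> 1"
    and std_normal_Phi_mono: "a \<le> b \<Longrightarrow> std_normal_Phi a \<le> std_normal_Phi b"
proof -
  interpret real_distribution std_normal_distribution by (rule real_dist_normal_dist)
  show "std_normal_Phi x \<ge> 0" "std_normal_Phi x \<le> 1"
    "a \<le> b \<Longrightarrow> std_normal_Phi a \<le> std_normal_Phi b"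
    unfolding std_normal_Phi_eq_cdf by (rule cdf_nonneg cdf_bounded_prob cdf_nondecreasing; assumption?)+
qed

lemma std_normal_Phi_lower_tail:
  assumes x: "x > 0"
  shows "std_normal_Phi (- x) \<le> 1 / x"
proof -
  interpret real_distribution std_normal_distribution by (rule real_dist_normal_dist)
  have "std_normal_Phi (- x) \<le> measure std_normal_distribution {t \<in> space std_normal_distribution. \<bar>t\<bar> \<ge> x}"
    unfolding std_normal_Phi_eq_cdf cdf_def by (intro finite_measure_mono) auto
  also have "\<dots> \<le> (\<integral>t. \<bar>t\<bar> \<partial>std_normal_distribution) / x"
    using x integrable_std_normal_distribution_moment[of 1]
    by (intro integral_Markov_inequality_measure[where A = "{}"]) auto
  also have "(\<integral>t. \<bar>t\<bar> \<partial>std_normal_distribution) = sqrt (2 / pi)"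
    using std_normal_distribution_odd_moments_abs[of 0] by simp
  also have "sqrt (2 / pi) \<le> 1" using pi_ge_two by simp
  finally show ?thesis using x by (simp add: divide_right_mono)
qed

lemma continuous_on_std_normal_density: "continuous_on A std_normal_density"
  unfolding std_normal_density_def by (intro continuous_intros) auto

lemma std_normal_Phi_has_integral: "(std_normal_density has_integral std_normal_Phi x) {..x}"
proof -
  have "set_integrable lborel {..x} std_normal_density"
    unfolding set_integrable_def by (intro integrable_mult_indicator) auto
  from set_borel_integral_eq_integral[OF this] show ?thesis
    by (simp add: std_normal_Phi_eq_LBINT has_integral_iff)
qed

lemma std_normal_Phi_eq_integral:
  assumes "a \<le> b"
  shows "std_normal_Phi b = std_normal_Phi a + integral {a..b} std_normal_density"
proof -
  have "(std_normal_density has_integral integral {a..b} std_normal_density) {a..b}"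
    by (intro integrable_integral integrable_continuous_real continuous_on_std_normal_density)
  with std_normal_Phi_has_integral[of a]
  have "(std_normal_density has_integral std_normal_Phi a + integral {a..b} std_normal_density)
      ({..a} \<union> {a..b})"
    by (rule has_integral_Un) (use assms in \<open>auto intro: negligible_subset[of "{a}"]\<close>)
  moreover have "{..a} \<union> {a..b} = {..b}" using assms by auto
  ultimately show ?thesis using std_normal_Phi_has_integral[of b] by (simp add: has_integral_unique)
qed

lemma std_normal_Phi_deriv: "(std_normal_Phi has_real_derivative std_normal_density x) (at x)"
proof -
  let ?I = "\<lambda>y. integral {x - 1..y} std_normal_density"
  have "(?I has_real_derivative std_normal_density x) (at x within {x - 1..x + 1})"
    by (rule integral_has_real_derivative) (auto intro: continuous_on_std_normal_density)
  hence "((\<lambda>y. std_normal_Phi (x - 1) + ?I y) has_real_derivative std_normal_density x)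
      (at x within {x - 1..x + 1})"
    by (auto intro!: derivative_eq_intros)
  hence "(std_normal_Phi has_real_derivative std_normal_density x) (at x within {x - 1..x + 1})"
    by (rule has_field_derivative_transform_within[where d = 1])
       (auto simp: std_normal_Phi_eq_integral[symmetric])
  thus ?thesis by (simp add: at_within_Icc_at)
qed

lemma std_normal_Phi_mvt:
  assumes "a < b"
  obtains z where "a < z" "z < b" "std_normal_Phi b - std_normal_Phi a = (b - a) * std_normal_density z"
  using MVT2[OF assms, of std_normal_Phi std_normal_density] std_normal_Phi_deriv by blast

lemma std_normal_Phi_affine_deriv:
  assumes "\<sigma> > 0"
  shows "((\<lambda>x. std_normal_Phi ((x - \<mu>) / \<sigma>)) has_real_derivative normal_density \<mu> \<sigma> x) (at x)"
proof -
  have "((\<lambda>x. std_normal_Phi ((x - \<mu>) / \<sigma>)) has_real_derivative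
      std_normal_density ((x - \<mu>) / \<sigma>) * (1 / \<sigma>)) (at x)"
    by (rule DERIV_chain'[OF _ std_normal_Phi_deriv]) (use assms in \<open>auto intro!: derivative_eq_intros\<close>)
  also have "std_normal_density ((x - \<mu>) / \<sigma>) * (1 / \<sigma>) = normal_density \<mu> \<sigma> x"
    using assms by (simp add: normal_density_def real_sqrt_mult power_divide)
  finally show ?thesis .
qed

lemma one_div_sqrt_2_pi_le_1: "1 / sqrt (2 * pi) \<le> 1"
  using pi_gt3 by (simp add: real_le_rsqrt)

lemma std_normal_Phi_lipschitz: "\<bar>std_normal_Phi a - std_normal_Phi b\<bar> \<le> \<bar>a - b\<bar>"
proof -
  have density: "std_normal_density z \<le> 1" for z
    using mult_mono[OF one_div_sqrt_2_pi_le_1, of "exp (- z\<^sup>2 / 2)" 1]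
    by (simp add: std_normal_density_def)
  have "\<bar>std_normal_Phi a - std_normal_Phi b\<bar> \<le> \<bar>a - b\<bar>" if less: "a < b" for a b
  proof -
    obtain z where "std_normal_Phi b - std_normal_Phi a = (b - a) * std_normal_density z"
      by (rule std_normal_Phi_mvt[OF less])
    moreover have "(b - a) * std_normal_density z \<le> (b - a) * 1"
      using density less by (intro mult_left_mono) auto
    moreover have "std_normal_Phi a \<le> std_normal_Phi b" using less by (intro std_normal_Phi_mono) auto
    ultimately show ?thesis using less by simp
  qed
  from this[of a b] this[of b a] show ?thesis
    by (cases a b rule: linorder_cases) (auto simp: abs_minus_commute)
qed

lemma abs_mult_std_normal_density_le:
  assumes "\<bar>x\<bar> / 2 \<le> \<bar>z\<bar>"
  shows "\<bar>x\<bar> * std_normal_density z \<le> 2"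
proof -
  have "(\<bar>x\<bar> / 2)\<^sup>2 \<le> \<bar>z\<bar>\<^sup>2" using assms by (intro power_mono) auto
  hence z: "x\<^sup>2 / 8 \<le> z\<^sup>2 / 2" by (simp add: power_divide)
  have "0 \<le> (\<bar>x\<bar> - 2)\<^sup>2" by simp
  hence "\<bar>x\<bar> \<le> 2 * (1 + x\<^sup>2 / 8)" by (simp add: power2_eq_square algebra_simps)
  also have "1 + x\<^sup>2 / 8 \<le> exp (x\<^sup>2 / 8)" by (rule exp_ge_add_one_self)
  also have "exp (x\<^sup>2 / 8) \<le> exp (z\<^sup>2 / 2)" using z by simp
  finally have "\<bar>x\<bar> * exp (- z\<^sup>2 / 2) \<le> 2 * exp (z\<^sup>2 / 2) * exp (- z\<^sup>2 / 2)"
    by (intro mult_right_mono) auto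
  also have "\<dots> = 2" by (simp add: mult.assoc exp_add[symmetric])
  finally have "(1 / sqrt (2 * pi)) * (\<bar>x\<bar> * exp (- z\<^sup>2 / 2)) \<le> 1 * 2"
    using one_div_sqrt_2_pi_le_1 by (intro mult_mono) auto
  thus ?thesis by (simp add: std_normal_density_def mult_ac)
qed

lemma std_normal_Phi_scale_diff:
  assumes l: "l \<ge> 1 / 2"
  shows "\<bar>std_normal_Phi (l * x) - std_normal_Phi x\<bar> \<le> 2 * \<bar>l - 1\<bar>"
proof -
  have length: "\<bar>l * x - x\<bar> = \<bar>l - 1\<bar> * \<bar>x\<bar>" by (simp add: abs_mult[symmetric] algebra_simps)
  have between: "\<bar>x\<bar> / 2 \<le> \<bar>z\<bar>" if "(x < z \<and> z < l * x) \<or> (l * x < z \<and> z < x)" for z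
  proof (cases "x \<ge> 0")
    case True
    hence "l * x \<ge> 1 / 2 * x" using l by (intro mult_right_mono) auto
    thus ?thesis using that True by linarith
  next
    case False
    hence "l * x \<le> 1 / 2 * x" using l by (intro mult_right_mono_neg) auto
    thus ?thesis using that False by linarith
  qed
  have increment: "std_normal_Phi b - std_normal_Phi a \<le> 2 * \<bar>l - 1\<bar>"
    if ab: "a < b" "b - a = \<bar>l - 1\<bar> * \<bar>x\<bar>" and z: "\<And>z. a < z \<Longrightarrow> z < b \<Longrightarrow> \<bar>x\<bar> / 2 \<le> \<bar>z\<bar>" for a b
  proof -
    obtain z where z': "a < z" "z < b" "std_normal_Phi b - std_normal_Phi a = (b - a) * std_normal_density z"
      by (rule std_normal_Phi_mvt[OF ab(1)])
    have "(b - a) * std_normal_density z = \<bar>l - 1\<bar> * (\<bar>x\<bar> * std_normal_density z)" using ab by simp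
    also have "\<dots> \<le> \<bar>l - 1\<bar> * 2"
      using abs_mult_std_normal_density_le[OF z[OF z'(1,2)]] by (intro mult_left_mono) auto
    finally show ?thesis using z'(3) by simp
  qed
  show ?thesis
  proof (cases "l * x" x rule: linorder_cases)
    case less
    thus ?thesis using increment[of "l * x" x] between length std_normal_Phi_mono[of "l * x" x] by auto
  next
    case greater
    thus ?thesis using increment[of x "l * x"] between length std_normal_Phi_mono[of x "l * x"] by auto
  qed auto
qed

text \<open>Write the unimodal function as a sum of a monotone and an antitone one; the errors of the
  mean value theorem then telescope.\<close>

lemma unimodal_riemann_sum:
  fixes f G :: "real \<Rightarrow> real"
  assumes deriv: "\<And>x. (G has_real_derivative f x) (at x)" and nonneg: "\<And>x. 0 \<le> f x"
    and unimodal: "\<And>x y. \<bar>y - \<mu>\<bar> \<le> \<bar>x - \<mu>\<bar> \<Longrightarrow> f x \<le> f y"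
  shows "\<bar>(\<Sum>j<k. f (real j)) - (G (real k) - G 0)\<bar> \<le> 2 * f \<mu>"
proof -
  define f1 f2 where "f1 x = f (min x \<mu>)" and "f2 x = f (max x \<mu>)" for x
  have f_split: "f x = f1 x + f2 x - f \<mu>" for x by (auto simp: f1_def f2_def min_def max_def)
  have mono_parts: "f1 x \<le> f1 y" "f2 y \<le> f2 x" if "x \<le> y" for x y
    unfolding f1_def f2_def using that by (auto intro!: unimodal simp: min_def max_def)
  have bound: "f x \<le> f \<mu>" for x by (rule unimodal) simp
  define err where "err x = f1 x - f2 x" for x
  have telescoping_bound: "\<bar>f (real j) - (G (real (Suc j)) - G (real j))\<bar> \<le>
      err (real (Suc j)) - err (real j)" for j
  proof -
    obtain z where z: "real j < z" "z < real (Suc j)" "G (real (Suc j)) - G (real j) = f z"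
      using MVT2[of "real j" "real (Suc j)" G f] deriv by auto
    show ?thesis unfolding z(3) err_def
      using f_split[of z] f_split[of "real j"] z(1,2)
        mono_parts[of "real j" z] mono_parts[of z "real (Suc j)"]
      by (auto simp: abs_le_iff)
  qed
  have "\<bar>(\<Sum>j<k. f (real j)) - (G (real k) - G 0)\<bar> = \<bar>\<Sum>j<k. f (real j) - (G (real (Suc j)) - G (real j))\<bar>"
    using sum_lessThan_telescope[of "\<lambda>j. G (real j)" k]
    by (simp only: sum_subtractf[of "\<lambda>j. f (real j)"] of_nat_0)
  also have "\<dots> \<le> (\<Sum>j<k. err (real (Suc j)) - err (real j))"
    by (rule order.trans[OF sum_abs sum_mono]) (rule telescoping_bound)
  also have "\<dots> = err (real k) - err 0"
    using sum_lessThan_telescope[of "\<lambda>j. err (real j)" k] by simp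
  also have "\<dots> \<le> 2 * f \<mu>"
    using bound[of "min (real k) \<mu>"] nonneg[of "min 0 \<mu>"] nonneg[of "max (real k) \<mu>"] bound[of "max 0 \<mu>"]
    unfolding err_def f1_def f2_def by linarith
  finally show ?thesis .
qed

lemma normal_density_mono_dist:
  assumes "\<sigma> > 0" "\<bar>y - \<mu>\<bar> \<le> \<bar>x - \<mu>\<bar>"
  shows "normal_density \<mu> \<sigma> x \<le> normal_density \<mu> \<sigma> y"
proof -
  have "(y - \<mu>)\<^sup>2 \<le> (x - \<mu>)\<^sup>2" using assms(2) by (simp add: abs_le_square_iff)
  hence "- (x - \<mu>)\<^sup>2 / (2 * \<sigma>\<^sup>2) \<le> - (y - \<mu>)\<^sup>2 / (2 * \<sigma>\<^sup>2)" by (intro divide_right_mono) auto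
  thus ?thesis unfolding normal_density_def by (intro mult_left_mono) auto
qed

lemma normal_density_le:
  assumes "\<sigma> > 0"
  shows "normal_density \<mu> \<sigma> x \<le> 1 / \<sigma>"
proof -
  have "normal_density \<mu> \<sigma> x \<le> normal_density \<mu> \<sigma> \<mu>"
    by (rule normal_density_mono_dist[OF assms]) simp
  also have "\<dots> = 1 / sqrt (2 * pi) * (1 / \<sigma>)"
    using assms by (simp add: normal_density_def real_sqrt_mult)
  also have "\<dots> \<le> 1 * (1 / \<sigma>)"
    using assms one_div_sqrt_2_pi_le_1 by (intro mult_right_mono) auto
  finally show ?thesis by simp
qed

lemma normal_density_riemann_sum:
  assumes \<sigma>: "\<sigma> > 0"
  shows "\<bar>(\<Sum>j<k. normal_density \<mu> \<sigma> (real j)) -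
     (std_normal_Phi ((real k - \<mu>) / \<sigma>) - std_normal_Phi (- \<mu> / \<sigma>))\<bar> \<le> 2 / \<sigma>"
  using unimodal_riemann_sum[where f = "normal_density \<mu> \<sigma>" and \<mu> = \<mu> and k = k,
      OF std_normal_Phi_affine_deriv[OF \<sigma>, of \<mu>] normal_density_nonneg normal_density_mono_dist[OF \<sigma>]]
    normal_density_le[OF \<sigma>, of \<mu> \<mu>] by simp

section \<open>Gaussian integrals\<close>

lemma gaussian_integral:
  fixes b :: real
  assumes b: "b > 0"
  shows "integrable lborel (\<lambda>t. exp (- b * t\<^sup>2))" "(\<integral>t. exp (- b * t\<^sup>2) \<partial>lborel) = sqrt (pi / b)"
proof -
  define \<sigma> where "\<sigma> = 1 / sqrt (2 * b)"
  have \<sigma>: "\<sigma> > 0" "\<sigma>\<^sup>2 = 1 / (2 * b)" using b by (auto simp: \<sigma>_def power_divide)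
  have gaussian_eq_density: "exp (- b * t\<^sup>2) = sqrt (pi / b) * normal_density 0 \<sigma> t" for t
    using b by (simp add: normal_density_def \<sigma>(2) real_sqrt_divide)
  show "integrable lborel (\<lambda>t. exp (- b * t\<^sup>2))" "(\<integral>t. exp (- b * t\<^sup>2) \<partial>lborel) = sqrt (pi / b)"
    unfolding gaussian_eq_density using \<sigma> by simp_all
qed

lemma gaussian_integral_interval_le:
  fixes b :: real
  assumes b: "b > 0"
  shows "integral {l..u} (\<lambda>t. exp (- b * t\<^sup>2)) \<le> sqrt (pi / b)"
proof -
  note integral_lborel = has_integral_integral_lborel[OF gaussian_integral(1)[OF b]]
  have "integral {l..u} (\<lambda>t. exp (- b * t\<^sup>2)) \<le> integral UNIV (\<lambda>t. exp (- b * t\<^sup>2))"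
    using integral_lborel
    by (intro integral_subset_le integrable_continuous_real continuous_intros) (auto simp: has_integral_iff)
  also have "\<dots> = sqrt (pi / b)"
    using integral_lborel gaussian_integral(2)[OF b] by (simp add: integral_unique)
  finally show ?thesis .
qed

lemma gaussian_tail_le:
  fixes b r :: real
  assumes b: "b > 0" and "r > 0"
  shows "(LBINT t:- {-r..r}. exp (- b * t\<^sup>2)) \<le> 2 / (b * r\<^sup>2) * sqrt (2 * pi / b)"
proof -
  have exp_le: "exp (- (b * r\<^sup>2 / 2)) \<le> 2 / (b * r\<^sup>2)"
  proof -
    have "b * r\<^sup>2 / 2 \<le> exp (b * r\<^sup>2 / 2)" using exp_ge_add_one_self[of "b * r\<^sup>2 / 2"] by linarith
    hence "inverse (exp (b * r\<^sup>2 / 2)) \<le> inverse (b * r\<^sup>2 / 2)" using assms by (intro le_imp_inverse_le) auto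
    thus ?thesis by (simp add: exp_minus)
  qed
  have "(LBINT t:- {-r..r}. exp (- b * t\<^sup>2)) \<le> (\<integral>t. exp (- (b * r\<^sup>2 / 2)) * exp (- (b / 2) * t\<^sup>2) \<partial>lborel)"
    unfolding set_lebesgue_integral_def
  proof (rule integral_mono)
    show "integrable lborel (\<lambda>t. indicator (- {-r..r}) t *\<^sub>R exp (- b * t\<^sup>2))"
      using gaussian_integral(1)[OF b] by (intro integrable_mult_indicator) auto
    show "integrable lborel (\<lambda>t. exp (- (b * r\<^sup>2 / 2)) * exp (- (b / 2) * t\<^sup>2))"
      using gaussian_integral(1)[of "b / 2"] b by simp
    fix t
    show "indicator (- {-r..r}) t *\<^sub>R exp (- b * t\<^sup>2) \<le> exp (- (b * r\<^sup>2 / 2)) * exp (- (b / 2) * t\<^sup>2)"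
    proof (cases "t \<in> - {-r..r}")
      case True
      hence "t\<^sup>2 \<ge> r\<^sup>2" using power_mono[of r "\<bar>t\<bar>" 2] \<open>r > 0\<close> by auto
      hence "b * t\<^sup>2 \<ge> b * r\<^sup>2" using b by simp
      thus ?thesis using True by (simp flip: exp_add)
    qed simp
  qed
  also have "\<dots> = exp (- (b * r\<^sup>2 / 2)) * sqrt (2 * pi / b)"
    using gaussian_integral(2)[of "b / 2"] b by (simp add: mult.commute)
  also have "\<dots> \<le> 2 / (b * r\<^sup>2) * sqrt (2 * pi / b)"
    using exp_le b by (intro mult_right_mono) auto
  finally show ?thesis .
qed

lemma gaussian_fourier:
  fixes V x :: real
  assumes V: "V > 0"
  shows "integrable lborel (\<lambda>t. cis (x * t) * of_real (exp (- V * t\<^sup>2 / 2)))"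
    and "(\<integral>t. cis (x * t) * of_real (exp (- V * t\<^sup>2 / 2)) \<partial>lborel) =
       of_real (sqrt (2 * pi / V) * exp (- x\<^sup>2 / (2 * V)))"
proof -
  have meas: "(\<lambda>t. cis (x * t) * of_real (exp (- V * t\<^sup>2 / 2))) \<in> borel_measurable lborel"
    unfolding cis_conv_exp by measurable
  have "integrable lborel (\<lambda>t. exp (- (V / 2) * t\<^sup>2))" using V by (intro gaussian_integral) auto
  thus "integrable lborel (\<lambda>t. cis (x * t) * of_real (exp (- V * t\<^sup>2 / 2)))"
    by (rule Bochner_Integration.integrable_bound) (use meas in \<open>auto simp: norm_mult\<close>)
  define s where "s = x / sqrt V"
  have s_squared: "s\<^sup>2 = x\<^sup>2 / V" using V by (simp add: s_def power_divide)
  have "complex_of_real (exp (- (s\<^sup>2) / 2)) = char std_normal_distribution s"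
    by (simp add: char_std_normal_distribution)
  also have "\<dots> = (\<integral>t. std_normal_density t *\<^sub>R iexp (s * t) \<partial>lborel)"
    unfolding char_def by (subst integral_density) auto
  also have "\<dots> = \<bar>sqrt V\<bar> *\<^sub>R (\<integral>t. std_normal_density (0 + sqrt V * t) *\<^sub>R iexp (s * (0 + sqrt V * t)) \<partial>lborel)"
    using V by (intro lborel_integral_real_affine) auto
  also have "(\<lambda>t. std_normal_density (0 + sqrt V * t) *\<^sub>R iexp (s * (0 + sqrt V * t))) =
     (\<lambda>t. (1 / sqrt (2 * pi)) *\<^sub>R (cis (x * t) * of_real (exp (- V * t\<^sup>2 / 2))))"
    using V by (auto simp: std_normal_density_def s_def cis_conv_exp scaleR_conv_of_real power_mult_distrib)
  finally have "complex_of_real (exp (- (s\<^sup>2) / 2)) =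
      (sqrt V / sqrt (2 * pi)) *\<^sub>R (\<integral>t. cis (x * t) * of_real (exp (- V * t\<^sup>2 / 2)) \<partial>lborel)"
    using V by simp
  hence "(sqrt (2 * pi) / sqrt V) *\<^sub>R complex_of_real (exp (- (s\<^sup>2) / 2)) =
     (\<integral>t. cis (x * t) * of_real (exp (- V * t\<^sup>2 / 2)) \<partial>lborel)"
    using V by simp
  thus "(\<integral>t. cis (x * t) * of_real (exp (- V * t\<^sup>2 / 2)) \<partial>lborel) =
       of_real (sqrt (2 * pi / V) * exp (- x\<^sup>2 / (2 * V)))"
    by (simp add: s_squared real_sqrt_divide scaleR_conv_of_real mult.commute)
qed

lemma gaussian_fourier_truncated:
  fixes V x :: real
  assumes V: "V > 0"
  shows "norm (integral {-pi..pi} (\<lambda>t. cis (x * t) * of_real (exp (- V * t\<^sup>2 / 2))) -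
       of_real (sqrt (2 * pi / V) * exp (- x\<^sup>2 / (2 * V)))) \<le> 4 / (V * pi\<^sup>2) * sqrt (4 * pi / V)"
proof -
  define h where "h t = cis (x * t) * complex_of_real (exp (- V * t\<^sup>2 / 2))" for t
  note fourier = gaussian_fourier[OF V, of x, folded h_def]
  have set_integrable: "set_integrable lborel A h" if "A \<in> sets lborel" for A
    using fourier(1) that unfolding set_integrable_def by (intro integrable_mult_indicator) auto
  have "(LBINT t:{-pi..pi} \<union> - {-pi..pi}. h t) = (LBINT t:{-pi..pi}. h t) + (LBINT t:- {-pi..pi}. h t)"
    by (intro set_integral_Un set_integrable) auto
  hence "(\<integral>t. h t \<partial>lborel) = integral {-pi..pi} h + (LBINT t:- {-pi..pi}. h t)"
    using set_borel_integral_eq_integral(2)[OF set_integrable[of "{-pi..pi}"]]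
    by (simp add: set_lebesgue_integral_def)
  hence "norm (integral {-pi..pi} h - of_real (sqrt (2 * pi / V) * exp (- x\<^sup>2 / (2 * V)))) =
      norm (LBINT t:- {-pi..pi}. h t)"
    unfolding fourier(2) by (metis add_diff_cancel_left' norm_minus_commute)
  also have "\<dots> \<le> (LBINT t:- {-pi..pi}. norm (h t))"
    using set_integrable by (intro set_integral_norm_bound) auto
  also have "\<dots> = (LBINT t:- {-pi..pi}. exp (- (V / 2) * t\<^sup>2))"
    by (simp add: h_def norm_mult)
  also have "\<dots> \<le> 2 / (V / 2 * pi\<^sup>2) * sqrt (2 * pi / (V / 2))"
    using V by (intro gaussian_tail_le) auto
  finally show ?thesis unfolding h_def[symmetric] by simp
qed

section \<open>Normal approximation of sums of Bernoulli variables\<close>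

lemma has_integral_cis_int:
  "((\<lambda>t. cis (of_int m * t)) has_integral (if m = 0 then of_real (2 * pi) else 0)) {-pi..pi}"
proof (cases "m = 0")
  case True
  thus ?thesis using has_integral_const_real[of "1 :: complex" "-pi" pi] by (simp add: scaleR_conv_of_real)
next
  case False
  let ?f = "\<lambda>z. exp (\<i> * of_int m * z) / (\<i> * of_int m)"
  have "((\<lambda>t. exp (\<i> * of_int m * of_real t)) has_integral ?f (of_real pi) - ?f (of_real (- pi))) {-pi..pi}"
  proof (rule fundamental_theorem_of_calculus)
    fix t assume "t \<in> {-pi..pi}"
    have "(?f has_field_derivative exp (\<i> * of_int m * of_real t)) (at (of_real t))"
      using False by (auto intro!: derivative_eq_intros)
    thus "((\<lambda>t. ?f (of_real t)) has_vector_derivative exp (\<i> * of_int m * of_real t)) (at t within {-pi..pi})"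
      by (rule has_vector_derivative_real_field)
  qed auto
  moreover have "exp (\<i> * of_int m * of_real t) = cis (of_int m * t)" for t
    by (simp add: cis_conv_exp mult_ac)
  moreover have "cis (of_int m * pi) = cis (of_int m * (- pi))"
    by (simp add: complex_eq_iff mult.commute)
  ultimately show ?thesis using False by (simp only: if_False diff_self)
qed

definition dirichlet_sum :: "nat \<Rightarrow> real \<Rightarrow> complex" where
  "dirichlet_sum k t = (\<Sum>j<k. cis (- (real j * t)))"

lemma poly_cis_partial_sums:
  fixes F :: "real poly"
  shows "((\<lambda>t. poly (map_poly of_real F) (cis t) * dirichlet_sum k t) has_integral
     of_real (2 * pi * (\<Sum>j<k. coeff F j))) {-pi..pi}"
proof -
  let ?c = "\<lambda>l. complex_of_real (coeff F l)"
  have "poly (map_poly of_real F) (cis t) * dirichlet_sum k t =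
    (\<Sum>j<k. \<Sum>l\<le>degree F. ?c l * cis (of_int (int l - int j) * t))" for t
  proof -
    have "poly (map_poly of_real F) (cis t) = (\<Sum>l\<le>degree F. ?c l * cis (real l * t))"
      unfolding poly_altdef by (simp add: coeff_map_poly degree_map_poly Complex.DeMoivre)
    moreover have "cis (real l * t) * cis (- (real j * t)) = cis (of_int (int l - int j) * t)" for l j
      by (simp add: cis_mult algebra_simps)
    ultimately show ?thesis
      by (subst sum.swap) (simp add: dirichlet_sum_def sum_product mult.assoc)
  qed
  moreover have "((\<lambda>t. \<Sum>j<k. \<Sum>l\<le>degree F. ?c l * cis (of_int (int l - int j) * t)) has_integral
     (\<Sum>j<k. \<Sum>l\<le>degree F. ?c l * (if int l - int j = 0 then of_real (2 * pi) else 0))) {-pi..pi}"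
    by (intro has_integral_sum finite_atMost finite_lessThan has_integral_mult_right has_integral_cis_int)
  moreover have "(\<Sum>l\<le>degree F. ?c l * (if int l - int j = 0 then of_real (2 * pi) else 0)) =
      of_real (2 * pi * coeff F j)" for j
  proof -
    have "(\<Sum>l\<le>degree F. ?c l * (if int l - int j = 0 then of_real (2 * pi) else 0)) =
      (\<Sum>l\<le>degree F. if l = j then of_real (2 * pi * coeff F j) else 0)"
      by (intro sum.cong) auto
    thus ?thesis by (cases "j \<le> degree F") (auto simp: coeff_eq_0)
  qed
  ultimately show ?thesis by (simp add: sum_distrib_left)
qed

lemma norm_dirichlet_sum_le:
  assumes t: "t \<noteq> 0" "\<bar>t\<bar> \<le> pi"
  shows "norm (dirichlet_sum k t) \<le> pi / \<bar>t\<bar>"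
proof -
  define z where "z = cis (- t)"
  have "4 * t\<^sup>2 / pi\<^sup>2 \<le> 2 * (1 - cos t)" using one_minus_cos_ge[OF t(2)] by simp
  also have "\<dots> = (1 - cos t)\<^sup>2 + (sin t)\<^sup>2"
    using sin_cos_squared_add[of t] by (simp add: power2_eq_square algebra_simps)
  also have "\<dots> = (norm (1 - z))\<^sup>2" by (simp add: z_def cmod_power2)
  finally have "(2 * \<bar>t\<bar> / pi)\<^sup>2 \<le> (norm (1 - z))\<^sup>2" by (simp add: power_divide power_mult_distrib)
  hence chord: "2 * \<bar>t\<bar> / pi \<le> norm (1 - z)" by (rule power2_le_imp_le) simp
  have pos: "2 * \<bar>t\<bar> / pi > 0" using t by simp
  hence z1: "z \<noteq> 1" using chord by auto
  have "dirichlet_sum k t = (\<Sum>j<k. z ^ j)" by (simp add: dirichlet_sum_def z_def Complex.DeMoivre)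
  also have "\<dots> = (1 - z ^ k) / (1 - z)" using z1 by (simp add: sum_gp_strict)
  finally have "norm (dirichlet_sum k t) = norm (1 - z ^ k) / norm (1 - z)" by (simp only: norm_divide)
  also have "norm (1 - z ^ k) \<le> norm (1 :: complex) + norm (z ^ k)" by (rule norm_triangle_ineq4)
  also have "\<dots> = 2" by (simp add: norm_power z_def)
  also have "2 / norm (1 - z) \<le> 2 / (2 * \<bar>t\<bar> / pi)"
    using chord pos by (intro divide_left_mono mult_pos_pos) (auto intro: less_le_trans[OF pos])
  finally show ?thesis by (simp add: divide_right_mono)
qed

definition centred_bernoulli_char :: "real \<Rightarrow> real \<Rightarrow> complex" where
  "centred_bernoulli_char p t = of_real (1 - p) * cis (- (p * t)) + of_real p * cis ((1 - p) * t)"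

lemma centred_bernoulli_char_eq:
  "centred_bernoulli_char p t = (of_real (1 - p) + of_real p * cis t) * cis (- (p * t))"
  by (simp add: centred_bernoulli_char_def algebra_simps cis_mult)

lemma poly_bernoulli_gf_cis:
  "poly (map_poly complex_of_real (bernoulli_gf d p)) (cis t) =
     cis ((\<Sum>i<d. p i) * t) * (\<Prod>i<d. centred_bernoulli_char (p i) t)"
proof (induction d)
  case (Suc d)
  have "poly (map_poly complex_of_real [:1 - p d, p d:]) (cis t) =
      cis (p d * t) * centred_bernoulli_char (p d) t"
    unfolding centred_bernoulli_char_eq mult.left_commute[of "cis (p d * t)"]
    by (simp add: map_poly_pCons cis_mult mult.commute)
  thus ?case
    using Suc by (simp add: map_poly_hom_mult distrib_right flip: cis_mult del: mult_pCons_right)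
qed simp

lemma norm_centred_bernoulli_char_le:
  assumes p: "0 \<le> p" "p \<le> 1" and t: "\<bar>t\<bar> \<le> pi"
  shows "norm (centred_bernoulli_char p t) \<le> exp (- (2 / pi\<^sup>2) * (p * (1 - p)) * t\<^sup>2)"
proof -
  have "(norm (centred_bernoulli_char p t))\<^sup>2 = (1 - p + p * cos t)\<^sup>2 + (p * sin t)\<^sup>2"
    unfolding centred_bernoulli_char_eq norm_mult norm_cis by (simp add: cmod_power2)
  also have "\<dots> = (1 - p)\<^sup>2 + 2 * (1 - p) * p * cos t + p\<^sup>2 * ((sin t)\<^sup>2 + (cos t)\<^sup>2)"
    by algebra
  also have "\<dots> = 1 - 2 * (p * (1 - p)) * (1 - cos t)" by (simp add: power2_eq_square algebra_simps)
  also have "\<dots> \<le> exp (- (2 * (p * (1 - p)) * (1 - cos t)))"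
    using exp_ge_add_one_self[of "- (2 * (p * (1 - p)) * (1 - cos t))"] by simp
  also have "\<dots> \<le> exp (- (2 * (p * (1 - p)) * (2 * t\<^sup>2 / pi\<^sup>2)))"
    unfolding exp_le_cancel_iff neg_le_iff_le using p one_minus_cos_ge[OF t] by (intro mult_left_mono) auto
  also have "\<dots> = (exp (- (2 / pi\<^sup>2) * (p * (1 - p)) * t\<^sup>2))\<^sup>2"
    unfolding exp_double[symmetric] by (simp add: mult_ac)
  finally show ?thesis by (rule power2_le_imp_le) simp
qed

lemma norm_cis_taylor_le: "norm (cis x - (1 + \<i> * of_real x - of_real (x\<^sup>2 / 2))) \<le> \<bar>x\<bar> ^ 3 / 6"
proof -
  have "norm (iexp x - (\<Sum>k\<le>2. (\<i> * x) ^ k / fact k)) \<le> \<bar>x\<bar> ^ Suc 2 / fact (Suc 2)"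
    by (rule iexp_approx1)
  moreover have "(\<Sum>k\<le>2. (\<i> * complex_of_real x) ^ k / fact k) = 1 + \<i> * of_real x - of_real (x\<^sup>2 / 2)"
    by (simp add: numeral_2_eq_2) (simp add: complex_eq_iff)
  moreover have "fact (Suc 2) = (6 :: real)" by (simp add: numeral_2_eq_2)
  ultimately show ?thesis by (simp add: cis_conv_exp numeral_3_eq_3 numeral_2_eq_2)
qed

lemma abs_exp_minus_taylor_le:
  fixes x :: real
  assumes x: "x \<ge> 0"
  shows "\<bar>exp (- x) - (1 - x)\<bar> \<le> x\<^sup>2"
proof -
  have "exp (- x) \<le> 1 / (1 + x)"
    using exp_ge_add_one_self[of x] x by (simp add: exp_minus field_simps)
  also have "\<dots> \<le> 1 - x + x\<^sup>2"
  proof -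
    have "(1 - x + x\<^sup>2) * (1 + x) = 1 + x ^ 3" by (simp add: power2_eq_square power3_eq_cube algebra_simps)
    thus ?thesis using x by (simp add: divide_le_eq)
  qed
  finally show ?thesis using exp_ge_add_one_self[of "- x"] by (simp add: abs_if)
qed

lemma bernoulli_variance_bounds:
  fixes p :: real
  assumes "0 \<le> p" "p \<le> 1"
  shows "0 \<le> p * (1 - p)" "p * (1 - p) \<le> 1 / 4"
proof -
  show "0 \<le> p * (1 - p)" using assms by simp
  have "(p - 1 / 2)\<^sup>2 \<ge> 0" by simp
  thus "p * (1 - p) \<le> 1 / 4" by (simp add: power2_eq_square algebra_simps)
qed

lemma centred_bernoulli_char_taylor_le:
  assumes p: "0 \<le> p" "p \<le> 1"
  shows "norm (centred_bernoulli_char p t - of_real (1 - p * (1 - p) * t\<^sup>2 / 2)) \<le> p * (1 - p) * \<bar>t\<bar> ^ 3 / 6"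
    (is "norm ?l \<le> _")
proof -
  define q where "q = 1 - p"
  have q: "0 \<le> q" using p by (simp add: q_def)
  define err where "err x = cis x - (1 + \<i> * of_real x - of_real (x\<^sup>2 / 2))" for x
  have "q + p = 1" "p * q * t\<^sup>2 = q * (p * t)\<^sup>2 + p * (q * t)\<^sup>2"
    by (simp_all add: q_def power2_eq_square algebra_simps)
  hence "?l = of_real q * err (- (p * t)) + of_real p * err (q * t)"
    unfolding centred_bernoulli_char_def q_def[symmetric] err_def
    by (simp add: complex_eq_iff algebra_simps add_divide_distrib[symmetric])
  hence "norm ?l \<le> q * norm (err (- (p * t))) + p * norm (err (q * t))"
    using p q norm_triangle_ineq[of "of_real q * err (- (p * t))" "of_real p * err (q * t)"]
    by (simp add: norm_mult)
  also have "\<dots> \<le> q * (\<bar>- (p * t)\<bar> ^ 3 / 6) + p * (\<bar>q * t\<bar> ^ 3 / 6)"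
    using p q unfolding err_def by (intro add_mono mult_left_mono norm_cis_taylor_le)
  also have "\<dots> = p * q * \<bar>t\<bar> ^ 3 / 6 * (p\<^sup>2 + q\<^sup>2)"
    using p q by (simp add: abs_mult power_mult_distrib power2_eq_square power3_eq_cube
        algebra_simps add_divide_distrib)
  also have "\<dots> \<le> p * q * \<bar>t\<bar> ^ 3 / 6 * 1"
  proof (intro mult_left_mono)
    have "p\<^sup>2 + q\<^sup>2 = 1 - 2 * (p * (1 - p))" by (simp add: q_def power2_eq_square algebra_simps)
    thus "p\<^sup>2 + q\<^sup>2 \<le> 1" using bernoulli_variance_bounds[OF p] by simp
  qed (use p q in auto)
  finally show ?thesis by (simp add: q_def)
qed

lemma centred_bernoulli_char_gaussian_diff_le:
  assumes p: "0 \<le> p" "p \<le> 1" and t: "\<bar>t\<bar> \<le> pi"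
  shows "norm (centred_bernoulli_char p t - of_real (exp (- (p * (1 - p)) * t\<^sup>2 / 2))) \<le> p * (1 - p) * \<bar>t\<bar> ^ 3"
proof -
  define v where "v = p * (1 - p)"
  define x where "x = v * t\<^sup>2 / 2"
  have v: "0 \<le> v" "v \<le> 1 / 4" unfolding v_def using bernoulli_variance_bounds[OF p] by auto
  have "\<bar>exp (- x) - (1 - x)\<bar> \<le> x\<^sup>2" using v by (intro abs_exp_minus_taylor_le) (simp add: x_def)
  also have "\<dots> = v * \<bar>t\<bar> ^ 3 * (v * \<bar>t\<bar> / 4)"
    by (simp add: x_def power2_eq_square power3_eq_cube abs_mult[symmetric])
  also have "\<dots> \<le> v * \<bar>t\<bar> ^ 3 * (1 / 4 * 4 / 4)"
    using v t pi_less_4 by (intro mult_left_mono divide_right_mono mult_mono) auto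
  finally have "norm (complex_of_real (1 - x) - of_real (exp (- x))) \<le> v * \<bar>t\<bar> ^ 3 / 4"
    by (simp only: of_real_diff[symmetric] norm_of_real abs_minus_commute)
  moreover have "norm (centred_bernoulli_char p t - of_real (1 - x)) \<le> v * \<bar>t\<bar> ^ 3 / 6"
    unfolding x_def v_def by (rule centred_bernoulli_char_taylor_le[OF p])
  ultimately have "norm (centred_bernoulli_char p t - of_real (exp (- x))) \<le>
      v * \<bar>t\<bar> ^ 3 / 6 + v * \<bar>t\<bar> ^ 3 / 4"
    by (rule norm_diff_triangle_le[rotated])
  also have "\<dots> \<le> v * \<bar>t\<bar> ^ 3" using v by (simp add: field_simps)
  finally show ?thesis by (simp add: x_def v_def)
qed

lemma exp_bernoulli_variance_ge:
  fixes v :: real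
  assumes v: "0 \<le> v" "v \<le> 1 / 4" and t: "\<bar>t\<bar> \<le> pi"
  shows "1 / 2 \<le> exp (- (2 / pi\<^sup>2) * v * t\<^sup>2)"
proof -
  have "t\<^sup>2 \<le> pi\<^sup>2" using t power_mono[of "\<bar>t\<bar>" pi 2] by simp
  hence "2 / pi\<^sup>2 * (v * t\<^sup>2) \<le> 2 / pi\<^sup>2 * (1 / 4 * pi\<^sup>2)"
    using v by (intro mult_left_mono mult_mono) auto
  also have "\<dots> = 1 / 2" by simp
  finally have "exp (2 / pi\<^sup>2 * (v * t\<^sup>2)) \<le> exp (1 / 2)" by simp
  hence "exp (2 / pi\<^sup>2 * (v * t\<^sup>2)) \<le> 2" using exp_half_le2 by linarith
  hence "inverse 2 \<le> inverse (exp (2 / pi\<^sup>2 * (v * t\<^sup>2)))" by (intro le_imp_inverse_le) auto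
  thus ?thesis by (simp add: exp_minus mult.assoc)
qed

lemma norm_prod_diff_weighted:
  fixes y z :: "'i \<Rightarrow> 'a::{real_normed_algebra_1, comm_monoid_mult}"
  assumes "finite I"
    and "\<And>i. i \<in> I \<Longrightarrow> norm (y i) \<le> a i" and "\<And>i. i \<in> I \<Longrightarrow> norm (z i) \<le> a i"
    and "\<And>i. i \<in> I \<Longrightarrow> norm (y i - z i) \<le> \<delta> i * a i"
  shows "norm ((\<Prod>i\<in>I. y i) - (\<Prod>i\<in>I. z i)) \<le> (\<Sum>i\<in>I. \<delta> i) * (\<Prod>i\<in>I. a i)"
  using assms
proof (induction I rule: finite_induct)
  case (insert i I)
  have a: "0 \<le> a j" if "j \<in> insert i I" for j using insert.prems(1)[OF that] norm_ge_zero order.trans by blast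
  have "norm (prod z I) \<le> prod a I"
    using insert.prems(2) by (intro order.trans[OF norm_prod_le] prod_mono) auto
  hence "norm ((y i - z i) * prod z I) \<le> (\<delta> i * a i) * prod a I"
    using insert.prems(3)[of i] order.trans[OF norm_ge_zero insert.prems(3)[of i]]
    by (intro order.trans[OF norm_mult_ineq] mult_mono) auto
  moreover have "norm (y i * (prod y I - prod z I)) \<le> a i * ((\<Sum>i\<in>I. \<delta> i) * prod a I)"
    using insert a by (intro order.trans[OF norm_mult_ineq] mult_mono) auto
  moreover have "prod y (insert i I) - prod z (insert i I) =
      y i * (prod y I - prod z I) + (y i - z i) * prod z I"
    using insert.hyps by (simp add: algebra_simps)
  ultimately have "norm (prod y (insert i I) - prod z (insert i I)) \<le>
      a i * ((\<Sum>i\<in>I. \<delta> i) * prod a I) + (\<delta> i * a i) * prod a I"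
    using norm_triangle_mono by metis
  thus ?case using insert.hyps by (simp add: algebra_simps)
qed simp

locale bernoulli_sum =
  fixes d :: nat and p :: "nat \<Rightarrow> real"
  assumes p_bounds: "\<And>i. i < d \<Longrightarrow> 0 \<le> p i \<and> p i \<le> 1"
    and variance_pos: "0 < (\<Sum>i<d. p i * (1 - p i))"
begin

definition \<mu> :: real where "\<mu> = (\<Sum>i<d. p i)"

definition V :: real where "V = (\<Sum>i<d. p i * (1 - p i))"

definition \<phi> :: "real \<Rightarrow> complex" where
  "\<phi> t = poly (map_poly complex_of_real (bernoulli_gf d p)) (cis t)"

definition \<gamma> :: "real \<Rightarrow> complex" where
  "\<gamma> t = cis (\<mu> * t) * of_real (exp (- V * t\<^sup>2 / 2))"

lemma V_pos: "V > 0"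
  using variance_pos by (simp add: V_def)

lemma V_le_mean: "V \<le> \<mu>"
  unfolding V_def \<mu>_def using p_bounds by (intro sum_mono) (auto simp: mult_le_cancel_left2)

lemma norm_prod_centred_bernoulli_char_diff_le:
  assumes t: "\<bar>t\<bar> \<le> pi"
  shows "norm ((\<Prod>i<d. centred_bernoulli_char (p i) t) - of_real (exp (- V * t\<^sup>2 / 2)))
    \<le> 2 * V * \<bar>t\<bar> ^ 3 * exp (- (2 / pi\<^sup>2) * V * t\<^sup>2)"
proof -
  define v where "v i = p i * (1 - p i)" for i
  define a where "a i = exp (- (2 / pi\<^sup>2) * v i * t\<^sup>2)" for i
  define g where "g i = complex_of_real (exp (- v i * t\<^sup>2 / 2))" for i
  have v: "0 \<le> v i" "v i \<le> 1 / 4" if "i < d" for i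
    unfolding v_def using bernoulli_variance_bounds p_bounds[OF that] by auto
  have "2\<^sup>2 \<le> pi\<^sup>2" using pi_ge_two by (intro power_mono) auto
  hence "2 / pi\<^sup>2 \<le> 1 / 2" by (simp add: field_simps)
  hence "2 / pi\<^sup>2 * (v i * t\<^sup>2) \<le> 1 / 2 * (v i * t\<^sup>2)" if "i < d" for i
    using v(1)[OF that] by (intro mult_right_mono) auto
  hence g_le: "norm (g i) \<le> a i" if "i < d" for i
    using that by (simp add: g_def a_def mult.assoc)
  have char_le: "norm (centred_bernoulli_char (p i) t) \<le> a i" if "i < d" for i
    unfolding a_def v_def using p_bounds[OF that] t by (intro norm_centred_bernoulli_char_le) auto
  have diff_le: "norm (centred_bernoulli_char (p i) t - g i) \<le> (2 * v i * \<bar>t\<bar> ^ 3) * a i" if "i < d" for i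
  proof -
    have "1 \<le> 2 * a i" using exp_bernoulli_variance_ge[OF v[OF that] t] by (simp add: a_def)
    hence "v i * \<bar>t\<bar> ^ 3 * 1 \<le> v i * \<bar>t\<bar> ^ 3 * (2 * a i)"
      using v[OF that] by (intro mult_left_mono) auto
    moreover have "norm (centred_bernoulli_char (p i) t - g i) \<le> v i * \<bar>t\<bar> ^ 3"
      unfolding g_def v_def using p_bounds[OF that] t by (intro centred_bernoulli_char_gaussian_diff_le) auto
    ultimately show ?thesis by (simp add: mult_ac)
  qed
  have "norm ((\<Prod>i<d. centred_bernoulli_char (p i) t) - (\<Prod>i<d. g i)) \<le>
      (\<Sum>i<d. 2 * v i * \<bar>t\<bar> ^ 3) * (\<Prod>i<d. a i)"
    using char_le g_le diff_le by (intro norm_prod_diff_weighted) auto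
  also have "(\<Prod>i<d. g i) = of_real (exp (- V * t\<^sup>2 / 2))"
    by (simp add: g_def V_def v_def exp_sum sum_distrib_right sum_divide_distrib flip: sum_negf of_real_prod)
  also have "(\<Prod>i<d. a i) = exp (- (2 / pi\<^sup>2) * V * t\<^sup>2)"
    unfolding a_def V_def v_def sum_distrib_left sum_distrib_right by (rule exp_sum[symmetric]) simp
  also have "(\<Sum>i<d. 2 * v i * \<bar>t\<bar> ^ 3) = 2 * V * \<bar>t\<bar> ^ 3"
    by (simp add: V_def v_def sum_distrib_left sum_distrib_right)
  finally show ?thesis .
qed

lemma norm_char_diff_mult_dirichlet_sum_le:
  assumes t: "t \<in> {-pi..pi}"
  shows "norm ((\<phi> t - \<gamma> t) * dirichlet_sum k t) \<le> 2 * pi ^ 3 * exp (- (V / pi\<^sup>2) * t\<^sup>2)"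
proof (cases "t = 0")
  case True
  thus ?thesis unfolding \<phi>_def \<gamma>_def poly_bernoulli_gf_cis by (simp add: centred_bernoulli_char_def)
next
  case False
  define y where "y = V / pi\<^sup>2 * t\<^sup>2"
  have t_le: "\<bar>t\<bar> \<le> pi" using t by auto
  have "norm (\<phi> t - \<gamma> t) = norm ((\<Prod>i<d. centred_bernoulli_char (p i) t) - of_real (exp (- V * t\<^sup>2 / 2)))"
    unfolding \<phi>_def poly_bernoulli_gf_cis \<mu>_def[symmetric] \<gamma>_def
      right_diff_distrib[symmetric] norm_mult norm_cis by simp
  also have "\<dots> \<le> 2 * V * \<bar>t\<bar> ^ 3 * exp (- (2 / pi\<^sup>2) * V * t\<^sup>2)"
    by (rule norm_prod_centred_bernoulli_char_diff_le[OF t_le])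
  finally have "norm ((\<phi> t - \<gamma> t) * dirichlet_sum k t) \<le>
      2 * V * \<bar>t\<bar> ^ 3 * exp (- (2 / pi\<^sup>2) * V * t\<^sup>2) * (pi / \<bar>t\<bar>)"
    unfolding norm_mult using norm_dirichlet_sum_le[OF False t_le, of k] V_pos by (intro mult_mono) auto
  also have "\<dots> = 2 * pi ^ 3 * (y * exp (- 2 * y))"
    using False by (simp add: y_def power3_eq_cube power2_eq_square field_simps)
  also have "y \<le> exp y" using exp_ge_add_one_self[of y] by linarith
  hence "y * exp (- 2 * y) \<le> exp y * exp (- 2 * y)" by (intro mult_right_mono) auto
  also have "\<dots> = exp (- y)" by (simp flip: exp_add)
  finally show ?thesis by (simp add: y_def)
qed

lemma continuous_on_cis_gaussian:
  "continuous_on A (\<lambda>t. cis (x * t) * complex_of_real (exp (- V * t\<^sup>2 / 2)))"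
  unfolding cis_conv_exp by (intro continuous_intros) auto

lemma integrable_gaussian_mult_dirichlet_sum: "(\<lambda>t. \<gamma> t * dirichlet_sum k t) integrable_on {-pi..pi}"
proof -
  have "continuous_on {-pi..pi} (dirichlet_sum k)"
    unfolding dirichlet_sum_def cis_conv_exp by (intro continuous_intros)
  thus ?thesis
    unfolding \<gamma>_def by (intro integrable_continuous_real continuous_on_mult[OF continuous_on_cis_gaussian])
qed

lemma partial_sum_approx_gaussian_integral:
  "norm (of_real (2 * pi * (\<Sum>j<k. coeff (bernoulli_gf d p) j)) -
       integral {-pi..pi} (\<lambda>t. \<gamma> t * dirichlet_sum k t))
     \<le> 2 * pi * (pi\<^sup>2 * sqrt (pi ^ 3) / sqrt V)"
proof -
  let ?\<phi>K = "\<lambda>t. \<phi> t * dirichlet_sum k t" and ?\<gamma>K = "\<lambda>t. \<gamma> t * dirichlet_sum k t"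
  have \<phi>: "(?\<phi>K has_integral of_real (2 * pi * (\<Sum>j<k. coeff (bernoulli_gf d p) j))) {-pi..pi}"
    unfolding \<phi>_def by (rule poly_cis_partial_sums)
  hence "of_real (2 * pi * (\<Sum>j<k. coeff (bernoulli_gf d p) j)) - integral {-pi..pi} ?\<gamma>K =
      integral {-pi..pi} (\<lambda>t. (\<phi> t - \<gamma> t) * dirichlet_sum k t)"
    unfolding left_diff_distrib
    using integrable_gaussian_mult_dirichlet_sum by (simp add: integral_diff has_integral_iff)
  also have "norm \<dots> \<le> integral {-pi..pi} (\<lambda>t. 2 * pi ^ 3 * exp (- (V / pi\<^sup>2) * t\<^sup>2))"
  proof (rule integral_norm_bound_integral)
    show "(\<lambda>t. (\<phi> t - \<gamma> t) * dirichlet_sum k t) integrable_on {-pi..pi}"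
      unfolding left_diff_distrib
      using \<phi> integrable_gaussian_mult_dirichlet_sum by (intro integrable_diff) (auto simp: integrable_on_def)
    show "(\<lambda>t. 2 * pi ^ 3 * exp (- (V / pi\<^sup>2) * t\<^sup>2)) integrable_on {-pi..pi}"
      by (intro integrable_continuous_real continuous_intros)
  qed (rule norm_char_diff_mult_dirichlet_sum_le)
  also have "\<dots> \<le> 2 * pi ^ 3 * sqrt (pi / (V / pi\<^sup>2))"
    unfolding integral_mult_right using V_pos
    by (intro mult_left_mono gaussian_integral_interval_le) auto
  also have "sqrt (pi / (V / pi\<^sup>2)) = sqrt (pi ^ 3) / sqrt V"
    by (simp add: power3_eq_cube power2_eq_square mult_ac flip: real_sqrt_divide)
  also have "2 * pi ^ 3 * (sqrt (pi ^ 3) / sqrt V) = 2 * pi * (pi\<^sup>2 * sqrt (pi ^ 3) / sqrt V)"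
    by (simp add: power3_eq_cube power2_eq_square)
  finally show ?thesis .
qed

lemma two_pi_mult_normal_density:
  "2 * pi * normal_density \<mu> (sqrt V) x = sqrt (2 * pi / V) * exp (- (\<mu> - x)\<^sup>2 / (2 * V))"
proof -
  have "2 * pi * V * (2 * pi / V) = (2 * pi)\<^sup>2" using V_pos by (simp add: power2_eq_square)
  hence "sqrt (2 * pi * V) * sqrt (2 * pi / V) = 2 * pi"
    unfolding real_sqrt_mult[symmetric] by (simp only: real_sqrt_abs) simp
  hence "2 * pi * (1 / sqrt (2 * pi * V)) = sqrt (2 * pi / V)" using V_pos by (simp add: field_simps)
  thus ?thesis
    using V_pos
    by (simp only: normal_density_def power2_commute[of x] real_sqrt_pow2[OF less_imp_le]
        mult.assoc[symmetric])
qed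

lemma gaussian_integral_approx_lattice_sum:
  "norm (integral {-pi..pi} (\<lambda>t. \<gamma> t * dirichlet_sum k t) -
       of_real (2 * pi * (\<Sum>j<k. normal_density \<mu> (sqrt V) (real j)))) \<le> 2 * pi * (real k / (V * sqrt V))"
proof -
  let ?h = "\<lambda>j t. cis ((\<mu> - real j) * t) * complex_of_real (exp (- V * t\<^sup>2 / 2))"
  have "\<gamma> t * dirichlet_sum k t = (\<Sum>j<k. ?h j t)" for t
  proof -
    have "cis ((\<mu> - real j) * t) = cis (\<mu> * t) * cis (- (real j * t))" for j
      by (simp add: cis_mult algebra_simps)
    thus ?thesis unfolding \<gamma>_def dirichlet_sum_def sum_distrib_left
      by (intro sum.cong refl) (simp only: mult_ac)
  qed
  hence "integral {-pi..pi} (\<lambda>t. \<gamma> t * dirichlet_sum k t) = (\<Sum>j<k. integral {-pi..pi} (?h j))"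
    by (simp only:) (intro integral_sum finite_lessThan integrable_continuous_real continuous_on_cis_gaussian)
  hence "norm (integral {-pi..pi} (\<lambda>t. \<gamma> t * dirichlet_sum k t) -
      of_real (2 * pi * (\<Sum>j<k. normal_density \<mu> (sqrt V) (real j)))) =
      norm (\<Sum>j<k. integral {-pi..pi} (?h j) - of_real (sqrt (2 * pi / V) * exp (- (\<mu> - real j)\<^sup>2 / (2 * V))))"
    unfolding sum_distrib_left two_pi_mult_normal_density of_real_sum sum_subtractf by simp
  also have "\<dots> \<le> (\<Sum>j<k. 4 / (V * pi\<^sup>2) * sqrt (4 * pi / V))"
    by (intro order.trans[OF norm_sum sum_mono] gaussian_fourier_truncated V_pos)
  also have "\<dots> = 4 / pi\<^sup>2 * sqrt (4 * pi) * (real k / (V * sqrt V))"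
    by (simp add: real_sqrt_divide mult_ac)
  also have "\<dots> \<le> 2 * pi * (real k / (V * sqrt V))"
  proof (intro mult_right_mono)
    have "sqrt (4 * pi) \<le> sqrt 16" using pi_less_4 by (intro real_sqrt_le_mono) auto
    moreover have "4 / pi\<^sup>2 \<le> 4 / 2\<^sup>2" using pi_ge_two by (intro divide_left_mono power_mono) auto
    ultimately have "4 / pi\<^sup>2 * sqrt (4 * pi) \<le> 1 * 4" by (intro mult_mono) auto
    thus "4 / pi\<^sup>2 * sqrt (4 * pi) \<le> 2 * pi" using pi_ge_two by linarith
  qed (use V_pos in auto)
  finally show ?thesis .
qed

lemma partial_sum_approx_lattice_sum:
  "\<bar>(\<Sum>j<k. coeff (bernoulli_gf d p) j) - (\<Sum>j<k. normal_density \<mu> (sqrt V) (real j))\<bar>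
     \<le> 128 * (1 / sqrt V) + real k / (V * sqrt V)" (is "\<bar>?S - ?L\<bar> \<le> _")
proof -
  have "2 * pi * \<bar>?S - ?L\<bar> = \<bar>2 * pi * ?S - 2 * pi * ?L\<bar>"
    by (simp add: right_diff_distrib[symmetric] abs_mult)
  also have "\<dots> = norm (complex_of_real (2 * pi * ?S) - of_real (2 * pi * ?L))"
    by (simp only: of_real_diff[symmetric] norm_of_real)
  also have "\<dots> \<le> 2 * pi * (pi\<^sup>2 * sqrt (pi ^ 3) / sqrt V) + 2 * pi * (real k / (V * sqrt V))"
    by (rule norm_diff_triangle_le
        [OF partial_sum_approx_gaussian_integral gaussian_integral_approx_lattice_sum])
  also have "\<dots> = 2 * pi * (pi\<^sup>2 * sqrt (pi ^ 3) / sqrt V + real k / (V * sqrt V))"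
    by (simp only: distrib_left)
  finally have "\<bar>?S - ?L\<bar> \<le> pi\<^sup>2 * sqrt (pi ^ 3) / sqrt V + real k / (V * sqrt V)"
    by (rule mult_left_le_imp_le) simp
  also have "pi\<^sup>2 * sqrt (pi ^ 3) / sqrt V \<le> 4\<^sup>2 * sqrt (4 ^ 3) / sqrt V"
    using pi_less_4 V_pos by (intro divide_right_mono mult_mono power_mono real_sqrt_le_mono) auto
  also have "sqrt (4 ^ 3) = (8 :: real)" by (rule real_sqrt_unique) auto
  finally show ?thesis by simp
qed

theorem partial_sum_normal_approximation:
  "\<bar>(\<Sum>j<k. coeff (bernoulli_gf d p) j) - std_normal_Phi ((real k - \<mu>) / sqrt V)\<bar>
     \<le> 131 * (1 / sqrt V + real k / (V * sqrt V))"
proof -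
  have "- \<mu> / sqrt V \<le> - sqrt V"
    using V_le_mean V_pos by (simp add: field_simps)
  hence "std_normal_Phi (- \<mu> / sqrt V) \<le> std_normal_Phi (- sqrt V)" by (rule std_normal_Phi_mono)
  also have "\<dots> \<le> 1 / sqrt V" using V_pos by (intro std_normal_Phi_lower_tail) simp
  finally have "\<bar>std_normal_Phi (- \<mu> / sqrt V)\<bar> \<le> 1 / sqrt V" using std_normal_Phi_nonneg by simp
  moreover have "\<bar>(\<Sum>j<k. normal_density \<mu> (sqrt V) (real j)) -
      (std_normal_Phi ((real k - \<mu>) / sqrt V) - std_normal_Phi (- \<mu> / sqrt V))\<bar> \<le> 2 / sqrt V"
    using V_pos by (intro normal_density_riemann_sum) simp
  moreover have "0 \<le> real k / (V * sqrt V)" using V_pos by simp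
  ultimately show ?thesis
    using partial_sum_approx_lattice_sum[of k] unfolding distrib_left by linarith
qed

end

lemma gf_cdf_normal_approximation:
  assumes P: "P = smult c (bernoulli_gf d p)" "c \<noteq> 0" and p: "\<And>i. i < d \<Longrightarrow> 0 \<le> p i \<and> p i \<le> 1"
    and V: "gf_variance P > 0"
  shows "\<bar>gf_cdf P k - std_normal_Phi ((real k - gf_mean P) / sqrt (gf_variance P))\<bar>
    \<le> 131 * (1 / sqrt (gf_variance P) + real k / (gf_variance P * sqrt (gf_variance P)))"
proof -
  have variance: "gf_variance P = (\<Sum>i<d. p i * (1 - p i))"
    unfolding P(1) gf_variance_smult[OF P(2)] gf_variance_bernoulli_gf ..
  interpret bernoulli_sum d p
    using p V by unfold_locales (auto simp: variance)
  have "gf_variance P = V" unfolding variance V_def ..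
  moreover have "gf_mean P = \<mu>"
    unfolding P(1) gf_mean_smult[OF P(2)] gf_mean_bernoulli_gf \<mu>_def ..
  moreover have "gf_cdf P k = (\<Sum>j<k. coeff (bernoulli_gf d p) j)"
    unfolding P(1) gf_cdf_smult[OF P(2)] by (simp add: gf_cdf_def poly_bernoulli_gf)
  ultimately show ?thesis using partial_sum_normal_approximation by simp
qed

section \<open>The central limit theorem\<close>

lemma bounded_if_bigo_1:
  fixes f :: "nat \<Rightarrow> real"
  assumes "f \<in> O(\<lambda>_. 1)"
  obtains B where "\<And>n. \<bar>f n\<bar> \<le> B"
proof -
  obtain C where "C > 0" "\<forall>\<^sub>F n in sequentially. norm (f n) \<le> C * norm (1 :: real)"
    using landau_o.bigE[OF assms] by blast
  hence "\<forall>\<^sub>F n in sequentially. norm (f n) \<le> norm C" by simp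
  hence "Bseq f" by (rule Bseq_eventually_mono) simp
  thus ?thesis using that by (auto simp: Bseq_def)
qed

lemma std_normal_Phi_perturbation:
  assumes V: "V > 0" "V \<le> 4 * W" and x: "\<bar>x - y\<bar> \<le> A" and VW: "\<bar>V - W\<bar> \<le> B"
  shows "\<bar>std_normal_Phi (x / sqrt V) - std_normal_Phi (y / sqrt W)\<bar> \<le> A / sqrt V + 2 * (B / V)"
proof -
  define l where "l = sqrt (W / V)"
  have W: "W > 0" using V by linarith
  have "sqrt (1 / 4) \<le> l" unfolding l_def using V by (intro real_sqrt_le_mono) (simp add: field_simps)
  hence l: "1 / 2 \<le> l" by (simp add: real_sqrt_divide)
  have "\<bar>l - 1\<bar> \<le> \<bar>l - 1\<bar> * (l + 1)" using l by (simp add: mult_le_cancel_left1)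
  also have "\<dots> = \<bar>l\<^sup>2 - 1\<bar>"
    using l by (simp add: abs_mult power2_eq_square square_diff_one_factored mult.commute)
  also have "l\<^sup>2 - 1 = (W - V) / V" using V W by (simp add: l_def diff_divide_distrib)
  also have "\<bar>(W - V) / V\<bar> \<le> B / V" using V VW by (simp add: abs_minus_commute divide_right_mono)
  finally have l_diff: "\<bar>l - 1\<bar> \<le> B / V" .
  have "y / sqrt V = l * (y / sqrt W)" using V W by (simp add: l_def real_sqrt_divide)
  hence "\<bar>std_normal_Phi (y / sqrt V) - std_normal_Phi (y / sqrt W)\<bar> \<le> 2 * (B / V)"
    using std_normal_Phi_scale_diff[OF l, of "y / sqrt W"] l_diff by simp
  moreover have "\<bar>x / sqrt V - y / sqrt V\<bar> \<le> A / sqrt V"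
    using V x by (simp add: divide_right_mono flip: diff_divide_distrib)
  hence "\<bar>std_normal_Phi (x / sqrt V) - std_normal_Phi (y / sqrt V)\<bar> \<le> A / sqrt V"
    by (rule order.trans[OF std_normal_Phi_lipschitz])
  ultimately show ?thesis by linarith
qed

lemma normal_approximation_error_le:
  fixes v V :: real and k n :: nat
  assumes v: "v > 0" and n: "n \<ge> 1" and V: "V \<ge> v * real n / 2" and k: "k \<le> n + 1"
  shows "1 / V \<le> 2 / v / real n"
    and "1 / sqrt V \<le> sqrt (2 / v) / sqrt (real n)"
    and "1 / sqrt V + real k / (V * sqrt V) \<le> (1 + 4 / v) * sqrt (2 / v) / sqrt (real n)"
proof -
  have vn: "v * real n > 0" using v n by simp
  hence V_pos: "V > 0" using V by linarith
  have "1 / V \<le> 1 / (v * real n / 2)" using V vn V_pos by (intro divide_left_mono) auto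
  thus inv_V: "1 / V \<le> 2 / v / real n" by simp
  hence "sqrt (1 / V) \<le> sqrt (2 / v / real n)" by (rule real_sqrt_le_mono)
  thus inv_sqrt_V: "1 / sqrt V \<le> sqrt (2 / v) / sqrt (real n)" by (simp add: real_sqrt_divide real_sqrt_mult)
  have "real k \<le> 2 * real n" using k n by linarith
  hence "real k * (1 / V) \<le> 2 * real n * (2 / v / real n)"
    using inv_V V_pos by (intro mult_mono) auto
  also have "\<dots> = 4 / v" using n by simp
  finally have "real k * (1 / V) * (1 / sqrt V) \<le> 4 / v * (sqrt (2 / v) / sqrt (real n))"
    using inv_sqrt_V V_pos v by (intro mult_mono) auto
  thus "1 / sqrt V + real k / (V * sqrt V) \<le> (1 + 4 / v) * sqrt (2 / v) / sqrt (real n)"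
    using inv_sqrt_V by (simp add: distrib_right add_divide_distrib)
qed

locale linear_moments_approximation =
  fixes X :: "nat \<Rightarrow> nat pmf" and \<mu> V :: "nat \<Rightarrow> real" and e v B C :: real
  assumes support: "set_pmf (X n) \<subseteq> {..n}"
    and v_pos: "v > 0" and C_nonneg: "C \<ge> 0"
    and mean_linear: "\<bar>\<mu> n - e * real n\<bar> \<le> B"
    and variance_linear: "\<bar>V n - v * real n\<bar> \<le> B"
    and normal_approximation: "V n > 0 \<Longrightarrow>
      \<bar>measure_pmf.prob (X n) {..<k} - std_normal_Phi ((real k - \<mu> n) / sqrt (V n))\<bar>
        \<le> C * (1 / sqrt (V n) + real k / (V n * sqrt (V n)))"
begin

definition standardize :: "nat \<Rightarrow> real \<Rightarrow> real" where
  "standardize n y = (y - e * real n) / sqrt (v * real n)"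

definition error_const :: real where
  "error_const = C * ((1 + 4 / v) * sqrt (2 / v)) + ((1 + B) * sqrt (2 / v) + 4 * B / v)"

lemma B_nonneg: "B \<ge> 0"
  using order.trans[OF abs_ge_zero mean_linear] .

lemma error_const_nonneg: "error_const \<ge> 0"
  using v_pos B_nonneg C_nonneg by (simp add: error_const_def)

lemma standardize_mono: "x \<le> y \<Longrightarrow> standardize n x \<le> standardize n y"
  using v_pos by (simp add: standardize_def divide_right_mono)

lemma lattice_point_approximation:
  assumes n: "n \<ge> 1" "2 * B \<le> v * real n" and k: "k \<le> n + 1" "\<bar>real k - y\<bar> \<le> 1"
  shows "\<bar>measure_pmf.prob (X n) {..<k} - std_normal_Phi (standardize n y)\<bar> \<le> error_const / sqrt (real n)"
proof -
  have V: "V n \<ge> v * real n / 2" "V n \<le> 4 * (v * real n)"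
    using variance_linear[of n] n B_nonneg by (auto simp: abs_le_iff)
  have V_pos: "V n > 0" using less_le_trans[OF _ V(1)] v_pos n(1) by simp
  note error_le = normal_approximation_error_le[OF v_pos n(1) V(1) k(1)]
  have "\<bar>measure_pmf.prob (X n) {..<k} - std_normal_Phi ((real k - \<mu> n) / sqrt (V n))\<bar>
      \<le> C * ((1 + 4 / v) * sqrt (2 / v) / sqrt (real n))"
    using normal_approximation[OF V_pos] mult_left_mono[OF error_le(3) C_nonneg] by (rule order.trans)
  moreover have "\<bar>std_normal_Phi ((real k - \<mu> n) / sqrt (V n)) - std_normal_Phi (standardize n y)\<bar>
      \<le> (1 + B) / sqrt (V n) + 2 * (B / V n)"
    unfolding standardize_def using V_pos V(2) k(2) mean_linear[of n] variance_linear[of n]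
    by (intro std_normal_Phi_perturbation) auto
  moreover have "(1 + B) / sqrt (V n) \<le> (1 + B) * (sqrt (2 / v) / sqrt (real n))"
    using mult_left_mono[OF error_le(2), of "1 + B"] B_nonneg by simp
  moreover have "2 * (B / V n) \<le> 2 * (B * (2 / v / sqrt (real n)))"
  proof -
    have "sqrt (real n) \<le> real n" using n(1) by (simp add: real_le_lsqrt power2_eq_square)
    hence "2 / v / real n \<le> 2 / v / sqrt (real n)" using v_pos n(1) by (intro divide_left_mono) auto
    hence "1 / V n \<le> 2 / v / sqrt (real n)" using error_le(1) by linarith
    from mult_left_mono[OF this B_nonneg] show ?thesis by simp
  qed
  ultimately have "\<bar>measure_pmf.prob (X n) {..<k} - std_normal_Phi (standardize n y)\<bar> \<le>
      C * ((1 + 4 / v) * sqrt (2 / v) / sqrt (real n)) +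
      ((1 + B) * (sqrt (2 / v) / sqrt (real n)) + 2 * (B * (2 / v / sqrt (real n))))"
    by linarith
  also have "\<dots> = error_const / sqrt (real n)" by (simp add: error_const_def add_divide_distrib)
  finally show ?thesis .
qed

lemma prob_eq_1:
  assumes "y \<ge> real n"
  shows "measure_pmf.prob (X n) {j. real j \<le> y} = 1"
  using assms support[of n] by (intro measure_pmf.prob_eq_1[THEN iffD2]) (auto simp: AE_measure_pmf_iff)

lemma prob_le_approximation_large:
  assumes n: "n \<ge> 1" "2 * B \<le> v * real n"
  shows "\<bar>measure_pmf.prob (X n) {j. real j \<le> y} - std_normal_Phi (standardize n y)\<bar>
    \<le> error_const / sqrt (real n)"
proof -
  have mono: "std_normal_Phi (standardize n x) \<le> std_normal_Phi (standardize n z)" if "x \<le> z" for x z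
    using that by (intro std_normal_Phi_mono standardize_mono)
  consider "y < 0" | "y \<ge> real n" | "0 \<le> y" "y < real n" by linarith
  thus ?thesis
  proof cases
    case 1
    hence "{j. real j \<le> y} = {}" by auto
    thus ?thesis
      using lattice_point_approximation[OF n, of 0 0] mono[of y 0] std_normal_Phi_nonneg 1
      by (simp add: abs_le_iff)
  next
    case 2
    have "{..<n + 1} = {j. real j \<le> real n}" by auto
    hence "measure_pmf.prob (X n) {..<n + 1} = 1" using prob_eq_1[of n "real n"] by simp
    thus ?thesis
      using lattice_point_approximation[OF n, of "n + 1" "real n"] mono[OF 2] std_normal_Phi_le_1
        prob_eq_1[OF 2]
      by (auto simp: abs_le_iff)
  next
    case 3
    define k where "k = nat \<lfloor>y\<rfloor> + 1"
    have k: "real k = of_int \<lfloor>y\<rfloor> + 1" using 3 by (simp add: k_def)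
    have "{j. real j \<le> y} = {..<k}"
      using 3 by (auto simp: k_def le_nat_floor le_floor_iff le_nat_iff less_Suc_eq_le)
    moreover have "k \<le> n + 1" "\<bar>real k - y\<bar> \<le> 1" using 3 k by linarith+
    ultimately show ?thesis using lattice_point_approximation[OF n, of k y] by simp
  qed
qed

lemma prob_le_approximation:
  assumes n: "n \<ge> 1"
  shows "\<bar>measure_pmf.prob (X n) {j. real j \<le> y} - std_normal_Phi (standardize n y)\<bar>
    \<le> (error_const + sqrt (2 * B / v)) / sqrt (real n)"
proof (cases "2 * B \<le> v * real n")
  case True
  note prob_le_approximation_large[OF n True]
  also have "error_const / sqrt (real n) \<le> (error_const + sqrt (2 * B / v)) / sqrt (real n)"
    using v_pos B_nonneg by (intro divide_right_mono) auto
  finally show ?thesis .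
next
  case False
  have "0 \<le> measure_pmf.prob (X n) {j. real j \<le> y}" "measure_pmf.prob (X n) {j. real j \<le> y} \<le> 1" by simp_all
  hence "\<bar>measure_pmf.prob (X n) {j. real j \<le> y} - std_normal_Phi (standardize n y)\<bar> \<le> 1"
    using std_normal_Phi_nonneg[of "standardize n y"] std_normal_Phi_le_1[of "standardize n y"] by linarith
  also have "sqrt (real n) \<le> sqrt (2 * B / v)"
    using False v_pos by (intro real_sqrt_le_mono) (simp add: field_simps)
  hence "sqrt (real n) \<le> error_const + sqrt (2 * B / v)" using error_const_nonneg by linarith
  hence "1 \<le> (error_const + sqrt (2 * B / v)) / sqrt (real n)" using n by (simp add: le_divide_eq)
  finally show ?thesis .
qed

lemma central_limit_theorem:
  assumes n: "n \<ge> 1"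
  shows "\<bar>measure_pmf.prob (X n) {j. standardize n (real j) \<le> x} - std_normal_Phi x\<bar>
    \<le> (error_const + sqrt (2 * B / v)) / sqrt (real n)"
proof -
  define y where "y = e * real n + x * sqrt (v * real n)"
  have "sqrt (v * real n) > 0" using v_pos n by simp
  hence "{j. standardize n (real j) \<le> x} = {j. real j \<le> y}"
    by (auto simp: standardize_def y_def pos_divide_le_eq algebra_simps simp del: real_sqrt_gt_0_iff)
  moreover have "standardize n y = x" using v_pos n by (simp add: standardize_def y_def)
  ultimately show ?thesis using prob_le_approximation[OF n, of y] by simp
qed

end

theorem lattice_central_limit_theorem:
  fixes X :: "nat \<Rightarrow> nat pmf" and e v C :: real and \<mu> V :: "nat \<Rightarrow> real"
  assumes "\<And>n. set_pmf (X n) \<subseteq> {..n}" "v > 0" "C \<ge> 0"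
    and mean: "(\<lambda>n. \<mu> n - e * real n) \<in> O(\<lambda>_. 1)"
    and variance: "(\<lambda>n. V n - v * real n) \<in> O(\<lambda>_. 1)"
    and "\<And>n k. V n > 0 \<Longrightarrow> \<bar>measure_pmf.prob (X n) {..<k} - std_normal_Phi ((real k - \<mu> n) / sqrt (V n))\<bar>
      \<le> C * (1 / sqrt (V n) + real k / (V n * sqrt (V n)))"
  shows "\<exists>K. \<forall>n\<ge>1. \<forall>x.
    \<bar>measure_pmf.prob (X n) {j. (real j - e * real n) / sqrt (v * real n) \<le> x} - std_normal_Phi x\<bar>
      \<le> K / sqrt (real n)"
proof -
  obtain B1 where B1: "\<And>n. \<bar>\<mu> n - e * real n\<bar> \<le> B1" using bounded_if_bigo_1[OF mean] by blast
  obtain B2 where B2: "\<And>n. \<bar>V n - v * real n\<bar> \<le> B2" using bounded_if_bigo_1[OF variance] by blast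
  interpret linear_moments_approximation X \<mu> V e v "max B1 B2" C
    using assms B1 B2 by unfold_locales (auto simp: le_max_iff_disj)
  show ?thesis using central_limit_theorem unfolding standardize_def by blast
qed

section \<open>Occurrences of a digit in random words\<close>

context naf_parameters
begin

lemma bigo_geometric_imp_bigo_1:
  assumes "f \<in> O(\<lambda>n. real n ^ k * rho M w ^ n)"
  shows "f \<in> O(\<lambda>_. 1)"
proof -
  have "(\<lambda>n. real n ^ k * rho M w ^ n) \<in> O(\<lambda>_. 1)" using rho_bounds by real_asymp
  with assms show ?thesis by (rule landau_o.big_trans)
qed

lemma gf_mean_occurrence_gf_linear: "(\<lambda>n. gf_mean (occurrence_gf n) - e_coeff M w * real n) \<in> O(\<lambda>_. 1)"
proof -
  have "(\<lambda>n. gf_mean (occurrence_gf n) - main_mean n) \<in> O(\<lambda>_. 1)"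
    using gf_mean_occurrence_gf_asymptotics bigo_geometric_imp_bigo_1[where k = 1] by simp
  moreover have "(\<lambda>n. main_mean n - e_coeff M w * real n) \<in> O(\<lambda>_. 1)"
    by (simp add: main_mean_def)
  ultimately show ?thesis by (auto dest: sum_in_bigo)
qed

lemma gf_variance_occurrence_gf_linear:
  "(\<lambda>n. gf_variance (occurrence_gf n) - v_coeff M w * real n) \<in> O(\<lambda>_. 1)"
proof -
  have "(\<lambda>n. gf_variance (occurrence_gf n) - main_variance n) \<in> O(\<lambda>_. 1)"
    using gf_variance_occurrence_gf_asymptotics by (rule bigo_geometric_imp_bigo_1)
  moreover have "(\<lambda>n. main_variance n - v_coeff M w * real n) \<in> O(\<lambda>_. 1)"
    by (simp add: main_variance_def)
  ultimately show ?thesis by (auto dest: sum_in_bigo)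
qed

lemma v_coeff_pos:
  assumes "digit_count \<ge> 1"
  shows "v_coeff M w > 0"
proof -
  have "(M - 1) * (real w)\<^sup>2 + 2 * real w \<le> digit_count * ((M - 1) * (real w)\<^sup>2 + 2 * real w)"
    using mult_right_mono[OF assms, of "(M - 1) * (real w)\<^sup>2 + 2 * real w"] M_ge_1 by simp
  moreover have "M ^ (w - 1) * denom\<^sup>2 = digit_count * ((M - 1) * (real w)\<^sup>2 + 2 * real w) + M ^ (w - 1)"
    by (simp add: denom_def digit_count_def power2_eq_square algebra_simps)
  moreover have "M ^ (w - 1) > 0" using M_pos by simp
  ultimately have "M ^ (w - 1) * denom\<^sup>2 - ((M - 1) * (real w)\<^sup>2 + 2 * real w - 1) > 0" by linarith
  thus ?thesis unfolding v_coeff_def denom_def[symmetric] using M_pos denom_pos by (intro divide_pos_pos) auto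
qed

end

locale naf_digits = naf_parameters +
  fixes D :: "complex set"
  assumes finite_digits: "finite D" and zero_digit: "0 \<in> D"
    and card_digits: "real (card (D - {0})) = digit_count"
begin

lemma w_ge_1: "w \<ge> 1"
  using w_ge_2 by simp

lemma wNAF_count_asymptotics:
  "(\<lambda>n. real (wNAF_count D w n) - 1 / denom * M ^ (n + w)) \<in> O(\<lambda>n. (rho M w * M) ^ n)"
  using occurrence_gf_count_asymptotics
  by (simp add: wNAF_count_eq_naf_gf[OF w_ge_1 zero_digit finite_digits] card_digits
      occurrence_gf_def poly_naf_gf)

context
  fixes \<eta> :: complex
  assumes \<eta>: "\<eta> \<in> D - {0}"
begin

definition occurrence_count :: "nat \<Rightarrow> (int \<Rightarrow> complex) \<Rightarrow> nat" where
  "occurrence_count n \<xi> = card {j \<in> {0..<int n}. \<xi> j = \<eta>}"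

lemma occurrences_eq: "occurrences n \<eta> = (\<lambda>\<xi>. real (occurrence_count n \<xi>))"
  by (simp add: fun_eq_iff occurrences_def occurrence_count_def)

lemma counting_gf_occurrence_count: "counting_gf (wNAFs D w n) (occurrence_count n) = occurrence_gf n"
  using counting_gf_occurrences[OF w_ge_1 zero_digit finite_digits \<eta>, of n]
  unfolding occurrence_gf_def card_digits occurrence_count_def .

lemma digit_count_ge_1: "digit_count \<ge> 1"
proof -
  have "card (D - {0}) > 0" using \<eta> finite_digits by (auto simp: card_gt_0_iff)
  thus ?thesis unfolding card_digits[symmetric] by simp
qed

lemmas finite_words = finite_wNAFs[OF w_ge_1 zero_digit finite_digits]

lemma wNAFs_nonempty: "wNAFs D w n \<noteq> {}"
  using zero_digit by (auto simp: wNAFs_def is_wNAF_def intro!: exI[of _ "\<lambda>_. 0"])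

lemma expectation_occurrences_asymptotics:
  "(\<lambda>n. measure_pmf.expectation (random_wNAF D w n) (occurrences n \<eta>) - main_mean n)
     \<in> O(\<lambda>n. real n * rho M w ^ n)"
  unfolding random_wNAF_def occurrences_eq
    expectation_pmf_of_set_eq_gf_mean[OF finite_words wNAFs_nonempty] counting_gf_occurrence_count
  by (rule gf_mean_occurrence_gf_asymptotics)

lemma variance_occurrences_asymptotics:
  "(\<lambda>n. measure_pmf.variance (random_wNAF D w n) (occurrences n \<eta>) - main_variance n)
     \<in> O(\<lambda>n. (real n)\<^sup>2 * rho M w ^ n)"
  unfolding random_wNAF_def occurrences_eq
    variance_pmf_of_set_eq_gf_variance[OF finite_words wNAFs_nonempty] counting_gf_occurrence_count
  by (rule gf_variance_occurrence_gf_asymptotics)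

lemma gf_cdf_occurrence_gf_normal_approximation:
  assumes "gf_variance (occurrence_gf n) > 0"
  shows "\<bar>gf_cdf (occurrence_gf n) k
      - std_normal_Phi ((real k - gf_mean (occurrence_gf n)) / sqrt (gf_variance (occurrence_gf n)))\<bar>
    \<le> 131 * (1 / sqrt (gf_variance (occurrence_gf n))
        + real k / (gf_variance (occurrence_gf n) * sqrt (gf_variance (occurrence_gf n))))"
proof -
  obtain p d where p: "\<And>i. i < d \<Longrightarrow> 0 < p i \<and> p i < 1"
    and P: "occurrence_gf n = smult (naf_gf w (digit_count - 1 + 1) n) (bernoulli_gf d p)"
    unfolding occurrence_gf_def using naf_gf_eq_bernoulli_gf[of "digit_count - 1" w n] digit_count_ge_1
    by (metis diff_ge_0_iff_ge)
  have "naf_gf w (digit_count - 1 + 1) n \<ge> 1" using digit_count_ge_1 by (intro naf_gf_ge_1) simp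
  with p assms show ?thesis by (intro gf_cdf_normal_approximation[OF P]) (auto simp: less_imp_le)
qed

lemma occurrences_central_limit_theorem:
  "\<exists>C. \<forall>n\<ge>1. \<forall>x. \<bar>measure_pmf.prob (random_wNAF D w n)
       {\<xi>. (occurrences n \<eta> \<xi> - e_coeff M w * real n) / sqrt (v_coeff M w * real n) \<le> x}
     - std_normal_Phi x\<bar> \<le> C / sqrt (real n)"
proof -
  define X where "X n = map_pmf (occurrence_count n) (random_wNAF D w n)" for n
  have "occurrence_count n \<xi> \<le> card {0..<int n}" for n \<xi>
    unfolding occurrence_count_def by (intro card_mono) auto
  hence support: "set_pmf (X n) \<subseteq> {..n}" for n by (auto simp: X_def)
  have cdf: "measure_pmf.prob (X n) {..<k} = gf_cdf (occurrence_gf n) k" for n k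
    using prob_pmf_of_set_eq_gf_cdf[OF finite_words wNAFs_nonempty, of n "occurrence_count n" k]
    by (simp add: X_def random_wNAF_def counting_gf_occurrence_count vimage_def)
  have "\<exists>C. \<forall>n\<ge>1. \<forall>x.
      \<bar>measure_pmf.prob (X n) {j. (real j - e_coeff M w * real n) / sqrt (v_coeff M w * real n) \<le> x}
        - std_normal_Phi x\<bar> \<le> C / sqrt (real n)"
    using gf_cdf_occurrence_gf_normal_approximation
    by (intro lattice_central_limit_theorem[where C = 131, OF support v_coeff_pos[OF digit_count_ge_1] _
        gf_mean_occurrence_gf_linear gf_variance_occurrence_gf_linear]) (simp_all add: cdf)
  thus ?thesis by (simp add: X_def occurrences_eq vimage_def)
qed

end

end

theorem theorem5p1:
  fixes \<tau> :: complex and w :: nat and D :: "complex set" and M :: real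
  assumes "algebraic_int \<tau>" and "cmod \<tau> > 1" and "w \<ge> 2"
    and "reduced_residue_digit_set \<tau> w D"
    and M: "M = cmod (alg_norm \<tau>)"
  shows
    "(\<lambda>n. real (wNAF_count D w n) - 1 / ((M - 1) * real w + 1) * M ^ (n + w))
       \<in> O(\<lambda>n. (rho M w * M) ^ n)
     \<and> rho M w < 1
     \<and> (\<forall>\<eta>\<in>D - {0}.
        (\<lambda>n. measure_pmf.expectation (random_wNAF D w n) (occurrences n \<eta>)
             - (e_coeff M w * real n
                + (M - 1) * (real w - 1) * real w
                  / (M ^ (w - 1) * ((M - 1) * real w + 1)\<^sup>2)))
          \<in> O(\<lambda>n. real n * rho M w ^ n)
      \<and> (\<lambda>n. measure_pmf.variance (random_wNAF D w n) (occurrences n \<eta>)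
             - (v_coeff M w * real n
                + (real w - 1) * real w
                  * (- (real w - 1)\<^sup>2 - M\<^sup>2 * (real w)\<^sup>2
                     + (M - 1) * M ^ (w - 1) * ((M - 1) * real w + 1)\<^sup>2
                     + 2 * M * ((real w)\<^sup>2 - real w + 1))
                  / (M ^ (2 * w - 2) * ((M - 1) * real w + 1) ^ 4)))
          \<in> O(\<lambda>n. (real n)\<^sup>2 * rho M w ^ n)
      \<and> (\<exists>K. \<forall>n\<ge>1. \<forall>x.
           \<bar>measure_pmf.prob (random_wNAF D w n)
               {\<xi>. (occurrences n \<eta> \<xi> - e_coeff M w * real n) / sqrt (v_coeff M w * real n) \<le> x}
             - std_normal_Phi x\<bar> \<le> K / sqrt (real n)))"
proof -
  have "\<tau> \<noteq> 0" and w: "w \<ge> 1" using assms(2,3) by auto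
  obtain f where f: "is_min_int_poly \<tau> f" using algebraic_int_imp_min_int_poly[OF assms(1)] .
  define m where "m = nat \<bar>coeff f 0\<bar>"
  have m: "m \<ge> 1" using coeff_0_min_int_poly_nonzero[OF f \<open>\<tau> \<noteq> 0\<close>] by (simp add: m_def)
  have M_eq: "M = real m" by (simp add: M cmod_alg_norm_eq[OF f] m_def)
  interpret naf_parameters M w
    using m assms(3) by unfold_locales (simp_all add: M_eq)
  note D = card_reduced_residue_digit_set[OF f \<open>\<tau> \<noteq> 0\<close> assms(4) w, folded m_def]
  interpret naf_digits M w D
  proof
    show "0 \<in> D" using assms(4) by (simp add: reduced_residue_digit_set_def)
    show "real (card (D - {0})) = digit_count"
      unfolding D(2) digit_count_def using m by (simp add: M_eq of_nat_diff)
  qed (rule D)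
  show ?thesis
    using wNAF_count_asymptotics[unfolded denom_def] rho_bounds(2)
      expectation_occurrences_asymptotics[unfolded main_mean_def denom_def]
      variance_occurrences_asymptotics[unfolded main_variance_def denom_def]
      occurrences_central_limit_theorem
    by blast
qed

end
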